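(* Let $\varphi$ be a PEB-spline of order $m$ and let $X\subseteq\mathbb{R}$ be a separated set with multiplicity function $\mu_X:X\to\{0,\dots,m-2\}$. If the weighted maximum gap of $(X,\mu_X)$ satisfies $\mathfrak{mg}(X,\mu_X)<1$, then $(X,\mu_X)$ is a sampling set for $V^p(\varphi)$ ($1\le p\le\infty$).
   Context: PEB-splines. Let $m\in\mathbb{N}=\{1,2,\dots\}$ and $T_yf(x)=f(x-y)$. For $1\le s\le m$ let $\gamma_s\in\mathbb{R}$, let $r_s\in C^{m-s}(\mathbb{R})$ be strictly positive and $1$-periodic, and put $w_s(x)=e^{\gamma_s x}r_s(x)$. Let $u_1=w_1$ and $u_s(x)=w_1(x)\int_0^x w_2(x_2)\int_0^{x_2}w_3(x_3)\cdots\int_0^{x_{s-1}}w_s(x_s)\,dx_s\cdots dx_2$ for $2\le s\le m$, and $\mathcal{U}_m=\mathrm{span}_{\mathbb{C}}(u_1,\dots,u_m)$. The periodic exponential B-spline (PEB-spline) of order $m$ for these weights is the function $\varphi:\mathbb{R}\to\mathbb{R}$, unique up to a positive scalar factor, with $\varphi\in C^{m-2}(\mathbb{R})$ (no condition if $m=1$), $\mathrm{supp}\,\varphi=[0,m]$, $\varphi>0$ on $(0,m)$, and whose restriction to each interval $(\ell,\ell+1)$, $\ell\in\mathbb{Z}$, is the restriction of an element of $\mathcal{U}_m$. Shift-invariant space: $V^p(\varphi)=\{\sum_{\ell\in\mathbb{Z}}c_\ell\varphi(\cdot-\ell):(c_\ell)\in\ell^p(\mathbb{Z})\}\subseteq L^p(\mathbb{R})$.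 Sampling: $X$ is separated if $\inf_{x\ne y\in X}|x-y|>0$; it is labelled as a bi-infinite strictly increasing sequence $X=(x_j)_{j\in\mathbb{Z}}$. $(X,\mu_X)$ is a sampling set for $V^p(\varphi)$ if there are constants $A_p,B_p>0$ with $A_p\|f\|_p^p\le\sum_{x\in X}\sum_{s=0}^{\mu_X(x)}|f^{(s)}(x)|^p\le B_p\|f\|_p^p$ for all $f\in V^p(\varphi)$ (with suprema in place of sums if $p=\infty$). Weighted maximum gap: $\mathfrak{mg}(X,\mu_X)=\max\Big\{\sup_{j\in\mathbb{Z}}\frac{x_{j+1}-x_j}{1+\mu_X(x_j)},\ \sup_{j\in\mathbb{Z}}\frac{x_{j+1}-x_j}{1+\mu_X(x_{j+1})}\Big\}$. *)

theory Defs
  imports "HOL-Analysis.Analysis" "HOL-Probability.Essential_Supremum"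
begin

definition nderiv :: "nat \<Rightarrow> (real \<Rightarrow> 'a::real_normed_vector) \<Rightarrow> real \<Rightarrow> 'a" where
  "nderiv n f = ((\<lambda>g x. vector_derivative g (at x)) ^^ n) f"

definition C_k :: "nat \<Rightarrow> (real \<Rightarrow> 'a::real_normed_vector) \<Rightarrow> bool" where
  "C_k k f \<longleftrightarrow>
     (\<forall>j<k. \<forall>x. nderiv j f differentiable (at x)) \<and> continuous_on UNIV (nderiv k f)"

definition PEB_weights :: "nat \<Rightarrow> (nat \<Rightarrow> real \<Rightarrow> real) \<Rightarrow> bool" where
  "PEB_weights m w \<longleftrightarrow>
     (\<exists>(\<gamma> :: nat \<Rightarrow> real) (r :: nat \<Rightarrow> real \<Rightarrow> real). \<forall>s\<in>{1..m}.
        C_k (m - s) (r s) \<and> (\<forall>x. r s x > 0) \<and> (\<forall>x. r s (x + 1) = r s x) \<and>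
        (\<forall>x. w s x = exp (\<gamma> s * x) * r s x))"

text \<open>The iterated integral of the \<open>n\<close> weights \<open>w k, \<dots>, w (k + n - 1)\<close>, the weight
  \<open>w k\<close> being outermost. \<open>LBINT\<close> is the oriented integral, so negative \<open>x\<close> is covered.\<close>
primrec iter_int :: "(nat \<Rightarrow> real \<Rightarrow> real) \<Rightarrow> nat \<Rightarrow> nat \<Rightarrow> real \<Rightarrow> real" where
  "iter_int w k 0 x = 1"
| "iter_int w k (Suc n) x = (LBINT t=0..ereal x. w k t * iter_int w (Suc k) n t)"

definition PEB_u :: "(nat \<Rightarrow> real \<Rightarrow> real) \<Rightarrow> nat \<Rightarrow> real \<Rightarrow> real" where
  "PEB_u w s x = w 1 x * iter_int w 2 (s - 1) x"

text \<open>The complex span of \<open>PEB_u w 1, \<dots>, PEB_u w m\<close>.\<close>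
definition PEB_space :: "nat \<Rightarrow> (nat \<Rightarrow> real \<Rightarrow> real) \<Rightarrow> (real \<Rightarrow> complex) set" where
  "PEB_space m w =
     {g. \<exists>a :: nat \<Rightarrow> complex. g = (\<lambda>x. \<Sum>s=1..m. a s * complex_of_real (PEB_u w s x))}"

definition PEB_spline :: "nat \<Rightarrow> (real \<Rightarrow> real) \<Rightarrow> bool" where
  "PEB_spline m \<phi> \<longleftrightarrow>
     m \<ge> 1 \<and>
     (\<exists>w. PEB_weights m w \<and>
        (m \<ge> 2 \<longrightarrow> C_k (m - 2) \<phi>) \<and>
        closure {x. \<phi> x \<noteq> 0} = {0..real m} \<and>
        (\<forall>x\<in>{0<..<real m}. \<phi> x > 0) \<and>
        (\<forall>l :: int. \<exists>g\<in>PEB_space m w.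
           \<forall>x\<in>{of_int l<..<of_int l + 1}. complex_of_real (\<phi> x) = g x))"

definition in_lp :: "ereal \<Rightarrow> (int \<Rightarrow> complex) \<Rightarrow> bool" where
  "in_lp p c \<longleftrightarrow>
     (if p = \<infinity> then bounded (range c)
      else (\<lambda>l. norm (c l) powr real_of_ereal p) summable_on UNIV)"

definition shift_inv_space :: "ereal \<Rightarrow> (real \<Rightarrow> real) \<Rightarrow> (real \<Rightarrow> complex) set" where
  "shift_inv_space p \<phi> =
     {f. \<exists>c. in_lp p c \<and>
        f = (\<lambda>x. \<Sum>\<^sub>\<infinity>l\<in>UNIV. c l * complex_of_real (\<phi> (x - of_int l)))}"

text \<open>The \<open>p\<close>-th power of the \<open>L\<^sup>p\<close> norm for finite \<open>p\<close>, and the \<open>L\<^sup>\<infinity>\<close> norm itself for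
  \<open>p = \<infinity>\<close>; the same convention applies to \<open>sample_pow\<close>.\<close>
definition Lp_pow :: "ereal \<Rightarrow> (real \<Rightarrow> complex) \<Rightarrow> ennreal" where
  "Lp_pow p f =
     (if p = \<infinity> then esssup lborel (\<lambda>x. ennreal (norm (f x)))
      else (\<integral>\<^sup>+x. ennreal (norm (f x) powr real_of_ereal p) \<partial>lborel))"

definition sample_pow ::
  "ereal \<Rightarrow> real set \<Rightarrow> (real \<Rightarrow> nat) \<Rightarrow> (real \<Rightarrow> complex) \<Rightarrow> ennreal" where
  "sample_pow p X \<mu> f =
     (if p = \<infinity> then (SUP x\<in>X. SUP s\<in>{0..\<mu> x}. ennreal (norm (nderiv s f x)))
      else (\<Sum>\<^sub>\<infinity>x\<in>X. \<Sum>s=0..\<mu> x. ennreal (norm (nderiv s f x) powr real_of_ereal p)))"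

definition sampling_set ::
  "ereal \<Rightarrow> (real \<Rightarrow> real) \<Rightarrow> real set \<Rightarrow> (real \<Rightarrow> nat) \<Rightarrow> bool" where
  "sampling_set p \<phi> X \<mu> \<longleftrightarrow>
     (\<exists>A B :: real. A > 0 \<and> B > 0 \<and>
        (\<forall>f\<in>shift_inv_space p \<phi>.
           ennreal A * Lp_pow p f \<le> sample_pow p X \<mu> f \<and>
           sample_pow p X \<mu> f \<le> ennreal B * Lp_pow p f))"

definition separated :: "real set \<Rightarrow> bool" where
  "separated X \<longleftrightarrow>
     (INF (x, y)\<in>{(x, y). x \<in> X \<and> y \<in> X \<and> x \<noteq> y}. ereal \<bar>x - y\<bar>) > 0"

text \<open>Taken in the extended reals, so that unbounded gaps give \<open>\<infinity>\<close>.\<close>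
definition weighted_max_gap :: "(int \<Rightarrow> real) \<Rightarrow> (real \<Rightarrow> nat) \<Rightarrow> ereal" where
  "weighted_max_gap x \<mu> =
     max (SUP j. ereal ((x (j + 1) - x j) / (1 + real (\<mu> (x j)))))
         (SUP j. ereal ((x (j + 1) - x j) / (1 + real (\<mu> (x (j + 1))))))"

end

theory Submission
  imports Defs
begin

text \<open>All estimates are local. On a long window of integer knots, a spline that vanishes at the
  samples (with multiplicity) must vanish on the middle knot interval: otherwise consider the longest
  run of knot intervals \<open>(a, b)\<close> around it on which it does not vanish. Applying Rolle's theorem
  \<open>m - 1\<close> times, dividing by the next weight before each differentiation, turns \<open>Z\<close> zeros into sign
  changes of a function that is constant on knot intervals. Hence \<open>Z \<le> b - a - m\<close> if the spline
  vanishes on both sides of the run, because the zeros at \<open>a\<close> and \<open>b\<close> help at every step, and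
  \<open>Z \<le> b - a + m - 2\<close> in any case. A weighted gap at most \<open>g < 1\<close> gives \<open>Z \<ge> (b - a) / g - m + 1\<close>,
  which contradicts the first bound always and the second one for long runs.

  A compactness argument over all integer translates of the sampling set makes this quantitative:
  every coefficient is bounded by one sample in its window, up to a small multiple of a nearby
  coefficient. Summing \<open>p\<close>-th powers and absorbing the small terms gives the lower bound; the upper
  bound follows from local linear independence of the shifts.\<close>

section \<open>Smoothness classes and zeros of finite order\<close>

text \<open>One chain of differential operators serves all shifts at once. Because r_s is periodic,
  a shift by an integer \<open>l\<close> multiplies the weight w_s by the constant
  \<open>exp (- \<gamma> s * l)\<close>, so every combination of integer shifts of the spline has
  generalized derivatives with respect to the same weights. Differentiation alone would not do: it
  is the division by the weights that leads, after m - 1 steps, to a function constant on knot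
  intervals.

  Counting needs points between consecutive zeros where the spline is nonzero, and a spline may
  vanish on whole knot intervals. This is why it is done on runs without such intervals. The counted
  quantity must also keep track of signs, since the last function jumps at the knots and has no
  intermediate value property.

  No growth condition on the coefficients enters the counting. It therefore applies to limits of
  windows, whose outer coefficients are under no control, and the exponent p appears only in the
  final summation.\<close>

lemma nderiv_0 [simp]: "nderiv 0 f = f"
  by (simp add: nderiv_def)

lemma nderiv_Suc: "nderiv (Suc n) f = (\<lambda>x. vector_derivative (nderiv n f) (at x))"
  by (simp add: nderiv_def)

lemma nderiv_Suc_shift: "nderiv (Suc n) f = nderiv n (\<lambda>x. vector_derivative f (at x))"
  by (simp add: nderiv_def funpow_Suc_right del: funpow.simps)

lemma C_k_0: "C_k 0 f \<longleftrightarrow> continuous_on UNIV f"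
  by (simp add: C_k_def)

lemma C_k_Suc:
  "C_k (Suc k) f \<longleftrightarrow> (\<forall>x. f differentiable (at x)) \<and> C_k k (\<lambda>x. vector_derivative f (at x))"
  unfolding C_k_def nderiv_Suc_shift[symmetric]
  by (auto simp: less_Suc_eq_0_disj)

lemma C_k_SucI:
  assumes "\<And>x. (f has_vector_derivative f' x) (at x)" "C_k k f'"
  shows "C_k (Suc k) f"
proof -
  have "(\<lambda>x. vector_derivative f (at x)) = f'"
    using assms(1) by (auto intro: vector_derivative_at)
  then show ?thesis using assms unfolding C_k_Suc
    by (auto simp: has_vector_derivative_def differentiable_def)
qed

lemma C_k_Suc_deriv:
  "C_k (Suc k) f \<Longrightarrow> (f has_vector_derivative vector_derivative f (at x)) (at x)"
  unfolding C_k_Suc using vector_derivative_works by blast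

lemma C_k_differentiable: "C_k k f \<Longrightarrow> j < k \<Longrightarrow> nderiv j f differentiable (at x)"
  unfolding C_k_def by blast

lemma C_k_continuous_nderiv: "C_k k f \<Longrightarrow> j \<le> k \<Longrightarrow> continuous_on UNIV (nderiv j f)"
  unfolding C_k_def
  by (metis (no_types, lifting) UNIV_I continuous_at_imp_continuous_on
      differentiable_imp_continuous_within le_neq_implies_less)

lemma C_k_mono: "C_k k f \<Longrightarrow> j \<le> k \<Longrightarrow> C_k j f"
  using C_k_continuous_nderiv[of k f j] by (auto simp: C_k_def)

lemma C_k_add: "C_k k f \<Longrightarrow> C_k k g \<Longrightarrow> C_k k (\<lambda>x. f x + g x)"
proof (induction k arbitrary: f g)
  case 0
  then show ?case by (auto simp: C_k_0 intro!: continuous_intros)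
next
  case (Suc k)
  show ?case
  proof (rule C_k_SucI)
    show "((\<lambda>x. f x + g x) has_vector_derivative
       vector_derivative f (at x) + vector_derivative g (at x)) (at x)" for x
      by (intro has_vector_derivative_add C_k_Suc_deriv[OF Suc.prems(1)]
          C_k_Suc_deriv[OF Suc.prems(2)])
    show "C_k k (\<lambda>x. vector_derivative f (at x) + vector_derivative g (at x))"
      using Suc by (auto simp: C_k_Suc)
  qed
qed

lemma C_k_mult:
  fixes f g :: "real \<Rightarrow> real"
  shows "C_k k f \<Longrightarrow> C_k k g \<Longrightarrow> C_k k (\<lambda>x. f x * g x)"
proof (induction k arbitrary: f g)
  case 0
  then show ?case by (auto simp: C_k_0 intro!: continuous_intros)
next
  case (Suc k)
  have fk: "C_k k f" "C_k k g" using Suc.prems C_k_mono by (auto intro: C_k_mono)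
  show ?case
  proof (rule C_k_SucI)
    show "((\<lambda>x. f x * g x) has_vector_derivative
       f x * vector_derivative g (at x) + vector_derivative f (at x) * g x) (at x)" for x
      by (intro has_vector_derivative_mult C_k_Suc_deriv[OF Suc.prems(1)]
          C_k_Suc_deriv[OF Suc.prems(2)])
    show "C_k k (\<lambda>x. f x * vector_derivative g (at x) + vector_derivative f (at x) * g x)"
      using Suc fk by (intro C_k_add Suc.IH) (auto simp: C_k_Suc)
  qed
qed

lemma C_k_const: "C_k k (\<lambda>x. c)"
proof (induction k arbitrary: c)
  case (Suc k)
  show ?case by (rule C_k_SucI[where f'="\<lambda>_. 0"]) (auto simp: Suc)
qed (auto simp: C_k_0)

lemma C_k_exp: "C_k k (\<lambda>x. c * exp (\<gamma> * x) :: real)"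
proof (induction k arbitrary: c)
  case (Suc k)
  show ?case
    by (rule C_k_SucI[where f'="\<lambda>x. (c * \<gamma>) * exp (\<gamma> * x)"])
      (auto simp: Suc has_real_derivative_iff_has_vector_derivative[symmetric]
         intro!: derivative_eq_intros)
qed (auto simp: C_k_0 intro!: continuous_intros)

lemma C_k_inverse:
  fixes f :: "real \<Rightarrow> real"
  shows "C_k k f \<Longrightarrow> (\<And>x. f x \<noteq> 0) \<Longrightarrow> C_k k (\<lambda>x. inverse (f x))"
proof (induction k)
  case 0
  then show ?case by (auto simp: C_k_0 intro!: continuous_intros)
next
  case (Suc k)
  have i: "C_k k (\<lambda>x. inverse (f x))" using Suc C_k_mono[OF Suc.prems(1), of k] by auto
  show ?case
  proof (rule C_k_SucI)
    fix x
    have "(f has_real_derivative vector_derivative f (at x)) (at x)"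
      using C_k_Suc_deriv[OF Suc.prems(1)]
      by (simp add: has_real_derivative_iff_has_vector_derivative)
    then show "((\<lambda>x. inverse (f x)) has_vector_derivative
       ((-1) * vector_derivative f (at x)) * (inverse (f x) * inverse (f x))) (at x)"
      unfolding has_real_derivative_iff_has_vector_derivative[symmetric]
      by (auto intro!: derivative_eq_intros Suc.prems)
    show "C_k k (\<lambda>x. ((-1) * vector_derivative f (at x)) * (inverse (f x) * inverse (f x)))"
      using i Suc.prems(1) by (intro C_k_mult C_k_const) (auto simp: C_k_Suc)
  qed
qed

lemma nderiv_cong_open:
  assumes "open U" "\<And>x. x \<in> U \<Longrightarrow> f x = g x" "x \<in> U"
  shows "nderiv n f x = nderiv n g x"
  using assms(3)
proof (induction n arbitrary: x)
  case (Suc n)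
  have "eventually (\<lambda>y. y \<in> U) (nhds x)"
    using assms(1) Suc.prems eventually_nhds by blast
  then have "eventually (\<lambda>y. nderiv n f y = nderiv n g y) (nhds x)"
    by (rule eventually_mono) (use Suc.IH in auto)
  then show ?case unfolding nderiv_Suc
    by (intro vector_derivative_cong_eq) (auto simp: Suc.IH Suc.prems eventually_nhds_conv_at)
qed (use assms in auto)

lemma nderiv_zero [simp]: "nderiv n (\<lambda>x. 0) = (\<lambda>x. 0)"
  by (induction n) (auto simp: nderiv_Suc)

lemma has_vector_derivative_shift:
  "(f has_vector_derivative f') (at (x - a)) \<Longrightarrow> ((\<lambda>x. f (x - a)) has_vector_derivative f') (at x)"
  for a :: real
  using vector_diff_chain_at[of "\<lambda>x. x - a" 1 x f f']
  by (auto simp: o_def has_vector_derivative_diff_const has_vector_derivative_id)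

text \<open>The coefficients live in any normed space because zero counting works with real
  coefficients and sampling with complex ones.\<close>

lemma nderiv_lincomb:
  fixes c :: "'i \<Rightarrow> 'b::real_normed_vector" and \<phi> :: "real \<Rightarrow> real"
  assumes "C_k k \<phi>" "j \<le> k"
  shows "nderiv j (\<lambda>x. \<Sum>i\<in>F. \<phi> (x - a i) *\<^sub>R c i) = (\<lambda>x. \<Sum>i\<in>F. nderiv j \<phi> (x - a i) *\<^sub>R c i)"
  using assms(2)
proof (induction j)
  case (Suc j)
  have "((\<lambda>x. \<Sum>i\<in>F. nderiv j \<phi> (x - a i) *\<^sub>R c i) has_vector_derivative
      (\<Sum>i\<in>F. nderiv (Suc j) \<phi> (x - a i) *\<^sub>R c i)) (at x)" for x
  proof (intro has_vector_derivative_sum)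
    fix i
    have "(nderiv j \<phi> has_vector_derivative nderiv (Suc j) \<phi> (x - a i)) (at (x - a i))"
      using C_k_differentiable[OF assms(1), of j] Suc.prems vector_derivative_works
      by (auto simp: nderiv_Suc)
    from has_vector_derivative_shift[OF this]
    have "((\<lambda>x. nderiv j \<phi> (x - a i)) has_real_derivative nderiv (Suc j) \<phi> (x - a i)) (at x)"
      by (simp add: has_real_derivative_iff_has_vector_derivative)
    from has_vector_derivative_scaleR[OF this has_vector_derivative_const[of "c i"]]
    show "((\<lambda>x. nderiv j \<phi> (x - a i) *\<^sub>R c i) has_vector_derivative
       nderiv (Suc j) \<phi> (x - a i) *\<^sub>R c i) (at x)" by simp
  qed
  then show ?case using Suc by (auto simp: nderiv_Suc intro!: vector_derivative_at)
qed simp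

lemma C_k_lincomb:
  fixes c :: "'i \<Rightarrow> 'b::real_normed_vector" and \<phi> :: "real \<Rightarrow> real"
  assumes "C_k k \<phi>"
  shows "C_k k (\<lambda>x. \<Sum>i\<in>F. \<phi> (x - a i) *\<^sub>R c i)"
  unfolding C_k_def
proof (intro conjI allI impI)
  fix j x assume "j < k"
  then have "(\<lambda>x. nderiv j \<phi> (x - a i)) differentiable at x" for i
    using C_k_differentiable[OF assms, of j "x - a i"] vector_derivative_works
      has_vector_derivative_shift differentiableI_vector by metis
  then show "nderiv j (\<lambda>x. \<Sum>i\<in>F. \<phi> (x - a i) *\<^sub>R c i) differentiable at x"
    using \<open>j < k\<close>
    by (subst nderiv_lincomb[OF assms], simp, cases "finite F") (simp_all add: differentiable_sum)
next
  have "continuous_on UNIV (\<lambda>x. nderiv k \<phi> (x - a i))" for i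
    by (rule continuous_on_compose2[OF C_k_continuous_nderiv[OF assms order_refl]])
      (auto intro!: continuous_intros)
  then show "continuous_on UNIV (nderiv k (\<lambda>x. \<Sum>i\<in>F. \<phi> (x - a i) *\<^sub>R c i))"
    by (subst nderiv_lincomb[OF assms order_refl]) (auto intro!: continuous_intros)
qed

definition zero_order :: "nat \<Rightarrow> (real \<Rightarrow> real) \<Rightarrow> real \<Rightarrow> bool" where
  "zero_order n f y \<longleftrightarrow> (\<forall>s<n. nderiv s f y = 0)"

lemma zero_order_Suc:
  "zero_order (Suc n) f y \<longleftrightarrow> f y = 0 \<and> zero_order n (\<lambda>x. vector_derivative f (at x)) y"
  unfolding zero_order_def nderiv_Suc_shift[symmetric]
  by (auto simp: less_Suc_eq_0_disj)

lemma zero_order_add: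
  "C_k k f \<Longrightarrow> C_k k g \<Longrightarrow> n \<le> Suc k \<Longrightarrow> zero_order n f y \<Longrightarrow> zero_order n g y
   \<Longrightarrow> zero_order n (\<lambda>x. f x + g x) y"
proof (induction n arbitrary: f g k)
  case (Suc n)
  show ?case
  proof (cases "n = 0")
    case False
    then obtain k' where k: "k = Suc k'" using Suc.prems(3) by (cases k) auto
    have "(\<lambda>x. vector_derivative (\<lambda>x. f x + g x) (at x))
      = (\<lambda>x. vector_derivative f (at x) + vector_derivative g (at x))"
      using Suc.prems C_k_Suc_deriv unfolding k
      by (auto intro!: vector_derivative_at has_vector_derivative_add)
    then show ?thesis using Suc.prems Suc.IH[of k'] by (auto simp: zero_order_Suc k C_k_Suc)
  qed (use Suc.prems in \<open>auto simp: zero_order_def\<close>)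
qed (auto simp: zero_order_def)

text \<open>The product rule, iterated. The second factor will be the reciprocal of a weight:
  dividing by a weight keeps every zero whose order the smoothness class can express.\<close>

lemma zero_order_mult:
  "C_k k f \<Longrightarrow> C_k k g \<Longrightarrow> n \<le> Suc k \<Longrightarrow> zero_order n f y
   \<Longrightarrow> zero_order n (\<lambda>x. f x * g x) y"
proof (induction n arbitrary: f g k)
  case (Suc n)
  show ?case
  proof (cases "n = 0")
    case False
    then obtain k' where k: "k = Suc k'" using Suc.prems(3) by (cases k) auto
    have d: "(\<lambda>x. vector_derivative (\<lambda>x. f x * g x) (at x))
      = (\<lambda>x. f x * vector_derivative g (at x) + vector_derivative f (at x) * g x)"
      using Suc.prems C_k_Suc_deriv unfolding k
      by (auto intro!: vector_derivative_at has_vector_derivative_mult)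
    have *: "C_k k' f" "C_k k' g" "C_k k' (\<lambda>x. vector_derivative g (at x))"
       "C_k k' (\<lambda>x. vector_derivative f (at x))"
      using Suc.prems C_k_mono[of k _ k'] by (auto simp: k C_k_Suc)
    have z: "zero_order n f y" "zero_order n (\<lambda>x. vector_derivative f (at x)) y" "f y = 0"
      using Suc.prems(4) zero_order_Suc[of n f] unfolding zero_order_def
      by (blast intro: less_SucI)+
    show ?thesis unfolding zero_order_Suc d
      using z * Suc.prems(3) k
      by (auto intro!: zero_order_add[of k'] C_k_mult Suc.IH[of k'])
  qed (use Suc.prems in \<open>auto simp: zero_order_def\<close>)
qed (auto simp: zero_order_def)

section \<open>Rolle's theorem with multiplicities\<close>

text \<open>What the zero count needs to know about two consecutive generalized derivatives. It asks
  for a sign of \<open>h\<close>, not for a zero, because the last \<open>h\<close> is not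
  continuous.\<close>

definition rolle :: "(real \<Rightarrow> real) \<Rightarrow> (real \<Rightarrow> real) \<Rightarrow> bool" where
  "rolle g h \<longleftrightarrow> (\<forall>s t. s < t \<longrightarrow> g s \<noteq> g t \<longrightarrow> (\<exists>u\<in>{s<..<t}. h u * (g t - g s) > 0))"

text \<open>If \<open>h\<close> had weakly the wrong sign throughout, so would the integral of
  \<open>w x * h x\<close>, which is the increment of \<open>g\<close>. The knots in [s, t] are
  finitely many, hence admissible exceptional points of the fundamental theorem.\<close>

lemma rolleI:
  fixes g h w :: "real \<Rightarrow> real"
  assumes cont: "continuous_on UNIV g" and w: "\<And>x. w x > 0"
    and der: "\<And>x. x \<notin> \<int> \<Longrightarrow> (g has_real_derivative w x * h x) (at x)"
  shows "rolle g h"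
  unfolding rolle_def
proof (intro allI impI, rule ccontr)
  fix s t :: real
  assume st: "s < t" "g s \<noteq> g t" and no: "\<not> (\<exists>u\<in>{s<..<t}. h u * (g t - g s) > 0)"
  define d where "d = g t - g s"
  have fin: "finite (\<int> \<inter> {s..t})"
    using finite_int_segment[of s t] by (simp add: Int_def)
  have "((\<lambda>x. if x \<in> \<int> then 0 else w x * h x) has_integral (g t - g s)) {s..t}"
    using fin
  proof (rule fundamental_theorem_of_calculus_interior_strong)
    show "continuous_on {s..t} g" using cont continuous_on_subset by blast
    fix x assume "x \<in> {s<..<t} - \<int> \<inter> {s..t}"
    then show "(g has_vector_derivative (if x \<in> \<int> then 0 else w x * h x)) (at x)"
      using der by (auto simp: has_real_derivative_iff_has_vector_derivative)
  qed (use st in auto)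
  then have "((\<lambda>x. - (if x \<in> \<int> then 0 else w x * h x) * d) has_integral - (g t - g s) * d) {s..t}"
    by (intro has_integral_mult_left has_integral_neg)
  then have i: "((\<lambda>x. - (if x \<in> \<int> then 0 else w x * h x) * d) has_integral - (g t - g s) * d) {s<..<t}"
    by (simp add: has_integral_Icc_iff_Ioo)
  have "0 \<le> - (g t - g s) * d"
  proof (rule has_integral_nonneg[OF i])
    fix x assume "x \<in> {s<..<t}"
    then have "h x * d \<le> 0" using no unfolding d_def by (metis leI)
    then have "w x * (h x * d) \<le> 0" using w[of x] by (simp add: mult_le_0_iff)
    then show "0 \<le> - (if x \<in> \<int> then 0 else w x * h x) * d" by (simp add: mult.assoc)
  qed
  moreover have "(g t - g s) * d > 0" using st unfolding d_def
    by (metis eq_iff_diff_eq_0 not_real_square_gt_zero)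
  ultimately show False by linarith
qed

text \<open>The number \<open>n\<close> counts zeros of \<open>G i\<close> between \<open>a\<close> and \<open>t\<close>. A step of weight \<open>e\<close> is a sign change
  by \<open>(-1)\<^sup>e\<close> across a zero of order at least \<open>e - 1\<close>: a zero of order \<open>v\<close> is thus worth \<open>v\<close> or \<open>v + 1\<close>,
  whichever has the parity of the sign change, and passing to \<open>G (i + 1)\<close> lowers the weight by
  exactly one. At the top level \<open>m\<close> only plain sign changes remain.\<close>
inductive osc :: "(nat \<Rightarrow> real \<Rightarrow> real) \<Rightarrow> real \<Rightarrow> nat \<Rightarrow> nat \<Rightarrow> nat \<Rightarrow> real \<Rightarrow> bool"
  for G a m i where
  start: "a < t \<Longrightarrow> G i t \<noteq> 0 \<Longrightarrow> osc G a m i 0 t"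
| step: "osc G a m i n s \<Longrightarrow> s < y \<Longrightarrow> y < t \<Longrightarrow> 1 \<le> e \<Longrightarrow> i + e \<le> m + 1 \<Longrightarrow>
    (\<And>j. i \<le> j \<Longrightarrow> j + 1 < i + e \<Longrightarrow> G j y = 0) \<Longrightarrow> G i t * G i s * (-1) ^ e > 0 \<Longrightarrow>
    osc G a m i (n + e) t"

lemma osc_nonzero: "osc G a m i n t \<Longrightarrow> G i t \<noteq> 0"
  by (induction rule: osc.induct) auto

lemma osc_gt: "osc G a m i n t \<Longrightarrow> a < t"
  by (induction rule: osc.induct) auto

text \<open>The weak inequality covers both a sign change between the two points and the departure
  from a zero at \<open>s\<close>; \<open>rolleD'\<close> covers the approach to a zero at
  \<open>t\<close>.\<close>

lemma rolleD:
  assumes "rolle g h" "s < t" "g s * g t \<le> 0" "g t \<noteq> 0"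
  obtains u where "s < u" "u < t" "h u * g t > 0"
proof -
  have ne: "g s \<noteq> g t" using assms(3,4) by (auto simp: mult_le_0_iff)
  then obtain u where u: "u \<in> {s<..<t}" "h u * (g t - g s) > 0"
    using assms(1,2) unfolding rolle_def by metis
  have "h u * g t > 0"
    using u(2) assms(3,4) by (auto simp: zero_less_mult_iff mult_le_0_iff)
  with u that show ?thesis by auto
qed

lemma rolleD':
  assumes "rolle g h" "s < t" "g s * g t \<le> 0" "g s \<noteq> 0"
  obtains u where "s < u" "u < t" "h u * g s < 0"
proof -
  have ne: "g s \<noteq> g t" using assms(3,4) by (auto simp: mult_le_0_iff)
  then obtain u where u: "u \<in> {s<..<t}" "h u * (g t - g s) > 0"
    using assms(1,2) unfolding rolle_def by metis
  have "h u * g s < 0"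
    using u(2) assms(3,4) by (auto simp: zero_less_mult_iff mult_le_0_iff mult_less_0_iff)
  with u that show ?thesis by auto
qed

lemma osc_sign_change:
  assumes "osc G a m i n s" "s < t" "G i t * G i s < 0" "i \<le> m"
  shows "osc G a m i (n + 1) t"
  using osc.step[of G a m i n s "(s+t)/2" t 1] assms by auto

text \<open>For e = 1 a single point between \<open>s\<close> and \<open>t\<close> serves as
  \<open>v\<close> and \<open>t'\<close>. For larger e, \<open>G i\<close> runs towards its zero
  \<open>y\<close> and away from it again, which gives \<open>v\<close> before and \<open>t'\<close>
  after \<open>y\<close>, with \<open>y\<close> still a zero of weight e - 1 one level up. The last
  clause is an implication in \<open>k\<close> because the count at \<open>v\<close> depends on what
  lies to the left of \<open>s\<close>.\<close>

lemma rolle_gap: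
  assumes r: "rolle (G i) (G (Suc i))" and im: "i < m"
    and gap: "s < y" "y < t" "1 \<le> e" "i + e \<le> m + 1"
      "\<And>j. i \<le> j \<Longrightarrow> j + 1 < i + e \<Longrightarrow> G j y = 0" "G i t * G i s * (-1) ^ e > 0"
  shows "\<exists>v t'. s < v \<and> v \<le> t' \<and> t' < t \<and> G (Suc i) v * G i s < 0 \<and> G (Suc i) t' * G i t > 0 \<and>
    (\<forall>k. osc G a m (Suc i) k v \<longrightarrow> osc G a m (Suc i) (k + (e - 1)) t')"
proof (cases "e = 1")
  case True
  then have sg: "G i s * G i t < 0" using gap(6) by (simp add: mult.commute)
  obtain u where u: "s < u" "u < t" "G (Suc i) u * G i t > 0"
    by (rule rolleD[OF r, of s t]) (use gap(1,2) sg in auto)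
  have "G (Suc i) u * G i s < 0"
    using u(3) sg by (auto simp: mult_less_0_iff zero_less_mult_iff)
  then show ?thesis using u True by (intro exI[of _ u]) simp
next
  case False
  then have y: "G i y = 0" using gap by auto
  have nz: "G i s \<noteq> 0" "G i t \<noteq> 0" using gap(6) by auto
  obtain v where v: "s < v" "v < y" "G (Suc i) v * G i s < 0"
    by (rule rolleD'[OF r gap(1)]) (use y nz in auto)
  obtain u where u: "y < u" "u < t" "G (Suc i) u * G i t > 0"
    by (rule rolleD[OF r gap(2)]) (use y nz in auto)
  obtain e' where e': "e = Suc e'" "1 \<le> e'" using False gap(3) by (cases e) auto
  \<comment> \<open>Compared with the pair (s, t), exactly one of the two signs has flipped, which
    matches the drop of the weight by one.\<close>
  have sgn: "G (Suc i) u * G (Suc i) v * (-1) ^ e' > 0"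
  proof -
    have "(G i t * G i s * (-1) ^ e) * ((G (Suc i) u * G i t) * (- (G (Suc i) v * G i s))) > 0"
      using u(3) v(3) gap(6) by (simp only: mult_pos_pos neg_0_less_iff_less)
    also have "(G i t * G i s * (-1) ^ e) * ((G (Suc i) u * G i t) * (- (G (Suc i) v * G i s)))
      = (G i t)\<^sup>2 * (G i s)\<^sup>2 * (G (Suc i) u * G (Suc i) v * (-1) ^ e')"
      by (simp add: e' power2_eq_square)
    finally have "0 < ((G i t)\<^sup>2 * (G i s)\<^sup>2) * (G (Suc i) u * G (Suc i) v * (-1) ^ e')" .
    moreover have "0 < (G i t)\<^sup>2 * (G i s)\<^sup>2" using nz by simp
    ultimately show ?thesis using zero_less_mult_pos by blast
  qed
  have "osc G a m (Suc i) (k + e') u" if "osc G a m (Suc i) k v" for k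
    by (rule osc.step[OF that v(2) u(1) e'(2) _ _ sgn]) (use gap(4,5) e' in auto)
  then show ?thesis using v u e' by (intro exI[of _ v] exI[of _ u]) simp
qed

text \<open>The weight lost at \<open>y\<close> is regained: \<open>G (Suc i)\<close> agrees in sign
  with \<open>G i s\<close> at \<open>u\<close> and opposes it at \<open>v\<close>, which is one
  additional sign change between the previous zero and \<open>y\<close>.\<close>

lemma rolle_step:
  assumes "rolle (G i) (G (Suc i))" "i < m"
    and "s < y" "y < t" "1 \<le> e" "i + e \<le> m + 1"
      "\<And>j. i \<le> j \<Longrightarrow> j + 1 < i + e \<Longrightarrow> G j y = 0" "G i t * G i s * (-1) ^ e > 0"
    and u: "osc G a m (Suc i) k u" "u < s" "G (Suc i) u * G i s > 0"
  shows "\<exists>t'<t. osc G a m (Suc i) (k + e) t' \<and> G (Suc i) t' * G i t > 0"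
proof -
  obtain v t' where v: "s < v" "v \<le> t'" "t' < t" "G (Suc i) v * G i s < 0" "G (Suc i) t' * G i t > 0"
    "\<And>k. osc G a m (Suc i) k v \<Longrightarrow> osc G a m (Suc i) (k + (e - 1)) t'"
    using rolle_gap[OF assms(1-8)] by blast
  have "G (Suc i) v * G (Suc i) u < 0"
    using v(4) u(3) by (auto simp: mult_less_0_iff zero_less_mult_iff)
  then have "osc G a m (Suc i) (k + 1) v"
    using u v assms(2) by (intro osc_sign_change[of _ _ _ _ _ u]) auto
  from v(6)[OF this] show ?thesis using v assms(5) by (intro exI[of _ t']) simp
qed

text \<open>Only the first zero has no predecessor from which a sign change could be regained, so
  one is lost in total. The sign at \<open>u\<close> is carried along to connect to the next
  zero.\<close>

lemma osc_rolle:
  assumes "rolle (G i) (G (Suc i))" "i < m"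
  shows "osc G a m i n t \<Longrightarrow> n = 0 \<or> (\<exists>u<t. osc G a m (Suc i) (n - 1) u \<and> G (Suc i) u * G i t > 0)"
proof (induction rule: osc.induct)
  case (step n s y t e)
  show ?case
  proof (cases "n = 0")
    case True
    obtain v t' where v: "s < v" "v \<le> t'" "t' < t" "G (Suc i) v * G i s < 0" "G (Suc i) t' * G i t > 0"
      "\<And>k. osc G a m (Suc i) k v \<Longrightarrow> osc G a m (Suc i) (k + (e - 1)) t'"
      using rolle_gap[OF assms step(2-5) step(6,7), where a=a] by blast
    have "osc G a m (Suc i) 0 v"
      using v osc_gt[OF step(1)] by (intro osc.start) auto
    from v(6)[OF this] show ?thesis using True v by (intro disjI2 exI[of _ t']) simp
  next
    case False
    then obtain u where u: "u < s" "osc G a m (Suc i) (n - 1) u" "G (Suc i) u * G i s > 0"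
      using step.IH by auto
    have "\<exists>t'<t. osc G a m (Suc i) (n - 1 + e) t' \<and> G (Suc i) t' * G i t > 0"
      by (rule rolle_step[OF assms step(2-5) step(6,7) u(2,1,3)])
    then show ?thesis using False by simp
  qed
qed simp

text \<open>The zero at \<open>a\<close> is the missing predecessor of the first counted zero, so
  nothing is lost.\<close>

lemma osc_rolle_left:
  assumes "rolle (G i) (G (Suc i))" "i < m" "G i a = 0"
  shows "osc G a m i n t \<Longrightarrow> \<exists>u<t. osc G a m (Suc i) n u \<and> G (Suc i) u * G i t > 0"
proof (induction rule: osc.induct)
  case (start t)
  obtain u where "a < u" "u < t" "G (Suc i) u * G i t > 0"
    using rolleD[OF assms(1), of a t] start assms by auto
  then show ?case by (intro exI[of _ u]) (auto intro!: osc.start)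
next
  case (step n s y t e)
  then obtain u where u: "u < s" "osc G a m (Suc i) n u" "G (Suc i) u * G i s > 0" by auto
  show ?case
    by (rule rolle_step[OF assms(1,2) step(2-5) step(6,7) u(2,1,3)])
qed

text \<open>In addition, \<open>G i\<close> has to return to 0 at \<open>b\<close> after its last
  nonzero point, and this is one more sign change of \<open>G (Suc i)\<close>.\<close>

lemma osc_rolle_both:
  assumes "rolle (G i) (G (Suc i))" "i < m" "G i a = 0" "G i b = 0" "osc G a m i n t" "t < b"
  shows "\<exists>u<b. osc G a m (Suc i) (n + 1) u"
proof -
  obtain u where u: "u < t" "osc G a m (Suc i) n u" "G (Suc i) u * G i t > 0"
    using osc_rolle_left[OF assms(1-3,5)] by auto
  obtain v where v: "t < v" "v < b" "G (Suc i) v * G i t < 0"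
    using rolleD'[OF assms(1), of t b] assms osc_nonzero[OF assms(5)] by auto
  have "G (Suc i) v * G (Suc i) u < 0"
    using v(3) u(3) by (auto simp: mult_less_0_iff zero_less_mult_iff)
  then show ?thesis using u v assms osc_sign_change[of G a m "Suc i" n u v] by auto
qed

text \<open>With the value 0 at the knots, a point where \<open>h\<close> is nonzero always lies
  inside an open knot interval, and its floor names that interval.\<close>

definition knotwise_const :: "(real \<Rightarrow> real) \<Rightarrow> bool" where
  "knotwise_const h \<longleftrightarrow> (\<forall>x\<in>\<int>. h x = 0) \<and>
     (\<forall>x y. x \<notin> \<int> \<longrightarrow> y \<notin> \<int> \<longrightarrow> \<lfloor>x\<rfloor> = \<lfloor>y\<rfloor> \<longrightarrow> h x = h y)"

text \<open>At level m the bound \<open>i + e \<le> m + 1\<close> leaves only e = 1, and each such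
  sign change moves on to a later knot interval.\<close>

lemma osc_top_le:
  assumes "knotwise_const (G m)"
  shows "osc G (of_int a) m m n t \<Longrightarrow> int n \<le> \<lfloor>t\<rfloor> - a"
proof (induction rule: osc.induct)
  case (start t)
  then show ?case by (simp add: le_floor_iff)
next
  case (step n s y t e)
  have e: "e = 1" using step by auto
  have "\<lfloor>s\<rfloor> \<noteq> \<lfloor>t\<rfloor>"
  proof
    assume "\<lfloor>s\<rfloor> = \<lfloor>t\<rfloor>"
    moreover have "G m s \<noteq> 0" "G m t \<noteq> 0" using step(7) by auto
    ultimately have "G m s = G m t" using assms unfolding knotwise_const_def by metis
    then show False using step(7) e by (simp add: not_less)
  qed
  moreover have "\<lfloor>s\<rfloor> \<le> \<lfloor>t\<rfloor>" using step by (intro floor_mono) auto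
  ultimately show ?case using step.IH e by simp
qed

definition rolle_chain :: "nat \<Rightarrow> (nat \<Rightarrow> real \<Rightarrow> real) \<Rightarrow> bool" where
  "rolle_chain m G \<longleftrightarrow> (\<forall>i\<in>{1..<m}. rolle (G i) (G (Suc i))) \<and> knotwise_const (G m)"

text \<open>The m - 1 passages lose at most one zero each, and b - a knot intervals admit at most b
  - a - 1 sign changes. Counts below m may be used up on the way; for them the bound is immediate
  from b - a \<ge> 1.\<close>

lemma osc_bound:
  assumes ch: "rolle_chain m G" and m: "m \<ge> 1"
    and o: "osc G (of_int a) m 1 n t" and t: "t < of_int b"
  shows "int n \<le> b - a + int m - 2"
proof -
  have "n < i \<or> (\<exists>u<of_int b. osc G (of_int a) m i (n + 1 - i) u)" if "1 \<le> i" "i \<le> m" for i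
    using that
  proof (induction i rule: dec_induct)
    case base
    then show ?case using o t by auto
  next
    case (step i)
    show ?case
    proof (cases "n < Suc i")
      case False
      then obtain u where "u < of_int b" "osc G (of_int a) m i (n + 1 - i) u"
        using step by auto
      moreover have "rolle (G i) (G (Suc i))" using ch step unfolding rolle_chain_def by auto
      ultimately have "\<exists>v<u. osc G (of_int a) m (Suc i) (n + 1 - i - 1) v"
        using osc_rolle[of G i m "of_int a" "n + 1 - i" u] step False by auto
      then obtain v where "v < u" "osc G (of_int a) m (Suc i) (n + 1 - i - 1) v" by blast
      then show ?thesis using False \<open>u < of_int b\<close> by (intro disjI2 exI[of _ v]) auto
    qed auto
  qed
  from this[OF m order_refl] consider "n < m"
    | u where "u < of_int b" "osc G (of_int a) m m (n + 1 - m) u" by blast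
  then show ?thesis
  proof cases
    case 1
    have "of_int a < (of_int b :: real)" using osc_gt[OF o] t by simp
    then show ?thesis using 1 by simp
  next
    case 2
    have "int (n + 1 - m) \<le> \<lfloor>u\<rfloor> - a"
      using osc_top_le[OF _ 2(2)] ch unfolding rolle_chain_def by auto
    moreover have "\<lfloor>u\<rfloor> < b" using 2(1) by (simp add: floor_less_iff)
    ultimately show ?thesis by linarith
  qed
qed

text \<open>Here each of the m - 1 passages gains one, so n + m - 1 sign changes have to fit into b
  - a knot intervals.\<close>

lemma osc_bound_vanishing:
  assumes ch: "rolle_chain m G" and m: "m \<ge> 1"
    and o: "osc G (of_int a) m 1 n t" and t: "t < of_int b"
    and z: "\<And>i. 1 \<le> i \<Longrightarrow> i < m \<Longrightarrow> G i (of_int a) = 0 \<and> G i (of_int b) = 0"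
  shows "int n \<le> b - a - int m"
proof -
  have "\<exists>u<of_int b. osc G (of_int a) m i (n + i - 1) u" if "1 \<le> i" "i \<le> m" for i
    using that
  proof (induction i rule: dec_induct)
    case base
    then show ?case using o t by auto
  next
    case (step i)
    then obtain u where "u < of_int b" "osc G (of_int a) m i (n + i - 1) u" by auto
    moreover have "rolle (G i) (G (Suc i))" using ch step unfolding rolle_chain_def by auto
    ultimately have "\<exists>v<of_int b. osc G (of_int a) m (Suc i) (n + i - 1 + 1) v"
      using step z by (intro osc_rolle_both[of G i m _ _ _ u]) auto
    then show ?case using step by simp
  qed
  from this[OF m order_refl] obtain u where
    u: "u < of_int b" "osc G (of_int a) m m (n + m - 1) u" by blast
  have "int (n + m - 1) \<le> \<lfloor>u\<rfloor> - a"
    using osc_top_le[OF _ u(2)] ch unfolding rolle_chain_def by auto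
  moreover have "\<lfloor>u\<rfloor> < b" using u(1) by (simp add: floor_less_iff)
  ultimately show ?thesis using m by linarith
qed

section \<open>Generalized derivatives of exponential splines\<close>

text \<open>\<open>G (i + 1)\<close> is the derivative of \<open>G i\<close> divided by \<open>w (i + 1)\<close>. The last function \<open>G m\<close> is set
  to 0 at the knots, where \<open>G (m - 1)\<close> need not be differentiable.\<close>
definition spline_chain ::
  "nat \<Rightarrow> (nat \<Rightarrow> real \<Rightarrow> real) \<Rightarrow> (real \<Rightarrow> real) \<Rightarrow> (nat \<Rightarrow> real \<Rightarrow> real) \<Rightarrow> bool" where
  "spline_chain m w f G \<longleftrightarrow>
     (\<forall>x. f x = w 1 x * G 1 x) \<and>
     (\<forall>i\<in>{1..<m}. continuous_on UNIV (G i) \<and>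
        (\<forall>x. x \<notin> \<int> \<or> i + 1 < m \<longrightarrow> (G i has_real_derivative w (i + 1) x * G (i + 1) x) (at x))) \<and>
     knotwise_const (G m)"

text \<open>The periodic factor is eliminated: its periodicity and the exponential together say that
  an integer shift rescales the weight.\<close>

definition spline_weights :: "nat \<Rightarrow> (nat \<Rightarrow> real \<Rightarrow> real) \<Rightarrow> (nat \<Rightarrow> real) \<Rightarrow> bool" where
  "spline_weights m w \<gamma> \<longleftrightarrow> (\<forall>s\<in>{1..m}. C_k (m - s) (w s) \<and> (\<forall>x. w s x > 0) \<and>
     (\<forall>x (l :: int). w s (x - of_int l) = exp (- \<gamma> s * of_int l) * w s x))"

lemma periodic_int:
  fixes r :: "real \<Rightarrow> 'a" and l :: int
  assumes "\<And>x. r (x + 1) = r x"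
  shows "r (x - of_int l) = r x"
proof (induction l arbitrary: x rule: int_induct[of _ 0])
  case (step1 i)
  have "r (x - of_int (i + 1)) = r (x - of_int (i + 1) + 1)" by (rule assms[symmetric])
  then show ?case using step1 by (simp add: algebra_simps)
next
  case (step2 i)
  have "r (x - of_int (i - 1)) = r (x - of_int i + 1)" by (simp add: algebra_simps)
  then show ?case using step2 by (simp add: assms)
qed simp

lemma PEB_weights_imp_spline_weights:
  assumes "PEB_weights m w"
  obtains \<gamma> where "spline_weights m w \<gamma>"
proof -
  obtain \<gamma> r where *: "\<And>s. s \<in> {1..m} \<Longrightarrow> C_k (m - s) (r s) \<and> (\<forall>x. r s x > 0) \<and>
      (\<forall>x. r s (x + 1) = r s x) \<and> (\<forall>x. w s x = exp (\<gamma> s * x) * r s x)"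
    using assms unfolding PEB_weights_def by blast
  have "spline_weights m w \<gamma>"
    unfolding spline_weights_def
  proof (intro ballI conjI allI)
    fix s x and l :: int assume s: "s \<in> {1..m}"
    have w: "w s = (\<lambda>x. 1 * exp (\<gamma> s * x) * r s x)" using *[OF s] by auto
    show "C_k (m - s) (w s)" unfolding w using *[OF s] by (intro C_k_mult C_k_exp) auto
    show "w s x > 0" using *[OF s] by (auto simp: w)
    have "r s (x - of_int l) = r s x" using *[OF s] by (intro periodic_int) auto
    then show "w s (x - of_int l) = exp (- \<gamma> s * of_int l) * w s x"
      by (simp add: w algebra_simps flip: exp_add)
  qed
  then show ?thesis using that by blast
qed

lemma spline_weights_pos: "spline_weights m w \<gamma> \<Longrightarrow> s \<in> {1..m} \<Longrightarrow> w s x > 0"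
  unfolding spline_weights_def by blast

lemma spline_weights_C_k: "spline_weights m w \<gamma> \<Longrightarrow> s \<in> {1..m} \<Longrightarrow> k \<le> m - s \<Longrightarrow> C_k k (w s)"
  unfolding spline_weights_def using C_k_mono by blast

lemma spline_weights_C_k_inverse:
  "spline_weights m w \<gamma> \<Longrightarrow> s \<in> {1..m} \<Longrightarrow> k \<le> m - s \<Longrightarrow> C_k k (\<lambda>x. inverse (w s x))"
  using C_k_inverse[OF spline_weights_C_k, of m w \<gamma> s k] spline_weights_pos[of m w \<gamma> s]
  by (metis less_irrefl)

lemma spline_chain_deriv:
  assumes "spline_chain m w f G" "1 \<le> i" "i < m" "x \<notin> \<int> \<or> i + 1 < m"
  shows "(G i has_real_derivative w (i + 1) x * G (i + 1) x) (at x)"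
  using assms unfolding spline_chain_def by auto

lemma spline_chain_rolle:
  assumes "spline_weights m w \<gamma>" "spline_chain m w f G"
  shows "rolle_chain m G"
  unfolding rolle_chain_def
proof (intro conjI ballI)
  fix i assume i: "i \<in> {1..<m}"
  show "rolle (G i) (G (Suc i))"
    using i assms unfolding spline_chain_def
    by (intro rolleI[where w="w (i + 1)"]) (auto intro: spline_weights_pos)
qed (use assms in \<open>auto simp: spline_chain_def\<close>)

text \<open>Each passage to the next function costs one derivative and one order of the zero, and
  the next weight is smooth enough for the division that follows. Hence the i-th function keeps
  order n + 1 - i, which is positive up to i = n.\<close>

lemma spline_chain_zero:
  assumes w: "spline_weights m w \<gamma>" and ch: "spline_chain m w f G" and m: "m \<ge> 2"
    and f: "C_k (m - 2) f" "zero_order n f y" "n \<le> m - 1" and i: "1 \<le> i" "i \<le> n"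
  shows "G i y = 0"
proof -
  have "C_k (m - 1 - i) (G i) \<and> (i \<le> n \<longrightarrow> zero_order (n + 1 - i) (G i) y)" if "1 \<le> i" "i \<le> m - 1" for i
    using that
  proof (induction i rule: dec_induct)
    case base
    have g: "G 1 = (\<lambda>x. f x * inverse (w 1 x))"
    proof
      fix x
      have "w 1 x > 0" using spline_weights_pos[OF w, of 1 x] m by auto
      moreover have "f x = w 1 x * G 1 x" using ch unfolding spline_chain_def by blast
      ultimately show "G 1 x = f x * inverse (w 1 x)" by (simp add: field_simps)
    qed
    have iw: "C_k (m - 2) (\<lambda>x. inverse (w 1 x))"
      using m by (intro spline_weights_C_k_inverse[OF w]) auto
    have "zero_order n (G 1) y"
      unfolding g using m f iw by (intro zero_order_mult[of "m - 2"]) auto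
    moreover have "C_k (m - 2) (G 1)"
      unfolding g using f iw by (intro C_k_mult) auto
    moreover have "m - 1 - 1 = m - 2" by simp
    ultimately show ?case by auto
  next
    case (step i)
    define k where "k = m - 1 - Suc i"
    have k: "m - 1 - i = Suc k" using step unfolding k_def by auto
    have ck: "C_k (Suc k) (G i)" using step k by auto
    have iw: "C_k k (\<lambda>x. inverse (w (Suc i) x))"
      using step unfolding k_def by (intro spline_weights_C_k_inverse[OF w]) auto
    have g: "G (Suc i) = (\<lambda>x. vector_derivative (G i) (at x) * inverse (w (Suc i) x))"
    proof
      fix x
      have "w (Suc i) x > 0" using spline_weights_pos[OF w, of "Suc i" x] step by auto
      moreover have "(G i has_real_derivative w (i + 1) x * G (i + 1) x) (at x)"
        by (rule spline_chain_deriv[OF ch]) (use step in auto)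
      then have "vector_derivative (G i) (at x) = w (i + 1) x * G (i + 1) x"
        by (auto simp: has_real_derivative_iff_has_vector_derivative intro: vector_derivative_at)
      ultimately show "G (Suc i) x = vector_derivative (G i) (at x) * inverse (w (Suc i) x)"
        by (simp add: field_simps)
    qed
    have cd: "C_k k (\<lambda>x. vector_derivative (G i) (at x))" using ck by (simp add: C_k_Suc)
    have "C_k k (G (Suc i))" unfolding g by (rule C_k_mult[OF cd iw])
    moreover have "zero_order (n + 1 - Suc i) (G (Suc i)) y" if "Suc i \<le> n"
    proof -
      have e: "n + 1 - i = Suc (n + 1 - Suc i)" using that by auto
      have "zero_order (n + 1 - i) (G i) y" using step that by auto
      then have "zero_order (n + 1 - Suc i) (\<lambda>x. vector_derivative (G i) (at x)) y"
        unfolding e zero_order_Suc by auto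
      then show ?thesis unfolding g
        by (intro zero_order_mult[OF cd iw]) (use f that in \<open>auto simp: k_def\<close>)
    qed
    ultimately show ?case unfolding k_def by auto
  qed
  from this[of i] have "zero_order (n + 1 - i) (G i) y" using i f by auto
  then show ?thesis using i unfolding zero_order_def
    by (metis Suc_diff_le Suc_eq_plus1 nderiv_0 zero_less_Suc)
qed

text \<open>A shifted chain becomes a chain for the unshifted weights once its functions are
  rescaled; chains for fixed weights can be added.\<close>

lemma spline_chain_lincomb:
  fixes c :: "int \<Rightarrow> real"
  assumes w: "spline_weights m w \<gamma>" and ch: "spline_chain m w f G" and m: "m \<ge> 1"
  shows "\<exists>H. spline_chain m w (\<lambda>x. \<Sum>l\<in>F. f (x - of_int l) *\<^sub>R c l) H"
proof -
  \<comment> \<open>The i-th function has been divided by the weights 1 to i, so it collects the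
    product of their shift factors.\<close>
  define e where "e i l = exp (- (\<Sum>s=1..i. \<gamma> s) * real_of_int l)" for i l
  have e_Suc: "e (Suc i) l = e i l * exp (- \<gamma> (Suc i) * of_int l)" for i l
    by (simp add: e_def algebra_simps flip: exp_add)
  have shift: "w s (x - of_int l) = exp (- \<gamma> s * of_int l) * w s x" if "s \<in> {1..m}" for s x l
    using w that unfolding spline_weights_def by blast
  define H where "H i x = (\<Sum>l\<in>F. c l * e i l * G i (x - of_int l))" for i x
  have int: "x - of_int l \<in> \<int> \<longleftrightarrow> x \<in> \<int>" for x :: real and l
    by (metis Ints_add Ints_diff Ints_of_int diff_add_cancel)
  have "spline_chain m w (\<lambda>x. \<Sum>l\<in>F. f (x - of_int l) *\<^sub>R c l) H"
    unfolding spline_chain_def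
  proof (intro conjI allI ballI impI)
    fix x
    have "f (x - of_int l) = w 1 x * (e 1 l * G 1 (x - of_int l))" for l
      using ch shift[of 1 x l] m by (simp add: spline_chain_def e_def)
    then show "(\<Sum>l\<in>F. f (x - of_int l) *\<^sub>R c l) = w 1 x * H 1 x"
      by (simp add: H_def sum_distrib_left mult_ac)
  next
    fix i assume i: "i \<in> {1..<m}"
    have "continuous_on UNIV (G i)" using ch i unfolding spline_chain_def by auto
    then have "continuous_on UNIV (\<lambda>x. G i (x - of_int l))" for l :: int
      by (rule continuous_on_compose2) (auto intro!: continuous_intros)
    then show "continuous_on UNIV (H i)"
      unfolding H_def[abs_def] by (intro continuous_intros) auto
    fix x :: real assume x: "x \<notin> \<int> \<or> i + 1 < m"
    have "(H i has_real_derivative (\<Sum>l\<in>F. c l * e i l * (w (i + 1) (x - of_int l) * G (i + 1) (x - of_int l)))) (at x)"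
      unfolding H_def[abs_def]
    proof (intro DERIV_sum DERIV_cmult)
      fix l :: int
      have "(G i has_real_derivative w (i + 1) (x - of_int l) * G (i + 1) (x - of_int l)) (at (x - of_int l))"
        using ch i x unfolding spline_chain_def by (auto simp: int)
      then show "((\<lambda>x. G i (x - of_int l)) has_real_derivative
         w (i + 1) (x - of_int l) * G (i + 1) (x - of_int l)) (at x)"
        using has_vector_derivative_shift by (simp add: has_real_derivative_iff_has_vector_derivative)
    qed
    also have "(\<Sum>l\<in>F. c l * e i l * (w (i + 1) (x - of_int l) * G (i + 1) (x - of_int l)))
       = w (i + 1) x * H (i + 1) x"
      using i by (simp add: H_def sum_distrib_left e_Suc shift mult_ac)
    finally show "(H i has_real_derivative w (i + 1) x * H (i + 1) x) (at x)" .
  next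
    show "knotwise_const (H m)"
      unfolding knotwise_const_def
    proof (intro conjI ballI allI impI)
      fix x :: real assume "x \<in> \<int>"
      then show "H m x = 0" using ch
        by (auto simp: H_def spline_chain_def knotwise_const_def intro!: sum.neutral)
    next
      fix x y :: real assume "x \<notin> \<int>" "y \<notin> \<int>" "\<lfloor>x\<rfloor> = \<lfloor>y\<rfloor>"
      then have "G m (x - of_int l) = G m (y - of_int l)" for l
        using ch int by (simp add: spline_chain_def knotwise_const_def)
      then show "H m x = H m y" by (simp add: H_def)
    qed
  qed
  then show ?thesis by blast
qed

lemma knot_interval: "x \<in> {of_int l<..<of_int l + 1} \<Longrightarrow> x \<notin> \<int> \<and> \<lfloor>x\<rfloor> = l" for x :: real
proof -
  assume a: "x \<in> {of_int l<..<of_int l + 1}"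
  then have f: "\<lfloor>x\<rfloor> = l" by (simp add: floor_eq_iff)
  then have "x \<noteq> of_int \<lfloor>x\<rfloor>" using a by auto
  then show ?thesis using f by (metis Ints_cases floor_of_int)
qed

lemma not_Ints_floor: "x \<notin> \<int> \<Longrightarrow> x \<in> {of_int \<lfloor>x\<rfloor><..<of_int \<lfloor>x\<rfloor> + 1}" for x :: real
  by (metis Ints_of_int floor_correct greaterThanLessThan_iff less_eq_real_def of_int_add of_int_1)

text \<open>Going up the chain, every function vanishes on the small interval. The last one is
  constant on the knot interval, hence zero there; going down, every function then has derivative 0
  and keeps the value 0 that it has at a point of the small interval.\<close>

lemma spline_chain_vanish:
  assumes w: "spline_weights m w \<gamma>" and ch: "spline_chain m w f G" and m: "m \<ge> 1"
    and st: "s < t" "{s<..<t} \<subseteq> {of_int l<..<of_int l + 1}" "\<And>x. x \<in> {s<..<t} \<Longrightarrow> f x = 0"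
    and x: "x \<in> {of_int l<..<of_int l + 1}"
  shows "f x = 0"
proof -
  have small: "G i y = 0" if "1 \<le> i" "i \<le> m" "y \<in> {s<..<t}" for i y
    using that
  proof (induction i arbitrary: y rule: dec_induct)
    case base
    have "f y = w 1 y * G 1 y" using ch unfolding spline_chain_def by blast
    moreover have "w 1 y > 0" using spline_weights_pos[OF w, of 1 y] m by auto
    moreover have "f y = 0" using base st by auto
    ultimately show ?case by auto
  next
    case (step i)
    have "y \<notin> \<int>" using knot_interval[of y l] st step by auto
    then have d: "(G i has_real_derivative w (i + 1) y * G (i + 1) y) (at y)"
      by (intro spline_chain_deriv[OF ch]) (use step in auto)
    have "((\<lambda>_. 0) has_real_derivative w (i + 1) y * G (i + 1) y) (at y)"
      by (rule has_field_derivative_transform_within_open[OF d, of "{s<..<t}"]) (use step in auto)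
    then have "w (i + 1) y * G (i + 1) y = 0" using DERIV_const DERIV_unique by blast
    moreover have "w (i + 1) y > 0" using spline_weights_pos[OF w, of "i + 1" y] step by auto
    ultimately show ?case by auto
  qed
  define z where "z = (s + t) / 2"
  have z: "z \<in> {s<..<t}" using st(1) by (auto simp: z_def)
  with st(2) have z: "z \<in> {s<..<t}" "z \<in> {of_int l<..<of_int l + 1}" by blast+
  have "G i y = 0" if "1 \<le> i" "i \<le> m" "y \<in> {of_int l<..<of_int l + 1}" for i y
    using that(2,1,3)
  proof (induction i arbitrary: y rule: inc_induct)
    case base
    then have "G m y = G m z" using ch z knot_interval[of _ l]
      by (auto simp: spline_chain_def knotwise_const_def)
    then show ?case using small[of m z] z m by auto
  next
    case (step i)
    have "(G i has_real_derivative 0) (at v)" if "v \<in> {of_int l<..<of_int l + 1}" for v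
    proof -
      have "(G i has_real_derivative w (i + 1) v * G (i + 1) v) (at v)"
        by (rule spline_chain_deriv[OF ch]) (use step knot_interval[OF that] in auto)
      then show ?thesis using step.IH[of v] that by simp
    qed
    then have "G i constant_on {of_int l<..<of_int l + 1}"
      by (intro has_field_derivative_0_imp_constant_on) auto
    then have "G i y = G i z" using step.prems z unfolding constant_on_def by metis
    then show ?case using small[of i z] z step by auto
  qed
  then show ?thesis using x m ch by (auto simp: spline_chain_def)
qed

section \<open>The chain of a PEB-spline from iterated integrals\<close>

lemma LBINT_0_deriv:
  assumes "continuous_on UNIV h"
  shows "((\<lambda>x::real. LBINT t=0..ereal x. h t) has_real_derivative h x) (at x)"
proof -
  define c where "c = \<bar>x\<bar> + 1"
  have "((\<lambda>u. LBINT t=ereal 0..ereal u. h t) has_vector_derivative h x) (at x within {- c..c})"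
    using assms continuous_on_subset by (intro interval_integral_FTC2) (auto simp: c_def)
  moreover have "at x within {- c..c} = at x"
    by (rule at_within_Icc_at) (auto simp: c_def)
  ultimately show ?thesis
    by (simp add: has_real_derivative_iff_has_vector_derivative zero_ereal_def)
qed

lemma iter_int_continuous:
  assumes "\<And>j. k \<le> j \<Longrightarrow> j < k + n \<Longrightarrow> continuous_on UNIV (w j)"
  shows "continuous_on UNIV (iter_int w k n)"
  using assms
proof (induction n arbitrary: k)
  case 0
  then show ?case by simp
next
  case (Suc n)
  have "continuous_on UNIV (\<lambda>t. w k t * iter_int w (Suc k) n t)"
    by (intro continuous_intros Suc.IH Suc.prems) auto
  from LBINT_0_deriv[OF this] show ?case
    by (auto intro!: continuous_at_imp_continuous_on DERIV_isCont)
qed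

lemma iter_int_deriv:
  assumes "\<And>j. k \<le> j \<Longrightarrow> j < k + Suc n \<Longrightarrow> continuous_on UNIV (w j)"
  shows "(iter_int w k (Suc n) has_real_derivative w k x * iter_int w (Suc k) n x) (at x)"
proof -
  have "continuous_on UNIV (\<lambda>t. w k t * iter_int w (Suc k) n t)"
    by (intro continuous_intros iter_int_continuous assms) auto
  moreover have "iter_int w k (Suc n) = (\<lambda>x. LBINT t=0..ereal x. w k t * iter_int w (Suc k) n t)"
    by (rule ext) simp
  ultimately show ?thesis using LBINT_0_deriv by metis
qed

text \<open>The index is shifted by one: \<open>chain_fun w f i\<close> will be
  \<open>G (i + 1)\<close>, whence the weight \<open>w (i + 2)\<close> in the recursion.\<close>

primrec chain_fun :: "(nat \<Rightarrow> real \<Rightarrow> real) \<Rightarrow> (real \<Rightarrow> real) \<Rightarrow> nat \<Rightarrow> real \<Rightarrow> real" where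
  "chain_fun w f 0 = (\<lambda>x. f x / w 1 x)"
| "chain_fun w f (Suc i) = (\<lambda>x. vector_derivative (chain_fun w f i) (at x) / w (i + 2) x)"

lemma chain_fun_C_k:
  assumes w: "spline_weights m w \<gamma>" and f: "C_k (m - 2) f" and i: "i + 2 \<le> m"
  shows "C_k (m - 2 - i) (chain_fun w f i)"
  using i
proof (induction i)
  case 0
  then show ?case using f spline_weights_C_k_inverse[OF w, of 1 "m - 2"]
    by (auto simp: divide_inverse intro!: C_k_mult)
next
  case (Suc i)
  have "m - 2 - i = Suc (m - 2 - Suc i)" using Suc.prems by auto
  then have "C_k (m - 2 - Suc i) (\<lambda>x. vector_derivative (chain_fun w f i) (at x))"
    using Suc by (auto simp: C_k_Suc)
  moreover have "C_k (m - 2 - Suc i) (\<lambda>x. inverse (w (i + 2) x))"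
    using Suc.prems by (intro spline_weights_C_k_inverse[OF w]) auto
  ultimately show ?case by (auto simp: divide_inverse intro!: C_k_mult)
qed

text \<open>Each step strips the outermost integral from every basis function and annihilates the
  one that has no integral left.\<close>

lemma chain_fun_local:
  fixes a :: "nat \<Rightarrow> real"
  assumes w: "spline_weights m w \<gamma>"
    and f: "\<And>x. x \<in> {of_int l<..<of_int l + 1} \<Longrightarrow> f x = (\<Sum>s=1..m. a s * PEB_u w s x)"
  shows "i < m \<Longrightarrow> x \<in> {of_int l<..<of_int l + 1} \<Longrightarrow>
      chain_fun w f i x = (\<Sum>s=i+1..m. a s * iter_int w (i + 2) (s - 1 - i) x)"
    and "i + 1 < m \<Longrightarrow> x \<in> {of_int l<..<of_int l + 1} \<Longrightarrow>
      (chain_fun w f i has_real_derivative w (i + 2) x * chain_fun w f (i + 1) x) (at x)"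
proof -
  have wp: "w s x > 0" if "s \<in> {1..m}" for s x using spline_weights_pos[OF w that] .
  have wc: "continuous_on UNIV (w s)" if "s \<in> {1..m}" for s
    using spline_weights_C_k[OF w that, of 0] by (simp add: C_k_0)
  let ?F = "\<lambda>i x. \<Sum>s=i+1..m. a s * iter_int w (i + 2) (s - 1 - i) x"
  have der: "(?F i has_real_derivative w (i + 2) x * ?F (i + 1) x) (at x)" if "i + 1 < m" for i x
  proof -
    \<comment> \<open>The term s = i + 1 is the constant \<open>a (i + 1)\<close>, the empty
      iterated integral being 1.\<close>
    have "(?F i has_real_derivative (\<Sum>s=i+1..m. if s = i + 1 then 0 else
        a s * (w (i + 2) x * iter_int w (i + 3) (s - 2 - i) x))) (at x)"
    proof (rule DERIV_sum)
      fix s assume s: "s \<in> {i+1..m}"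
      show "((\<lambda>x. a s * iter_int w (i + 2) (s - 1 - i) x) has_real_derivative (if s = i + 1 then 0 else
        a s * (w (i + 2) x * iter_int w (i + 3) (s - 2 - i) x))) (at x)"
      proof (cases "s = i + 1")
        case False
        define n where "n = s - 2 - i"
        have n: "s - 1 - i = Suc n" using False s by (auto simp: n_def)
        have "(iter_int w (i + 2) (Suc n) has_real_derivative w (i + 2) x * iter_int w (Suc (i + 2)) n x) (at x)"
          using s False by (intro iter_int_deriv wc) (auto simp: n_def)
        from DERIV_cmult[OF this, of "a s"] show ?thesis
          unfolding n n_def[symmetric] using False by (simp add: numeral_3_eq_3)
      qed simp
    qed
    also have "(\<Sum>s=i+1..m. if s = i + 1 then 0 else
        a s * (w (i + 2) x * iter_int w (i + 3) (s - 2 - i) x)) =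
       (\<Sum>s=i+2..m. a s * (w (i + 2) x * iter_int w (i + 3) (s - 2 - i) x))"
      by (rule sum.mono_neutral_cong_right) auto
    also have "\<dots> = w (i + 2) x * ?F (i + 1) x"
      unfolding sum_distrib_left by (rule sum.cong) (auto simp: numeral_3_eq_3 mult_ac)
    finally show ?thesis .
  qed
  have *: "chain_fun w f i x = ?F i x" if "i < m" "x \<in> {of_int l<..<of_int l + 1}" for i x
    using that
  proof (induction i arbitrary: x)
    case 0
    have "w 1 x > 0" using wp[of 1 x] 0 by auto
    then show ?case using f[OF 0(2)]
      by (simp add: PEB_u_def sum_divide_distrib sum_distrib_left mult_ac numeral_2_eq_2)
  next
    case (Suc i)
    have "(chain_fun w f i has_real_derivative w (i + 2) x * ?F (i + 1) x) (at x)"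
      by (rule has_field_derivative_transform_within_open[OF der, of _ "{of_int l<..<of_int l + 1}"])
        (use Suc in auto)
    then have "vector_derivative (chain_fun w f i) (at x) = w (i + 2) x * ?F (i + 1) x"
      by (auto simp: has_real_derivative_iff_has_vector_derivative intro: vector_derivative_at)
    moreover have "w (i + 2) x > 0" using wp[of "i + 2" x] Suc by auto
    ultimately show ?case by simp
  qed
  show "i < m \<Longrightarrow> x \<in> {of_int l<..<of_int l + 1} \<Longrightarrow> chain_fun w f i x = ?F i x" by (rule *)
  assume i: "i + 1 < m" and x: "x \<in> {of_int l<..<of_int l + 1}"
  have "(chain_fun w f i has_real_derivative w (i + 2) x * ?F (i + 1) x) (at x)"
    by (rule has_field_derivative_transform_within_open[OF der, of _ "{of_int l<..<of_int l + 1}"])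
      (use i x * in auto)
  then show "(chain_fun w f i has_real_derivative w (i + 2) x * chain_fun w f (i + 1) x) (at x)"
    using *[of "i + 1" x] i x by simp
qed

lemma chain_fun_spline_chain:
  assumes w: "spline_weights m w \<gamma>" and m: "m \<ge> 2" and f: "C_k (m - 2) f"
    and loc: "\<And>l::int. \<exists>a :: nat \<Rightarrow> real. \<forall>x\<in>{of_int l<..<of_int l + 1}. f x = (\<Sum>s=1..m. a s * PEB_u w s x)"
  shows "\<exists>G. spline_chain m w f G"
proof -
  define G where "G i = (if i < m then chain_fun w f (i - 1)
     else (\<lambda>x. if x \<in> \<int> then 0 else chain_fun w f (m - 1) x))" for i
  have wp: "w s x > 0" if "s \<in> {1..m}" for s x using spline_weights_pos[OF w that] .
  have "spline_chain m w f G"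
    unfolding spline_chain_def
  proof (intro conjI allI ballI impI)
    fix x show "f x = w 1 x * G 1 x" using m wp[of 1 x] by (auto simp: G_def)
  next
    fix i assume i: "i \<in> {1..<m}"
    have ck: "C_k (m - 2 - (i - 1)) (chain_fun w f (i - 1))"
      using i by (intro chain_fun_C_k[OF w f]) auto
    from C_k_continuous_nderiv[OF this, of 0] show "continuous_on UNIV (G i)"
      using i by (simp add: G_def)
    fix x :: real assume x: "x \<notin> \<int> \<or> i + 1 < m"
    show "(G i has_real_derivative w (i + 1) x * G (i + 1) x) (at x)"
    proof (cases "i + 1 < m")
      case True
      have "m - 2 - (i - 1) = Suc (m - 2 - i)" using True i by auto
      then have "(chain_fun w f (i - 1) has_real_derivative
           vector_derivative (chain_fun w f (i - 1)) (at x)) (at x)"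
        using C_k_Suc_deriv ck by (metis has_real_derivative_iff_has_vector_derivative)
      moreover have "chain_fun w f i x = vector_derivative (chain_fun w f (i - 1)) (at x) / w (i + 1) x"
        using i by (cases i) auto
      ultimately show ?thesis using True i wp[of "i + 1" x] by (simp add: G_def)
    next
      case False
      \<comment> \<open>The global smoothness is exhausted at this level, so the derivative comes
        from the local formula and exists off the knots.\<close>
      then have e: "i = m - 1" "x \<notin> \<int>" using i x by auto
      obtain a where "\<forall>x\<in>{of_int \<lfloor>x\<rfloor><..<of_int \<lfloor>x\<rfloor> + 1}. f x = (\<Sum>s=1..m. a s * PEB_u w s x)"
        using loc by blast
      then have "(chain_fun w f (m - 2) has_real_derivative
          w (m - 2 + 2) x * chain_fun w f (m - 2 + 1) x) (at x)"
        using m by (intro chain_fun_local(2)[OF w _ _ not_Ints_floor[OF e(2)]]) auto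
      moreover have eqs: "m - 2 + 2 = m" "m - 2 + 1 = m - 1" "m - 1 - 1 = m - 2" "m - 1 + 1 = m"
        using m by auto
      ultimately have "(chain_fun w f (m - 2) has_real_derivative
          w m x * chain_fun w f (m - 1) x) (at x)" by (simp only: eqs)
      moreover have "G i = chain_fun w f (m - 2)" "G m x = chain_fun w f (m - 1) x"
        using e m by (simp_all add: G_def eqs(3) del: One_nat_def)
      ultimately show ?thesis using e(1) eqs(4) by simp
    qed
  next
    show "knotwise_const (G m)"
      unfolding knotwise_const_def
    proof (intro conjI ballI allI impI)
      fix x y :: real assume xy: "x \<notin> \<int>" "y \<notin> \<int>" "\<lfloor>x\<rfloor> = \<lfloor>y\<rfloor>"
      obtain a where "\<forall>x\<in>{of_int \<lfloor>x\<rfloor><..<of_int \<lfloor>x\<rfloor> + 1}. f x = (\<Sum>s=1..m. a s * PEB_u w s x)"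
        using loc by blast
      \<comment> \<open>Only the term s = m is left, so the value is the constant \<open>a m\<close>
        of this knot interval.\<close>
      then have "chain_fun w f (m - 1) z = (\<Sum>s=m - 1 + 1..m. a s * iter_int w (m - 1 + 2) (s - 1 - (m - 1)) z)"
        if "z \<in> {of_int \<lfloor>x\<rfloor><..<of_int \<lfloor>x\<rfloor> + 1}" for z
        using m that by (intro chain_fun_local(1)[OF w _ _ that]) auto
      from this[of x] this[of y] show "G m x = G m y"
        using m xy not_Ints_floor[of x] not_Ints_floor[of y] by (simp add: G_def)
    qed (auto simp: G_def)
  qed
  then show ?thesis by blast
qed

lemma PEB_spline_chain:
  assumes "PEB_spline m \<phi>" "m \<ge> 2"
  obtains w \<gamma> G where "spline_weights m w \<gamma>" "spline_chain m w \<phi> G"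
proof -
  obtain w where w: "PEB_weights m w" "C_k (m - 2) \<phi>"
    "\<And>l :: int. \<exists>g\<in>PEB_space m w. \<forall>x\<in>{of_int l<..<of_int l + 1}. complex_of_real (\<phi> x) = g x"
    using assms unfolding PEB_spline_def by blast
  obtain \<gamma> where g: "spline_weights m w \<gamma>" using PEB_weights_imp_spline_weights[OF w(1)] .
  have "\<exists>a :: nat \<Rightarrow> real. \<forall>x\<in>{of_int l<..<of_int l + 1}. \<phi> x = (\<Sum>s=1..m. a s * PEB_u w s x)"
    for l :: int
  proof -
    obtain a :: "nat \<Rightarrow> complex" where a: "\<forall>x\<in>{of_int l<..<of_int l + 1}.
        complex_of_real (\<phi> x) = (\<Sum>s=1..m. a s * complex_of_real (PEB_u w s x))"
      using w(3)[of l] unfolding PEB_space_def by blast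
    \<comment> \<open>The spline and the basis functions are real, so real parts of the complex
      coefficients represent it as well.\<close>
    show ?thesis
    proof (intro exI[of _ "\<lambda>s. Re (a s)"] ballI)
      fix x :: real assume "x \<in> {of_int l<..<of_int l + 1}"
      then have "Re (complex_of_real (\<phi> x)) = Re (\<Sum>s=1..m. a s * complex_of_real (PEB_u w s x))"
        using a by auto
      then show "\<phi> x = (\<Sum>s=1..m. Re (a s) * PEB_u w s x)" by simp
    qed
  qed
  then obtain G where "spline_chain m w \<phi> G"
    using chain_fun_spline_chain[OF g assms(2) w(2)] by blast
  then show ?thesis using g that by blast
qed

section \<open>Zero counting and uniqueness\<close>

lemma nderiv_zero_on_closed:
  assumes "C_k k f" "j \<le> k" "s < t" "\<And>x. x \<in> {s<..<t} \<Longrightarrow> f x = 0" "x \<in> {s..t}"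
  shows "nderiv j f x = 0"
proof -
  have "closed {x. nderiv j f x = 0}"
    using C_k_continuous_nderiv[OF assms(1,2)] by (intro closed_Collect_eq) auto
  moreover have "{s<..<t} \<subseteq> {x. nderiv j f x = 0}"
    using nderiv_cong_open[of "{s<..<t}" f "\<lambda>_. 0"] assms(4) by auto
  ultimately have "closure {s<..<t} \<subseteq> {x. nderiv j f x = 0}" by (simp add: closure_minimal)
  then show ?thesis using assms(3,5) by auto
qed

section \<open>Separated sequences with bounded weighted gaps\<close>

lemma crossing:
  fixes y :: "int \<Rightarrow> real"
  assumes "k0 \<le> k1" "P (y k0)" "\<not> P (y k1)"
  shows "\<exists>p. P (y p) \<and> \<not> P (y (p + 1))"
proof (rule ccontr)
  assume no: "\<not> ?thesis"
  have "P (y k1)" using assms(1)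
    by (induction rule: int_ge_induct) (use assms no in auto)
  with assms show False by simp
qed

text \<open>All inequalities on the sequence are weak, so that they survive limits of translates.
  Multiplicities belong to indices and not to points, since the points move under such
  limits.\<close>

definition gap_seq :: "nat \<Rightarrow> real \<Rightarrow> real \<Rightarrow> (int \<Rightarrow> real) \<Rightarrow> (int \<Rightarrow> nat) \<Rightarrow> bool" where
  "gap_seq m \<delta> g y \<nu> \<longleftrightarrow> 0 < \<delta> \<and> 0 < g \<and>
     (\<forall>k. \<delta> \<le> y (k + 1) - y k \<and> y (k + 1) - y k \<le> g * (1 + real (\<nu> k)) \<and> \<nu> k + 2 \<le> m)"

lemma gap_seq_diff:
  assumes "gap_seq m \<delta> g y \<nu>" "j \<le> k"
  shows "\<delta> * of_int (k - j) \<le> y k - y j" "y k - y j \<le> g * real m * of_int (k - j)"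
proof -
  have "\<delta> * of_int (k - j) \<le> y k - y j \<and> y k - y j \<le> g * real m * of_int (k - j)"
    using assms(2)
  proof (induction k rule: int_ge_induct)
    case (step i)
    have "y (i + 1) - y i \<le> g * (1 + real (\<nu> i))" "\<delta> \<le> y (i + 1) - y i" "\<nu> i + 2 \<le> m" "g > 0"
      using assms(1) unfolding gap_seq_def by blast+
    moreover from this have "g * (1 + real (\<nu> i)) \<le> g * real m" by (intro mult_left_mono) auto
    moreover have "g * real m * of_int (i + 1 - j) = g * real m * of_int (i - j) + g * real m"
      "\<delta> * of_int (i + 1 - j) = \<delta> * of_int (i - j) + \<delta>" by (auto simp: algebra_simps)
    ultimately show ?case using step.IH by linarith
  qed auto
  then show "\<delta> * of_int (k - j) \<le> y k - y j" "y k - y j \<le> g * real m * of_int (k - j)" by auto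
qed

lemma gap_seq_strict_mono:
  assumes "gap_seq m \<delta> g y \<nu>" shows "strict_mono y"
proof (rule strict_monoI)
  fix j k :: int assume "j < k"
  then have "0 < \<delta> * of_int (k - j)" using assms by (auto simp: gap_seq_def)
  then show "y j < y k" using gap_seq_diff(1)[OF assms, of j k] \<open>j < k\<close> by simp
qed

lemma gap_seq_unbounded:
  assumes "gap_seq m \<delta> g y \<nu>"
  shows "\<exists>k\<ge>0. b < y k" "\<exists>k\<le>0. y k < b"
proof -
  have d: "\<delta> > 0" using assms by (simp add: gap_seq_def)
  obtain n where n: "(\<bar>b\<bar> + \<bar>y 0\<bar> + 1) < real n * \<delta>" using reals_Archimedean3[OF d] by blast
  have "b < y (int n)" using gap_seq_diff(1)[OF assms, of 0 "int n"] n by (simp add: mult.commute)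
  then show "\<exists>k\<ge>0. b < y k" by (intro exI[of _ "int n"]) auto
  have "y (- int n) < b" using gap_seq_diff(1)[OF assms, of "- int n" 0] n by (simp add: mult.commute)
  then show "\<exists>k\<le>0. y k < b" by (intro exI[of _ "- int n"]) auto
qed

lemma gap_seq_crossing:
  assumes "gap_seq m \<delta> g y \<nu>"
  shows "\<exists>p. y p \<le> b \<and> b < y (p + 1)" "\<exists>p. y p < b \<and> b \<le> y (p + 1)"
proof -
  obtain k0 k1 where "k0 \<le> 0" "0 \<le> k1" "y k0 < b" "b < y k1"
    using gap_seq_unbounded[OF assms, of b] by blast
  then show "\<exists>p. y p \<le> b \<and> b < y (p + 1)" "\<exists>p. y p < b \<and> b \<le> y (p + 1)"
    using crossing[of k0 k1 "\<lambda>x. x \<le> b" y] crossing[of k0 k1 "\<lambda>x. x < b" y] by (auto simp: not_le not_less)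
qed

text \<open>Each gap is charged to its left end. The gap across \<open>a\<close> is charged to a
  point that is not counted, and since multiplicities are at most m - 2 this costs at most m -
  1.\<close>

lemma gap_seq_count:
  assumes gs: "gap_seq m \<delta> g y \<nu>" and ab: "a < b"
  obtains p q where "p \<le> q" "\<And>k. k \<in> {p<..q} \<Longrightarrow> a < y k \<and> y k < b"
    "(b - a) / g - real m + 1 \<le> (\<Sum>k\<in>{p<..q}. 1 + real (\<nu> k))"
proof -
  note sm = gap_seq_strict_mono[OF gs]
  obtain p q where p: "y p \<le> a" "a < y (p + 1)" and q: "y q < b" "b \<le> y (q + 1)"
    using gap_seq_crossing[OF gs] by metis
  have pq: "p \<le> q"
  proof -
    have "y p < y (q + 1)" using p q ab by linarith
    then show ?thesis using sm by (simp add: strict_mono_less)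
  qed
  have g: "g > 0" and gap: "\<And>k. y (k + 1) - y k \<le> g * (1 + real (\<nu> k))" "\<And>k. \<nu> k + 2 \<le> m"
    using gs by (auto simp: gap_seq_def)
  have "y (q + 1) - y (p + 1) \<le> g * (\<Sum>k\<in>{p<..q}. 1 + real (\<nu> k))"
    using pq
  proof (induction q rule: int_ge_induct)
    case (step i)
    have "{p<..i + 1} = insert (i + 1) {p<..i}" using step by auto
    then show ?case using step.IH gap(1)[of "i + 1"] by (simp add: algebra_simps)
  qed auto
  moreover have "y (p + 1) \<le> a + g * (real m - 1)"
  proof -
    have "g * (1 + real (\<nu> p)) \<le> g * (real m - 1)"
      using g gap(2)[of p] by (intro mult_left_mono) auto
    then show ?thesis using gap(1)[of p] p by linarith
  qed
  ultimately have "b - a \<le> g * ((\<Sum>k\<in>{p<..q}. 1 + real (\<nu> k)) + (real m - 1))"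
    using q(2) by (simp add: algebra_simps)
  then have "(b - a) / g \<le> (\<Sum>k\<in>{p<..q}. 1 + real (\<nu> k)) + (real m - 1)"
    using g by (simp add: pos_divide_le_eq mult.commute)
  moreover have "a < y k \<and> y k < b" if "k \<in> {p<..q}" for k
  proof -
    have "y (p + 1) \<le> y k" "y k \<le> y q" using that sm by (auto simp: strict_mono_less_eq)
    then show ?thesis using p q by linarith
  qed
  ultimately show ?thesis using that pq by (simp add: algebra_simps)
qed

section \<open>Zero counting for finite combinations of shifts\<close>

locale peb =
  fixes m :: nat and \<phi> :: "real \<Rightarrow> real" and w :: "nat \<Rightarrow> real \<Rightarrow> real" and \<gamma> :: "nat \<Rightarrow> real"
    and G :: "nat \<Rightarrow> real \<Rightarrow> real"
  assumes m2: "m \<ge> 2" and weights: "spline_weights m w \<gamma>" and chain: "spline_chain m w \<phi> G"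
    and smooth: "C_k (m - 2) \<phi>" and supp: "\<And>x. x \<notin> {0..real m} \<Longrightarrow> \<phi> x = 0"
    and nonzero: "\<And>x. x \<in> {0<..<real m} \<Longrightarrow> \<phi> x \<noteq> 0"
begin

definition spl :: "int set \<Rightarrow> (int \<Rightarrow> 'a::real_normed_vector) \<Rightarrow> real \<Rightarrow> 'a" where
  "spl F c x = (\<Sum>l\<in>F. \<phi> (x - of_int l) *\<^sub>R c l)"

lemma spl_C_k: "C_k (m - 2) (spl F c)"
  unfolding spl_def[abs_def] by (rule C_k_lincomb[OF smooth])

lemma nderiv_spl:
  "j \<le> m - 2 \<Longrightarrow> nderiv j (spl F c) x = (\<Sum>l\<in>F. nderiv j \<phi> (x - of_int l) *\<^sub>R c l)"
  unfolding spl_def[abs_def] by (subst nderiv_lincomb[OF smooth]) auto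

lemma spl_chain: obtains H where "spline_chain m w (spl F c) H"
  using spline_chain_lincomb[OF weights chain, of c F] m2 unfolding spl_def[abs_def] by auto

lemma nderiv_outside:
  assumes "j \<le> m - 2" "z < 0 \<or> real m \<le> z"
  shows "nderiv j \<phi> z = 0"
proof (cases "z < 0")
  case True
  then show ?thesis using supp
    by (intro nderiv_zero_on_closed[OF smooth assms(1), of "z - 1" 0]) auto
next
  case False
  then show ?thesis using supp assms
    by (intro nderiv_zero_on_closed[OF smooth assms(1), of "real m" "z + 1"]) auto
qed

text \<open>These m indices suffice even at integers: there the shift whose support ends at
  \<open>x\<close> contributes nothing, because the derivatives up to order m - 2 vanish at the
  right end of the support.\<close>

definition active :: "real \<Rightarrow> int set" where
  "active x = {\<lfloor>x\<rfloor> - int m + 1..\<lfloor>x\<rfloor>}"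

lemma nderiv_inactive:
  assumes "j \<le> m - 2" "l \<notin> active x"
  shows "nderiv j \<phi> (x - of_int l) = 0"
proof (rule nderiv_outside[OF assms(1)])
  have "\<lfloor>x\<rfloor> < l \<or> l \<le> \<lfloor>x\<rfloor> - int m" using assms(2) by (auto simp: active_def)
  then show "x - of_int l < 0 \<or> real m \<le> x - of_int l"
    by (auto simp: floor_less_iff le_floor_iff algebra_simps)
qed

lemma active_sum:
  fixes c :: "int \<Rightarrow> 'a::real_normed_vector"
  assumes "j \<le> m - 2" "active x \<subseteq> F" "finite F"
  shows "(\<Sum>l\<in>F. nderiv j \<phi> (x - of_int l) *\<^sub>R c l) = (\<Sum>l\<in>active x. nderiv j \<phi> (x - of_int l) *\<^sub>R c l)"
  using assms(2,3) nderiv_inactive[OF assms(1)] by (intro sum.mono_neutral_right) auto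

abbreviation vanishes_on_knot :: "(real \<Rightarrow> real) \<Rightarrow> int \<Rightarrow> bool" where
  "vanishes_on_knot f k \<equiv> (\<forall>x\<in>{of_int k<..<of_int k + 1}. f x = 0)"

text \<open>A subinterval of zeros would spread to the whole knot interval containing its left
  part.\<close>

lemma nonzero_point:
  assumes ch: "spline_chain m w f H" and nv: "\<And>k. k \<in> {a..<b} \<Longrightarrow> \<not> vanishes_on_knot f k"
    and st: "of_int a \<le> s" "s < t" "t \<le> of_int b"
  shows "\<exists>x\<in>{s<..<t}. f x \<noteq> 0"
proof (rule ccontr)
  assume no: "\<not> ?thesis"
  define l where "l = \<lfloor>s\<rfloor>"
  define t' where "t' = min t (of_int l + 1)"
  have l: "l \<in> {a..<b}" "of_int l \<le> s" "s < of_int l + 1"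
    using st by (auto simp: l_def le_floor_iff floor_less_iff)
  have st': "s < t'" "{s<..<t'} \<subseteq> {of_int l<..<of_int l + 1}" using l st by (auto simp: t'_def)
  have z: "\<And>x. x \<in> {s<..<t'} \<Longrightarrow> f x = 0" using no by (auto simp: t'_def)
  have "vanishes_on_knot f l"
    using spline_chain_vanish[OF weights ch _ st' z] m2 by auto
  then show False using nv l by blast
qed

text \<open>The bound \<open>\<beta>\<close> is free in the induction so that the last nonzero point
  can be placed before the next zero.\<close>

lemma osc_from_zeros:
  fixes y :: "int \<Rightarrow> real"
  assumes ch: "spline_chain m w f H" and f: "C_k (m - 2) f"
    and nv: "\<And>k. k \<in> {a..<b} \<Longrightarrow> \<not> vanishes_on_knot f k"
    and y: "strict_mono y" "\<And>k. k \<in> {p<..q} \<Longrightarrow> of_int a < y k \<and> y k < of_int b"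
    and z: "\<And>k. k \<in> {p<..q} \<Longrightarrow> \<nu> k + 2 \<le> m \<and> zero_order (1 + \<nu> k) f (y k)"
    and r: "p \<le> r" "r \<le> q" "(if r = p then of_int a else y r) < \<beta>" "\<beta> \<le> of_int b"
  shows "\<exists>n t. osc H (of_int a) m 1 n t \<and> t < \<beta> \<and> (r \<noteq> p \<longrightarrow> y r < t) \<and> (\<Sum>k\<in>{p<..r}. 1 + \<nu> k) \<le> n"
proof -
  have fH: "f x = w 1 x * H 1 x" "w 1 x > 0" for x
    using ch spline_weights_pos[OF weights, of 1 x] m2 by (auto simp: spline_chain_def)
  then have fH': "f x \<noteq> 0 \<longleftrightarrow> H 1 x \<noteq> 0" for x by (metis less_irrefl mult_eq_0_iff)
  show ?thesis using r
  proof (induction r arbitrary: \<beta> rule: int_ge_induct)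
    case base
    then obtain t where "t \<in> {of_int a<..<\<beta>}" "f t \<noteq> 0"
      using nonzero_point[OF ch nv, of a b "of_int a" \<beta>] by auto
    then show ?case
      by (intro exI[of _ 0] exI[of _ t]) (auto intro!: osc.start simp: fH')
  next
    case (step r)
    have k: "r + 1 \<in> {p<..q}" using step by auto
    have "(if r = p then of_int a else y r) < y (r + 1)"
      using y(1) y(2)[OF k] by (auto simp: strict_mono_def)
    with step.IH[of "y (r + 1)"] obtain n s where
      s: "osc H (of_int a) m 1 n s" "s < y (r + 1)" "(\<Sum>k\<in>{p<..r}. 1 + \<nu> k) \<le> n"
      using step.prems y(2)[OF k] by auto
    obtain t where t: "y (r + 1) < t" "t < \<beta>" "f t \<noteq> 0"
      using nonzero_point[OF ch nv, of a b "y (r + 1)" \<beta>] step y(2)[OF k] by auto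
    define v where "v = 1 + \<nu> (r + 1)"
    \<comment> \<open>A zero of order at least v supports both weights, and the observed sign change
      decides by parity. The value v + 1 is admissible because v \<le> m - 1.\<close>
    define e where "e = (if H 1 t * H 1 s * (-1) ^ v > 0 then v else v + 1)"
    have e: "v \<le> e" "e \<le> v + 1" "1 \<le> v" by (auto simp: e_def v_def)
    have vm: "v + 1 \<le> m" using z[OF k] by (auto simp: v_def)
    have "H 1 t * H 1 s \<noteq> 0" using t osc_nonzero[OF s(1)] fH' by auto
    then have sg: "H 1 t * H 1 s * (-1) ^ e > 0"
      by (cases "even v") (auto simp: e_def not_less order.order_iff_strict)
    have "osc H (of_int a) m 1 (n + e) t"
    proof (rule osc.step[OF s(1,2) t(1)])
      fix j assume j: "1 \<le> j" "j + 1 < 1 + e"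
      show "H j (y (r + 1)) = 0"
        by (rule spline_chain_zero[OF weights ch m2 f, of v]) (use j e z[OF k] vm in \<open>auto simp: v_def\<close>)
    qed (use e vm sg in auto)
    moreover have "{p<..r + 1} = insert (r + 1) {p<..r}" using step by auto
    ultimately show ?case using t e s
      by (intro exI[of _ "n + e"] exI[of _ t]) (auto simp: v_def)
  qed
qed

lemma zero_count:
  fixes y :: "int \<Rightarrow> real" and c :: "int \<Rightarrow> real"
  assumes f: "f = spl F c" and ab: "a < b"
    and nv: "\<And>k. k \<in> {a..<b} \<Longrightarrow> \<not> vanishes_on_knot f k"
    and y: "strict_mono y" "\<And>k. k \<in> {p<..q} \<Longrightarrow> of_int a < y k \<and> y k < of_int b" "p \<le> q"
    and z: "\<And>k. k \<in> {p<..q} \<Longrightarrow> \<nu> k + 2 \<le> m \<and> zero_order (1 + \<nu> k) f (y k)"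
  shows "int (\<Sum>k\<in>{p<..q}. 1 + \<nu> k) \<le> b - a + int m - 2"
    and "vanishes_on_knot f (a - 1) \<Longrightarrow> vanishes_on_knot f b \<Longrightarrow>
      int (\<Sum>k\<in>{p<..q}. 1 + \<nu> k) \<le> b - a - int m"
proof -
  obtain H where ch: "spline_chain m w f H" unfolding f by (rule spl_chain)
  have ck: "C_k (m - 2) f" unfolding f by (rule spl_C_k)
  obtain n t where nt: "osc H (of_int a) m 1 n t" "t < of_int b" "(\<Sum>k\<in>{p<..q}. 1 + \<nu> k) \<le> n"
  proof -
    have "(if q = p then of_int a else y q) < of_int b" using y(2)[of q] y(3) ab by auto
    from osc_from_zeros[OF ch ck nv y(1,2) z y(3) order_refl this order_refl] that show ?thesis by blast
  qed
  have rc: "rolle_chain m H" by (rule spline_chain_rolle[OF weights ch])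
  show "int (\<Sum>k\<in>{p<..q}. 1 + \<nu> k) \<le> b - a + int m - 2"
    using osc_bound[OF rc _ nt(1,2)] nt(3) m2 by linarith
  assume v: "vanishes_on_knot f (a - 1)" "vanishes_on_knot f b"
  \<comment> \<open>The vanishing neighbour makes the end of the run a zero of order m - 1 by
    continuity of the derivatives.\<close>
  have "nderiv s f (of_int a) = 0" if "s \<le> m - 2" for s
    by (rule nderiv_zero_on_closed[OF ck that, of "of_int a - 1" "of_int a"]) (use v in auto)
  then have za: "zero_order (m - 1) f (of_int a)" unfolding zero_order_def by auto
  have "nderiv s f (of_int b) = 0" if "s \<le> m - 2" for s
    by (rule nderiv_zero_on_closed[OF ck that, of "of_int b" "of_int b + 1"]) (use v in auto)
  then have zb: "zero_order (m - 1) f (of_int b)" unfolding zero_order_def by auto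
  have "int n \<le> b - a - int m"
    using m2 by (intro osc_bound_vanishing[OF rc _ nt(1,2)] conjI
        spline_chain_zero[OF weights ch m2 ck za] spline_chain_zero[OF weights ch m2 ck zb]) auto
  then show "int (\<Sum>k\<in>{p<..q}. 1 + \<nu> k) \<le> b - a - int m" using nt(3) by linarith
qed

text \<open>The zero count with no zeros at all says that a run between two vanishing knot intervals
  has length at least m. A nontrivial combination that vanishes on (0, 1) would give a shorter one:
  it starts at the least index with a nonzero coefficient, at least 1 - m, and ends by 0.\<close>

lemma local_independence:
  fixes c :: "int \<Rightarrow> real"
  assumes van: "\<And>x. x \<in> {0<..<1} \<Longrightarrow> spl {1 - int m..0} c x = 0" and l: "l \<in> {1 - int m..0}"
  shows "c l = 0"
proof (rule ccontr)
  let ?f = "spl {1 - int m..0} c"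
  assume "c l \<noteq> 0"
  define S where "S = {k \<in> {1 - int m..0}. c k \<noteq> 0}"
  have "S \<subseteq> {1 - int m..0}" by (auto simp: S_def)
  then have S: "finite S" "S \<noteq> {}"
    using \<open>c l \<noteq> 0\<close> l finite_subset by (blast, auto simp: S_def)
  define a where "a = Min S"
  have a: "a \<in> {1 - int m..0}" "c a \<noteq> 0" and below: "\<And>k. k \<in> {1 - int m..0} \<Longrightarrow> k < a \<Longrightarrow> c k = 0"
  proof -
    have "a \<in> S" using Min_in[OF S] by (simp add: a_def)
    then show "a \<in> {1 - int m..0}" "c a \<noteq> 0" by (auto simp: S_def)
    fix k assume "k \<in> {1 - int m..0}" "k < a"
    then have "k \<notin> S" using Min_le[OF S(1), of k] by (auto simp: a_def)
    with \<open>k \<in> {1 - int m..0}\<close> show "c k = 0" by (simp add: S_def)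
  qed
  have left: "vanishes_on_knot ?f (a - 1)"
  proof
    fix x :: real assume x: "x \<in> {of_int (a - 1)<..<of_int (a - 1) + 1}"
    have "\<phi> (x - of_int k) *\<^sub>R c k = 0" if "k \<in> {1 - int m..0}" for k
    proof (cases "k < a")
      case False
      then have "x < of_int k" using x by auto
      then show ?thesis using supp[of "x - of_int k"] by auto
    qed (use below that in auto)
    then show "?f x = 0" unfolding spl_def by (intro sum.neutral) blast
  qed
  have nva: "\<not> vanishes_on_knot ?f a"
  proof -
    define x where "x = real_of_int a + 1 / 2"
    have "?f x = (\<Sum>k\<in>{a}. \<phi> (x - of_int k) *\<^sub>R c k)"
      unfolding spl_def
    proof (rule sum.mono_neutral_right)
      show "\<forall>k\<in>{1 - int m..0} - {a}. \<phi> (x - of_int k) *\<^sub>R c k = 0"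
      proof
        fix k assume k: "k \<in> {1 - int m..0} - {a}"
        show "\<phi> (x - of_int k) *\<^sub>R c k = 0"
        proof (cases "k < a")
          case False
          then have "a + 1 \<le> k" using k by auto
          then have "real_of_int a + 1 \<le> of_int k" by linarith
          then show ?thesis using supp[of "x - of_int k"] by (auto simp: x_def)
        qed (use below k in auto)
      qed
    qed (use a in auto)
    also have "\<dots> \<noteq> 0" using nonzero[of "1/2"] a m2 by (simp add: x_def)
    finally have "?f x \<noteq> 0" .
    moreover have "x \<in> {of_int a<..<of_int a + 1}" by (simp add: x_def)
    ultimately show ?thesis by blast
  qed
  have van0: "vanishes_on_knot ?f 0" using van by simp
  define T where "T = {k \<in> {a..0}. vanishes_on_knot ?f k}"
  have "T \<subseteq> {a..0}" "0 \<in> T" using van0 a by (auto simp: T_def)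
  then have T: "finite T" "T \<noteq> {}" using finite_subset by blast+
  define b where "b = Min T"
  have "b \<in> T" using Min_in[OF T] by (simp add: b_def)
  then have b: "a \<le> b" "b \<le> 0" "vanishes_on_knot ?f b" by (simp_all add: T_def)
  have nv: "\<not> vanishes_on_knot ?f k" if "k \<in> {a..<b}" for k
  proof
    assume "vanishes_on_knot ?f k"
    then have "k \<in> T" using that b(2) by (simp add: T_def)
    then show False using Min_le[OF T(1), of k] that by (simp add: b_def)
  qed
  have "a < b" using b nva by (cases "a = b") auto
  \<comment> \<open>With p = q the set of counted zeros is empty; the sequence is a dummy.\<close>
  from zero_count(2)[OF refl this nv, where y = real_of_int and p = 0 and q = 0, OF _ _ _ _ _ left b(3)]
  have "0 \<le> b - a - int m" by (auto simp: strict_mono_def)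
  then show False using b(2) a(1) by auto
qed

lemma uniqueness:
  fixes c :: "int \<Rightarrow> real"
  assumes gs: "gap_seq m \<delta> g y \<nu>" and g: "g < 1" and N: "2 * real m < (real N + 1) * (1 / g - 1)"
    and F: "finite F" "{1 - int m..0} \<subseteq> F"
    and z: "\<And>k s. - real N < y k \<Longrightarrow> y k < real N + 1 \<Longrightarrow> s \<le> \<nu> k \<Longrightarrow>
       (\<Sum>l\<in>F. nderiv s \<phi> (y k - of_int l) *\<^sub>R c l) = 0"
  shows "c 0 = 0"
proof -
  define f where "f = spl F c"
  have num: "\<nu> k + 2 \<le> m" for k using gs by (auto simp: gap_seq_def)
  have g0: "g > 0" using gs by (auto simp: gap_seq_def)
  have zo: "zero_order (1 + \<nu> k) f (y k)" if "- real N < y k" "y k < real N + 1" for k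
    unfolding zero_order_def f_def
  proof (intro allI impI)
    fix s assume s: "s < 1 + \<nu> k"
    then have sm: "s \<le> m - 2" using num[of k] by linarith
    show "nderiv s (spl F c) (y k) = 0"
      unfolding nderiv_spl[OF sm] by (rule z[OF that]) (use s in simp)
  qed
  have "vanishes_on_knot f 0"
  proof (rule ccontr)
    assume nv0: "\<not> vanishes_on_knot f 0"
    \<comment> \<open>The run extends from knot interval 0 to the nearest vanishing knot interval on
      each side, or to the end of the window if there is none.\<close>
    define L where "L = {k \<in> {- int N..-1}. vanishes_on_knot f k}"
    define R where "R = {k \<in> {1..int N}. vanishes_on_knot f k}"
    define a where "a = (if L = {} then - int N else Max L + 1)"
    define b where "b = (if R = {} then int N + 1 else Min R)"
    have LD: "- int N \<le> k \<and> k \<le> -1 \<and> vanishes_on_knot f k" if "k \<in> L" for k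
      using that by (simp add: L_def)
    have RD: "1 \<le> k \<and> k \<le> int N \<and> vanishes_on_knot f k" if "k \<in> R" for k
      using that by (simp add: R_def)
    have fin: "finite L" "finite R"
      using LD RD by (auto intro!: finite_subset[of L "{- int N..-1}"] finite_subset[of R "{1..int N}"])
    have "L \<noteq> {} \<Longrightarrow> a - 1 \<in> L" using Max_in[OF fin(1)] by (simp add: a_def)
    then have a: "- int N \<le> a" "a \<le> 0" "L \<noteq> {} \<Longrightarrow> vanishes_on_knot f (a - 1)"
      using LD[of "a - 1"] by (cases "L = {}"; simp add: a_def)+
    have "R \<noteq> {} \<Longrightarrow> b \<in> R" using Min_in[OF fin(2)] by (simp add: b_def)
    then have b: "b \<le> int N + 1" "1 \<le> b" "R \<noteq> {} \<Longrightarrow> vanishes_on_knot f b"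
      using RD[of b] by (cases "R = {}"; simp add: b_def)+
    have nv: "\<not> vanishes_on_knot f k" if k: "k \<in> {a..<b}" for k
    proof
      assume v: "vanishes_on_knot f k"
      consider "k < 0" | "k = 0" | "k > 0" by linarith
      then show False
      proof cases
        case 1
        then have "k \<in> {- int N..-1}" using k a(1) by simp
        with v have "k \<in> L" unfolding L_def by blast
        then show False using Max_ge[OF fin(1), of k] k by (cases "L = {}") (auto simp: a_def)
      next
        case 3
        then have "k \<in> {1..int N}" using k b(1) by simp
        with v have "k \<in> R" unfolding R_def by blast
        then show False using Min_le[OF fin(2), of k] k by (cases "R = {}") (auto simp: b_def)
      next
        case 2
        with v nv0 show False by blast
      qed
    qed
    have ab: "a < b" "real_of_int a < real_of_int b" using a(2) b(2) by auto
    obtain p q where pq: "p \<le> q" "\<And>k. k \<in> {p<..q} \<Longrightarrow> of_int a < y k \<and> y k < of_int b"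
      "(of_int b - of_int a) / g - real m + 1 \<le> (\<Sum>k\<in>{p<..q}. 1 + real (\<nu> k))"
      by (rule gap_seq_count[OF gs ab(2)]) (rule that)
    have win: "- real N < y k \<and> y k < real N + 1" if "k \<in> {p<..q}" for k
    proof -
      have "- real N \<le> of_int a" "of_int b \<le> real N + 1" using a(1) b(1) by linarith+
      then show ?thesis using pq(2)[OF that] by linarith
    qed
    have zz: "\<nu> k + 2 \<le> m \<and> zero_order (1 + \<nu> k) f (y k)" if "k \<in> {p<..q}" for k
      using num zo win[OF that] by blast
    define Z where "Z = (\<Sum>k\<in>{p<..q}. 1 + \<nu> k)"
    have Z: "(of_int b - of_int a) / g - real m + 1 \<le> real Z" using pq(3) by (simp add: Z_def)
    note zc = zero_count[OF f_def ab(1) nv gap_seq_strict_mono[OF gs] pq(2,1) zz, folded Z_def]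
    show False
    proof (cases "L \<noteq> {} \<and> R \<noteq> {}")
      case True
      then have "int Z \<le> b - a - int m" using zc(2) a(3) b(3) by blast
      then have "real Z \<le> of_int b - of_int a - real m" by linarith
      moreover have "(of_int b - of_int a) * 1 \<le> (of_int b - of_int a) * (1 / g)"
        using g g0 ab by (intro mult_left_mono) auto
      ultimately show False using Z by simp
    next
      case False
      \<comment> \<open>The run reaches an end of the window. The two bounds on \<open>Z\<close>
        would give (b - a)(1/g - 1) \<le> 2m - 3, and \<open>N\<close> is chosen to exclude this for
        runs of length N + 1 or more.\<close>
      then have "int N + 1 \<le> b - a" using a(1,2) b(1,2) by (cases "L = {}"; cases "R = {}") (simp_all add: a_def b_def)
      then have "real N + 1 \<le> of_int b - of_int a" by linarith
      then have "(real N + 1) * (1 / g - 1) \<le> (of_int b - of_int a) * (1 / g - 1)"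
        using g g0 by (intro mult_right_mono) auto
      moreover have "real Z \<le> of_int b - of_int a + real m - 2" using zc(1) by linarith
      moreover have "(of_int b - of_int a) * (1 / g - 1) = (of_int b - of_int a) / g - (of_int b - of_int a)"
        by (simp add: right_diff_distrib)
      ultimately show False using Z N by linarith
    qed
  qed
  then have "spl F c x = 0" if "x \<in> {0<..<1}" for x using that by (auto simp: f_def)
  moreover have "spl F c x = spl {1 - int m..0} c x" if "x \<in> {0<..<1}" for x
  proof -
    have "\<lfloor>x\<rfloor> = 0" using that by (auto simp: floor_eq_iff)
    then have "active x = {1 - int m..0}" by (auto simp: active_def)
    then show ?thesis using active_sum[of 0 x F c] F by (simp add: spl_def)
  qed
  ultimately show ?thesis using local_independence[of c 0] m2 by simp
qed

end

section \<open>Compactness and local estimates\<close>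

text \<open>Tychonoff's theorem; a countable product of metric spaces is metrizable, so its compact
  sets are sequentially compact.\<close>

lemma pointwise_convergent_subseq:
  fixes z :: "nat \<Rightarrow> 'i::countable \<Rightarrow> 'b::metric_space"
  assumes "\<And>k. compact (K k)" "\<And>n k. z n k \<in> K k"
  obtains L r where "strict_mono (r :: nat \<Rightarrow> nat)" "\<And>k. (\<lambda>n. z (r n) k) \<longlonglongrightarrow> L k"
proof -
  have "compactin (product_topology (\<lambda>i::'i. euclidean :: 'b topology) UNIV) (PiE UNIV K)"
    unfolding compactin_PiE using assms(1) by simp
  then have "compact (PiE UNIV K)"
    unfolding euclidean_product_topology compactin_euclidean_iff .
  then have "seq_compact (PiE UNIV K)" by (simp add: compact_eq_seq_compact_metric)
  moreover have "\<forall>n. z n \<in> PiE UNIV K" using assms(2) by auto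
  ultimately obtain L r where r: "strict_mono (r :: nat \<Rightarrow> nat)" "(z \<circ> r) \<longlonglongrightarrow> L"
    unfolding seq_compact_def by metis
  have "(\<lambda>n. z (r n) k) \<longlonglongrightarrow> L k" for k
    using continuous_on_tendsto_compose[OF continuous_on_product_coordinates r(2), of k]
    by (simp add: o_def)
  with r(1) that show ?thesis by blast
qed

lemma infsum_locally_finite:
  assumes "finite F" "\<And>l. l \<notin> F \<Longrightarrow> f l = 0"
  shows "(\<Sum>\<^sub>\<infinity>l\<in>UNIV. f l) = sum f F"
proof -
  have "(\<Sum>\<^sub>\<infinity>l\<in>UNIV. f l) = (\<Sum>\<^sub>\<infinity>l\<in>F. f l)"
    using assms(2) by (intro infsum_cong_neutral) auto
  then show ?thesis using assms(1) by simp
qed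

context peb
begin

lemma continuous_nderiv: "s \<le> m - 2 \<Longrightarrow> continuous_on UNIV (nderiv s \<phi>)"
  by (rule C_k_continuous_nderiv[OF smooth])

lemma nderiv_bound:
  obtains B where "B > 0" "\<And>s z. s \<le> m - 2 \<Longrightarrow> \<bar>nderiv s \<phi> z\<bar> \<le> B"
proof -
  have "\<exists>b. \<forall>z\<in>{0..real m}. \<bar>nderiv s \<phi> z\<bar> \<le> b" if "s \<le> m - 2" for s
  proof -
    have "compact (nderiv s \<phi> ` {0..real m})"
      by (intro compact_continuous_image continuous_on_subset[OF continuous_nderiv[OF that]]) auto
    from compact_imp_bounded[OF this] show ?thesis
      unfolding bounded_iff by auto
  qed
  then obtain b where b: "\<And>s z. s \<le> m - 2 \<Longrightarrow> z \<in> {0..real m} \<Longrightarrow> \<bar>nderiv s \<phi> z\<bar> \<le> b s" by metis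
  define B where "B = 1 + (\<Sum>s\<le>m - 2. \<bar>b s\<bar>)"
  have "\<bar>nderiv s \<phi> z\<bar> \<le> B" if s: "s \<le> m - 2" for s z
  proof (cases "z \<in> {0..real m}")
    case True
    have "\<bar>b s\<bar> \<le> (\<Sum>s\<le>m - 2. \<bar>b s\<bar>)" using s by (intro member_le_sum) auto
    then show ?thesis using b[OF s True] by (simp add: B_def)
  next
    case False
    then show ?thesis using nderiv_outside[OF s, of z] by (auto simp: B_def sum_nonneg add_nonneg_nonneg)
  qed
  moreover have "B > 0" unfolding B_def by (simp add: add_pos_nonneg sum_nonneg)
  ultimately show ?thesis using that by blast
qed

lemma finite_active [simp]: "finite (active x)"
  by (simp add: active_def)

lemma active_bound:
  fixes c :: "int \<Rightarrow> 'a::real_normed_vector"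
  assumes "\<And>z. \<bar>nderiv s \<phi> z\<bar> \<le> B"
  shows "norm (\<Sum>l\<in>F. nderiv s \<phi> (x - of_int l) *\<^sub>R c l) \<le> B * (\<Sum>l\<in>F. norm (c l))"
proof -
  have "norm (\<Sum>l\<in>F. nderiv s \<phi> (x - of_int l) *\<^sub>R c l) \<le> (\<Sum>l\<in>F. \<bar>nderiv s \<phi> (x - of_int l)\<bar> * norm (c l))"
    by (rule order.trans[OF norm_sum]) simp
  also have "\<dots> \<le> (\<Sum>l\<in>F. B * norm (c l))"
    by (intro sum_mono mult_right_mono assms) auto
  finally show ?thesis by (simp add: sum_distrib_left)
qed

text \<open>One finite index set has to serve a whole neighbourhood so that derivatives can be taken
  termwise. As the sum is locally finite, the coefficients may be arbitrary.\<close>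

lemma series_local:
  fixes c :: "int \<Rightarrow> complex"
  assumes f: "f = (\<lambda>x. \<Sum>\<^sub>\<infinity>l\<in>UNIV. c l * complex_of_real (\<phi> (x - of_int l)))"
  obtains F where "finite F" "active x \<subseteq> F" "\<And>y. y \<in> ball x 1 \<Longrightarrow> f y = spl F c y"
proof -
  define F where "F = {\<lfloor>x\<rfloor> - int m - 1..\<lfloor>x\<rfloor> + 2}"
  have act: "active y \<subseteq> F" if "y \<in> ball x 1" for y
  proof -
    have "\<lfloor>x\<rfloor> - 1 \<le> \<lfloor>y\<rfloor>" "\<lfloor>y\<rfloor> \<le> \<lfloor>x\<rfloor> + 1"
      using that by (auto simp: dist_real_def le_floor_iff floor_le_iff abs_less_iff) linarith+
    then show ?thesis by (auto simp: active_def F_def)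
  qed
  have loc: "f y = spl F c y" if "y \<in> ball x 1" for y
  proof -
    have "\<phi> (y - of_int l) = 0" if "l \<notin> F" for l
      using nderiv_inactive[of 0 l y] act[OF \<open>y \<in> ball x 1\<close>] that by auto
    then have "f y = (\<Sum>l\<in>F. c l * complex_of_real (\<phi> (y - of_int l)))"
      unfolding f by (intro infsum_locally_finite) (auto simp: F_def)
    then show ?thesis by (simp add: spl_def scaleR_conv_of_real mult.commute)
  qed
  show ?thesis by (rule that[of F]) (use act[of x] loc in \<open>auto simp: F_def\<close>)
qed

lemma series_nderiv:
  fixes c :: "int \<Rightarrow> complex"
  assumes f: "f = (\<lambda>x. \<Sum>\<^sub>\<infinity>l\<in>UNIV. c l * complex_of_real (\<phi> (x - of_int l)))" and s: "s \<le> m - 2"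
  shows "nderiv s f x = (\<Sum>l\<in>active x. nderiv s \<phi> (x - of_int l) *\<^sub>R c l)"
proof -
  obtain F where F: "finite F" "active x \<subseteq> F" "\<And>y. y \<in> ball x 1 \<Longrightarrow> f y = spl F c y"
    using series_local[OF f] by blast
  have "nderiv s f x = nderiv s (spl F c) x"
    using F(3) by (intro nderiv_cong_open[of "ball x 1"]) auto
  also have "\<dots> = (\<Sum>l\<in>active x. nderiv s \<phi> (x - of_int l) *\<^sub>R c l)"
    unfolding nderiv_spl[OF s] using F by (intro active_sum[OF s])
  finally show ?thesis .
qed

lemma series_continuous:
  fixes c :: "int \<Rightarrow> complex"
  assumes f: "f = (\<lambda>x. \<Sum>\<^sub>\<infinity>l\<in>UNIV. c l * complex_of_real (\<phi> (x - of_int l)))"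
  shows "continuous_on UNIV f"
proof (intro continuous_at_imp_continuous_on ballI)
  fix x
  obtain F where F: "\<And>y. y \<in> ball x 1 \<Longrightarrow> f y = spl F c y" using series_local[OF f] by blast
  have "continuous_on UNIV (spl F c)" using C_k_continuous_nderiv[OF spl_C_k, of 0] by simp
  then have "isCont (spl F c) x" by (simp add: continuous_on_eq_continuous_at)
  moreover have "\<forall>\<^sub>F y in nhds x. f y = spl F c y"
    using F by (intro eventually_nhds_in_open[of "ball x 1", THEN eventually_mono]) auto
  ultimately show "isCont f x" using isCont_cong by blast
qed

section \<open>Limits of splines and stability of the shifts\<close>

lemma tendsto_spl_nderiv:
  fixes d :: "nat \<Rightarrow> int \<Rightarrow> complex"
  assumes "s \<le> m - 2" "\<And>j. (\<lambda>n. d n j) \<longlonglongrightarrow> D j" "Y \<longlonglongrightarrow> y"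
  shows "(\<lambda>n. \<Sum>j\<in>F. nderiv s \<phi> (Y n - of_int j) *\<^sub>R d n j)
     \<longlonglongrightarrow> (\<Sum>j\<in>F. nderiv s \<phi> (y - of_int j) *\<^sub>R D j)"
proof (intro tendsto_sum tendsto_scaleR assms(2))
  fix j
  show "(\<lambda>n. nderiv s \<phi> (Y n - of_int j)) \<longlonglongrightarrow> nderiv s \<phi> (y - of_int j)"
    using continuous_nderiv[OF assms(1)] assms(3)
    by (intro isCont_tendsto_compose[of _ "nderiv s \<phi>"] tendsto_diff)
      (auto simp: continuous_on_eq_continuous_at)
qed

text \<open>Otherwise normalized counterexamples converge to a nonzero combination vanishing on
  [0, 1], whose real and imaginary parts contradict local independence.\<close>

lemma stability_sup:
  "\<exists>\<kappa>>0. \<forall>c :: int \<Rightarrow> complex. \<exists>x\<in>{0..1}.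
     \<kappa> * (\<Sum>j\<in>{1 - int m..0}. norm (c j)) \<le> norm (spl {1 - int m..0} c x)"
proof (rule ccontr)
  let ?A = "{1 - int m..0}"
  assume no: "\<not> ?thesis"
  have "\<exists>c :: int \<Rightarrow> complex. \<forall>x\<in>{0..1}.
     norm (spl ?A c x) < inverse (real (Suc n)) * (\<Sum>j\<in>?A. norm (c j))" for n
    using no by (meson inverse_positive_iff_positive not_le of_nat_0_less_iff zero_less_Suc)
  then obtain c :: "nat \<Rightarrow> int \<Rightarrow> complex" where c: "\<And>n x. x \<in> {0..1} \<Longrightarrow>
     norm (spl ?A (c n) x) < inverse (real (Suc n)) * (\<Sum>j\<in>?A. norm (c n j))" by metis
  define S where "S n = (\<Sum>j\<in>?A. norm (c n j))" for n
  have S: "S n > 0" for n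
  proof -
    have "norm (spl ?A (c n) 0) < inverse (real (Suc n)) * S n"
      unfolding S_def by (rule c) simp
    then have "0 < inverse (real (Suc n)) * S n" using norm_ge_zero order.strict_trans1 by blast
    then show ?thesis by (simp add: zero_less_mult_iff)
  qed
  \<comment> \<open>The normalization keeps all entries in the unit disc and the limit away from 0;
    outside \<open>?A\<close> the entries are irrelevant and are set to 0.\<close>
  define d where "d n j = (if j \<in> ?A then c n j /\<^sub>R S n else 0)" for n j
  have dS: "(\<Sum>j\<in>?A. norm (d n j)) = 1" for n
  proof -
    have "(\<Sum>j\<in>?A. norm (d n j)) = (\<Sum>j\<in>?A. norm (c n j) / S n)"
      using S[of n] by (intro sum.cong) (auto simp: d_def divide_inverse)
    also have "\<dots> = (\<Sum>j\<in>?A. norm (c n j)) / S n" by (simp only: sum_divide_distrib)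
    also have "\<dots> = S n / S n" by (simp only: S_def)
    finally show ?thesis using S[of n] by simp
  qed
  have "norm (d n j) \<le> 1" for n j
  proof (cases "j \<in> ?A")
    case True
    then have "norm (d n j) \<le> (\<Sum>j\<in>?A. norm (d n j))" by (intro member_le_sum) auto
    then show ?thesis using dS by simp
  next
    case False
    then have "d n j = 0" unfolding d_def by (rule if_not_P)
    then show ?thesis by simp
  qed
  then have "d n j \<in> cball 0 1" for n j by (simp add: dist_norm)
  then obtain D r where r: "strict_mono (r :: nat \<Rightarrow> nat)" "\<And>j. (\<lambda>n. d (r n) j) \<longlonglongrightarrow> D j"
    using pointwise_convergent_subseq[of "\<lambda>_. cball 0 1" d, OF compact_cball] by blast
  have z: "spl ?A D x = 0" if x: "x \<in> {0..1}" for x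
  proof -
    have "(\<lambda>n. spl ?A (d (r n)) x) \<longlonglongrightarrow> spl ?A D x"
      using tendsto_spl_nderiv[of 0 "\<lambda>n. d (r n)" D "\<lambda>_. x" x ?A] r(2) by (simp add: spl_def)
    moreover have "(\<lambda>n. spl ?A (d (r n)) x) \<longlonglongrightarrow> 0"
    proof (rule Lim_null_comparison)
      show "(\<lambda>n. inverse (real (Suc (r n)))) \<longlonglongrightarrow> 0"
        using LIMSEQ_subseq_LIMSEQ[OF LIMSEQ_inverse_real_of_nat r(1)] by (simp add: o_def)
      have "norm (spl ?A (d n) x) \<le> inverse (real (Suc n))" for n
      proof -
        have "spl ?A (d n) x = spl ?A (c n) x /\<^sub>R S n"
          unfolding spl_def scaleR_sum_right by (rule sum.cong) (auto simp: d_def mult.commute)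
        then have "norm (spl ?A (d n) x) = norm (spl ?A (c n) x) / S n"
          using S[of n] by (simp add: divide_inverse mult.commute)
        also have "\<dots> \<le> inverse (real (Suc n))"
          using c[OF x, of n] S[of n] unfolding S_def[symmetric] by (simp add: pos_divide_le_eq)
        finally show ?thesis .
      qed
      then show "\<forall>\<^sub>F n in sequentially. norm (spl ?A (d (r n)) x) \<le> inverse (real (Suc (r n)))"
        by auto
    qed
    ultimately show ?thesis using LIMSEQ_unique by blast
  qed
  have "D j = 0" if j: "j \<in> ?A" for j
  proof -
    have "spl ?A (\<lambda>j. Re (D j)) x = 0" "spl ?A (\<lambda>j. Im (D j)) x = 0" if "x \<in> {0<..<1}" for x
    proof -
      have "spl ?A D x = 0" using z[of x] that by auto
      then have "Re (spl ?A D x) = 0" "Im (spl ?A D x) = 0" by simp_all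
      then show "spl ?A (\<lambda>j. Re (D j)) x = 0" "spl ?A (\<lambda>j. Im (D j)) x = 0" by (simp_all add: spl_def)
    qed
    then have "Re (D j) = 0" "Im (D j) = 0"
      using local_independence[OF _ j, of "\<lambda>j. Re (D j)"] local_independence[OF _ j, of "\<lambda>j. Im (D j)"]
      by auto
    then show ?thesis by (simp add: complex_eq_iff)
  qed
  moreover have "(\<lambda>n. \<Sum>j\<in>?A. norm (d (r n) j)) \<longlonglongrightarrow> (\<Sum>j\<in>?A. norm (D j))"
    by (intro tendsto_intros r(2))
  ultimately show False using dS by (simp add: LIMSEQ_const_iff)
qed

text \<open>Integral norms do not see single points. Uniform continuity of \<phi> spreads the bound
  from one point to an interval whose length does not depend on the coefficients.\<close>

lemma stability:
  obtains \<eta> where "\<eta> > 0" "\<And>(c :: int \<Rightarrow> complex) l. \<exists>s t. of_int l \<le> s \<and> t \<le> of_int l + 1 \<and> s + \<eta> \<le> t \<and>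
     (\<forall>x\<in>{s..<t}. \<eta> * (\<Sum>j\<in>active x. norm (c j)) \<le> norm (\<Sum>j\<in>active x. \<phi> (x - of_int j) *\<^sub>R c j))"
proof -
  let ?A = "{1 - int m..0}"
  obtain \<kappa> where k: "\<kappa> > 0" "\<And>c :: int \<Rightarrow> complex. \<exists>x\<in>{0..1}. \<kappa> * (\<Sum>j\<in>?A. norm (c j)) \<le> norm (spl ?A c x)"
    using stability_sup by blast
  have "uniformly_continuous_on {0..real m + 1} \<phi>"
    using continuous_nderiv[of 0] continuous_on_subset
    by (intro compact_uniformly_continuous) auto
  then obtain d where d: "d > 0" "\<And>u v. u \<in> {0..real m + 1} \<Longrightarrow> v \<in> {0..real m + 1} \<Longrightarrow> \<bar>v - u\<bar> < d \<Longrightarrow> \<bar>\<phi> v - \<phi> u\<bar> < \<kappa> / 2"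
    using k(1) unfolding uniformly_continuous_on_def dist_real_def
    by (metis half_gt_zero)
  \<comment> \<open>The first term uses the modulus of continuity, the second lets the interval fit
    into [0, 1] on one side of \<open>x\<close>, and the third is the part of \<kappa> left after
    the perturbation.\<close>
  define \<eta> where "\<eta> = min (d / 2) (min (1 / 2) (\<kappa> / 2))"
  have eta: "\<eta> > 0" "\<eta> < d" "\<eta> \<le> 1 / 2" "\<eta> \<le> \<kappa> / 2" using d(1) k(1) by (auto simp: \<eta>_def)
  have near: "\<eta> * (\<Sum>j\<in>?A. norm (c j)) \<le> norm (spl ?A c y)"
    if x: "x \<in> {0..1}" "\<kappa> * (\<Sum>j\<in>?A. norm (c j)) \<le> norm (spl ?A c x)" and y: "y \<in> {0..1}" "\<bar>y - x\<bar> \<le> \<eta>"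
    for x y and c :: "int \<Rightarrow> complex"
  proof -
    have "norm (spl ?A c x - spl ?A c y) = norm (\<Sum>j\<in>?A. (\<phi> (x - of_int j) - \<phi> (y - of_int j)) *\<^sub>R c j)"
      by (simp add: spl_def sum_subtractf scaleR_left_diff_distrib)
    also have "\<dots> \<le> (\<Sum>j\<in>?A. \<bar>\<phi> (x - of_int j) - \<phi> (y - of_int j)\<bar> * norm (c j))"
      by (rule order.trans[OF norm_sum]) simp
    also have "\<dots> \<le> (\<Sum>j\<in>?A. \<kappa> / 2 * norm (c j))"
    proof (intro sum_mono mult_right_mono)
      fix j assume "j \<in> ?A"
      then have "of_int j \<le> (0::real)" "1 - real m \<le> of_int j" by auto
      then show "\<bar>\<phi> (x - of_int j) - \<phi> (y - of_int j)\<bar> \<le> \<kappa> / 2"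
        using x y eta by (intro less_imp_le[OF d(2)]) auto
    qed auto
    also have "\<dots> = \<kappa> / 2 * (\<Sum>j\<in>?A. norm (c j))" by (simp add: sum_distrib_left)
    finally have "\<kappa> / 2 * (\<Sum>j\<in>?A. norm (c j)) \<le> norm (spl ?A c y)"
      using x(2) norm_triangle_ineq2[of "spl ?A c x" "spl ?A c y"] by linarith
    moreover have "\<eta> * (\<Sum>j\<in>?A. norm (c j)) \<le> \<kappa> / 2 * (\<Sum>j\<in>?A. norm (c j))"
      using eta by (intro mult_right_mono sum_nonneg) auto
    ultimately show ?thesis by linarith
  qed
  have "\<exists>s t. of_int l \<le> s \<and> t \<le> of_int l + 1 \<and> s + \<eta> \<le> t \<and>
     (\<forall>x\<in>{s..<t}. \<eta> * (\<Sum>j\<in>active x. norm (c j)) \<le> norm (\<Sum>j\<in>active x. \<phi> (x - of_int j) *\<^sub>R c j))"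
    for c :: "int \<Rightarrow> complex" and l
  proof -
    define c' where "c' j = c (j + l)" for j
    obtain x where x: "x \<in> {0..1}" "\<kappa> * (\<Sum>j\<in>?A. norm (c' j)) \<le> norm (spl ?A c' x)" using k(2) by blast
    define s0 where "s0 = (if x \<le> 1 / 2 then x else x - \<eta>)"
    have s0: "0 \<le> s0" "s0 + \<eta> \<le> 1" "\<And>y. y \<in> {s0..s0 + \<eta>} \<Longrightarrow> \<bar>y - x\<bar> \<le> \<eta>"
      using x eta by (auto simp: s0_def split: if_splits)
    have "\<eta> * (\<Sum>j\<in>active y. norm (c j)) \<le> norm (\<Sum>j\<in>active y. \<phi> (y - of_int j) *\<^sub>R c j)"
      if y: "y \<in> {of_int l + s0..<of_int l + s0 + \<eta>}" for y
    proof -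
      have "\<lfloor>y\<rfloor> = l" using y s0 by (auto simp: floor_eq_iff)
      then have act: "active y = (\<lambda>j. j + l) ` ?A" by (auto simp: active_def image_iff)
      have inj: "inj_on (\<lambda>j. j + l) ?A" by (auto simp: inj_on_def)
      have "\<eta> * (\<Sum>j\<in>?A. norm (c' j)) \<le> norm (spl ?A c' (y - of_int l))"
        using y s0(1,2) s0(3)[of "y - of_int l"] by (intro near[OF x]) auto
      then show ?thesis
        unfolding act sum.reindex[OF inj] by (simp add: o_def c'_def spl_def algebra_simps)
    qed
    then show ?thesis using s0 by (intro exI[of _ "of_int l + s0"] exI[of _ "of_int l + s0 + \<eta>"]) auto
  qed
  with eta(1) that show ?thesis by blast
qed

text \<open>Coefficients near the ends of the window are not determined by the samples in it. The second
  alternative takes care of them: where it fails, the ratios \<open>d j / d 0\<close> are bounded, so that a limit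
  exists to which uniqueness applies.\<close>
lemma local_estimate:
  assumes gs: "gap_seq m \<delta> g x \<mu>" and g: "g < 1" and N: "2 * real m < (real N + 1) * (1 / g - 1)"
    and eps: "\<epsilon> > 0" and F: "finite F" "{1 - int m..0} \<subseteq> F"
  obtains C where "C > 0" "\<And>(l :: int) (d :: int \<Rightarrow> complex).
     (\<exists>k s. - real N < x k - of_int l \<and> x k - of_int l < real N + 1 \<and> s \<le> \<mu> k \<and>
        norm (d 0) \<le> C * norm (\<Sum>j\<in>F. nderiv s \<phi> (x k - of_int l - of_int j) *\<^sub>R d j)) \<or>
     (\<exists>j\<in>F. norm (d 0) \<le> \<epsilon> * norm (d j))"
proof (rule ccontr)
  assume no: "\<not> thesis"
  have zF: "0 \<in> F" using F m2 by auto
  define P where "P C l d k s \<longleftrightarrow> - real N < x k - of_int l \<and> x k - of_int l < real N + 1 \<and> s \<le> \<mu> k \<and>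
        norm (d 0) \<le> C * norm (\<Sum>j\<in>F. nderiv s \<phi> (x k - of_int l - of_int j) *\<^sub>R d j)"
    for C :: real and l :: int and d :: "int \<Rightarrow> complex" and k s
  define Q where "Q d j \<longleftrightarrow> norm (d 0) \<le> \<epsilon> * norm (d j)" for d :: "int \<Rightarrow> complex" and j
  have "\<exists>l d. (\<forall>k s. \<not> P (real (Suc n)) l d k s) \<and> (\<forall>j\<in>F. \<not> Q d j)" for n
    using that[of "real (Suc n)", folded P_def Q_def] no by (metis of_nat_0_less_iff zero_less_Suc)
  then obtain l :: "nat \<Rightarrow> int" and e :: "nat \<Rightarrow> int \<Rightarrow> complex" where
    e: "\<And>n k s. \<not> P (real (Suc n)) (l n) (e n) k s" "\<And>n j. j \<in> F \<Longrightarrow> \<not> Q (e n) j" by metis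
  have e1: "real (Suc n) * norm (\<Sum>j\<in>F. nderiv s \<phi> (x k - of_int (l n) - of_int j) *\<^sub>R e n j) < norm (e n 0)"
    if "- real N < x k - of_int (l n)" "x k - of_int (l n) < real N + 1" "s \<le> \<mu> k" for n k s
    using e(1)[of n k s] that unfolding P_def by (simp only: not_le simp_thms)
  have e2: "\<epsilon> * norm (e n j) < norm (e n 0)" if "j \<in> F" for n j
    using e(2)[OF that, of n] unfolding Q_def by simp
  have e0: "e n 0 \<noteq> 0" for n
  proof
    assume "e n 0 = 0"
    then show False using e2[OF zF, of n] by simp
  qed
  \<comment> \<open>Scaling the central coefficient to 1 keeps the limit nontrivial; the failed
    second alternative bounds the others by 1 / \<epsilon>.\<close>
  define d where "d n j = (if j \<in> F then e n j / e n 0 else 0)" for n j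
  have d0: "d n 0 = 1" for n using zF e0 by (simp add: d_def)
  have db: "d n j \<in> cball 0 (1 / \<epsilon>)" for n j
    using e2[of j n] e0[of n] eps by (auto simp: d_def dist_norm norm_divide field_simps)
  have dsum: "norm (\<Sum>j\<in>F. nderiv s \<phi> (x k - of_int (l n) - of_int j) *\<^sub>R d n j) \<le> inverse (real (Suc n))"
    if "- real N < x k - of_int (l n)" "x k - of_int (l n) < real N + 1" "s \<le> \<mu> k" for n k s
  proof -
    define V where "V = (\<Sum>j\<in>F. nderiv s \<phi> (x k - of_int (l n) - of_int j) *\<^sub>R e n j)"
    have "(\<Sum>j\<in>F. nderiv s \<phi> (x k - of_int (l n) - of_int j) *\<^sub>R d n j) = V / e n 0"
      unfolding V_def sum_divide_distrib by (rule sum.cong) (auto simp: d_def scaleR_conv_of_real)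
    moreover have "0 < norm (e n 0)" using e0[of n] by simp
    moreover have "real (Suc n) * norm V < norm (e n 0)" unfolding V_def by (rule e1[OF that])
    moreover from this have "norm V \<le> inverse (real (Suc n)) * norm (e n 0)"
      by (simp add: field_simps del: of_nat_Suc)
    ultimately show ?thesis by (simp add: norm_divide pos_divide_le_eq)
  qed
  \<comment> \<open>Recentring: index 0 is to label the last sample at or before \<open>l n\<close>.
    Then the k-th sample stays within |k| + 1 gaps of the centre, whatever n is.\<close>
  have "\<exists>q. x q \<le> of_int (l n) \<and> of_int (l n) < x (q + 1)" for n
    using gap_seq_crossing(1)[OF gs] by blast
  then obtain q where q: "\<And>n. x (q n) \<le> of_int (l n)" "\<And>n. of_int (l n) < x (q n + 1)" by metis
  define Y where "Y n k = x (k + q n) - of_int (l n)" for n k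
  define \<nu> where "\<nu> n k = \<mu> (k + q n)" for n k
  define R where "R k = g * real m * (of_int \<bar>k\<bar> + 1)" for k :: int
  have g0: "g > 0" using gs by (simp add: gap_seq_def)
  have Yb: "Y n k \<in> {- R k..R k}" for n k
  proof -
    have up: "x (q n + 1) - x (q n) \<le> g * real m"
      using gap_seq_diff(2)[OF gs, of "q n" "q n + 1"] by simp
    have mono: "x j \<le> x k" if "j \<le> k" for j k
      using gap_seq_strict_mono[OF gs] that by (simp add: strict_mono_less_eq)
    have R: "R k = g * real m * of_int \<bar>k\<bar> + g * real m" by (simp add: R_def algebra_simps)
    have nn: "0 \<le> g * real m * of_int \<bar>k\<bar>" using g0 by simp
    show ?thesis
    proof (cases "k \<ge> 0")
      case True
      then have "x (k + q n) - x (q n) \<le> g * real m * of_int \<bar>k\<bar>"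
        using gap_seq_diff(2)[OF gs, of "q n" "k + q n"] by simp
      moreover have "x (q n) \<le> x (k + q n)" using True by (intro mono) auto
      ultimately show ?thesis using up q[of n] nn unfolding R Y_def by auto
    next
      case False
      then have "x (q n) - x (k + q n) \<le> g * real m * of_int \<bar>k\<bar>"
        using gap_seq_diff(2)[OF gs, of "k + q n" "q n"] by simp
      moreover have "x (k + q n) \<le> x (q n)" using False by (intro mono) auto
      ultimately show ?thesis using up q[of n] nn unfolding R Y_def by auto
    qed
  qed
  obtain r1 y where r1: "strict_mono (r1 :: nat \<Rightarrow> nat)" "\<And>k. (\<lambda>n. Y (r1 n) k) \<longlonglongrightarrow> y k"
    using pointwise_convergent_subseq[of "\<lambda>k. {- R k..R k}" Y, OF compact_Icc Yb] by blast
  have "\<mu> k + 2 \<le> m" for k using gs unfolding gap_seq_def by blast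
  then have \<nu>b: "\<nu> n k \<in> {..m}" for n k unfolding \<nu>_def by (meson add_leD1 atMost_iff)
  \<comment> \<open>Multiplicities are treated as points of a finite, hence compact, set of
    reals.\<close>
  obtain r2 v' where r2: "strict_mono (r2 :: nat \<Rightarrow> nat)" "\<And>k. (\<lambda>n. real (\<nu> (r1 (r2 n)) k)) \<longlonglongrightarrow> v' k"
    using pointwise_convergent_subseq[where K="\<lambda>_. real ` {..m}" and z="\<lambda>n k. real (\<nu> (r1 n) k)",
        OF finite_imp_compact[OF finite_imageI[OF finite_atMost]] imageI[OF \<nu>b]] by blast
  obtain r3 D where r3: "strict_mono (r3 :: nat \<Rightarrow> nat)" "\<And>k. (\<lambda>n. d (r1 (r2 (r3 n))) k) \<longlonglongrightarrow> D k"
    using pointwise_convergent_subseq[of "\<lambda>k. cball 0 (1 / \<epsilon>)" "\<lambda>n. d (r1 (r2 n))",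
        OF compact_cball db] by blast
  define r where "r n = r1 (r2 (r3 n))" for n
  have sm: "strict_mono r" using r1(1) r2(1) r3(1) by (auto simp: r_def strict_mono_def)
  have Yl: "(\<lambda>n. Y (r n) k) \<longlonglongrightarrow> y k" for k
    using LIMSEQ_subseq_LIMSEQ[OF r1(2) strict_mono_o[OF r2(1) r3(1)]] by (simp add: r_def o_def)
  \<comment> \<open>A convergent sequence of integers is eventually constant, so the limit sample
    inherits every derivative order of its approximants.\<close>
  have "\<exists>v. \<forall>\<^sub>F n in sequentially. \<nu> (r n) k = v" for k
  proof -
    have "(\<lambda>n. real (\<nu> (r n) k)) \<longlonglongrightarrow> v' k"
      using LIMSEQ_subseq_LIMSEQ[OF r2(2) r3(1)] by (simp add: r_def o_def)
    then obtain n0 where n0: "\<And>n. n \<ge> n0 \<Longrightarrow> dist (real (\<nu> (r n) k)) (v' k) < 1 / 2"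
      using metric_LIMSEQ_D[of _ _ "1 / 2"] by (metis half_gt_zero zero_less_one)
    have "\<nu> (r n) k = \<nu> (r n0) k" if "n \<ge> n0" for n
    proof -
      have "dist (real (\<nu> (r n) k)) (real (\<nu> (r n0) k)) < 1"
        using n0[OF that] n0[OF order_refl] by (rule dist_triangle_half_l)
      then show ?thesis by (simp add: dist_real_def)
    qed
    then show ?thesis by (intro exI[of _ "\<nu> (r n0) k"] eventually_sequentiallyI[of n0])
  qed
  then obtain v where \<nu>e: "\<And>k. \<forall>\<^sub>F n in sequentially. \<nu> (r n) k = v k" by metis
  have Dl: "(\<lambda>n. d (r n) k) \<longlonglongrightarrow> D k" for k using r3(2) by (simp add: r_def)
  have "D 0 = 1" using LIMSEQ_unique[OF Dl[of 0]] d0 by simp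
  have gsn: "\<delta> \<le> Y n (k + 1) - Y n k \<and> Y n (k + 1) - Y n k \<le> g * (1 + real (\<nu> n k)) \<and> \<nu> n k + 2 \<le> m" for n k
  proof -
    have e: "k + 1 + q n = k + q n + 1" by simp
    have "\<delta> \<le> x (k + q n + 1) - x (k + q n) \<and> x (k + q n + 1) - x (k + q n) \<le> g * (1 + real (\<mu> (k + q n))) \<and> \<mu> (k + q n) + 2 \<le> m"
      using gs unfolding gap_seq_def by blast
    then show ?thesis unfolding Y_def \<nu>_def e by linarith
  qed
  have gsl: "gap_seq m \<delta> g y v"
    unfolding gap_seq_def
  proof (intro conjI allI)
    show "0 < \<delta>" "0 < g" using gs by (auto simp: gap_seq_def)
    fix k
    have dl: "(\<lambda>n. Y (r n) (k + 1) - Y (r n) k) \<longlonglongrightarrow> y (k + 1) - y k" by (intro tendsto_intros Yl)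
    show "\<delta> \<le> y (k + 1) - y k" by (rule LIMSEQ_le_const[OF dl]) (use gsn in auto)
    have "(\<lambda>n. g * (1 + real (\<nu> (r n) k))) \<longlonglongrightarrow> g * (1 + real (v k))"
      by (rule tendsto_eventually, rule eventually_mono[OF \<nu>e[of k]]) simp
    then show "y (k + 1) - y k \<le> g * (1 + real (v k))"
      by (rule LIMSEQ_le[OF dl]) (use gsn in auto)
    have "\<exists>n. \<nu> (r n) k = v k" using eventually_happens'[OF _ \<nu>e[of k]] by auto
    then show "v k + 2 \<le> m" using gsn by metis
  qed
  have "(\<Sum>j\<in>F. nderiv s \<phi> (y k - of_int j) *\<^sub>R D j) = 0"
    if k: "- real N < y k" "y k < real N + 1" and s: "s \<le> v k" for k s
  proof -
    have s2: "s \<le> m - 2" using gsl s unfolding gap_seq_def by (metis add_le_imp_le_diff order_trans)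
    have "(\<lambda>n. \<Sum>j\<in>F. nderiv s \<phi> (Y (r n) k - of_int j) *\<^sub>R d (r n) j)
       \<longlonglongrightarrow> (\<Sum>j\<in>F. nderiv s \<phi> (y k - of_int j) *\<^sub>R D j)"
      by (rule tendsto_spl_nderiv[OF s2 Dl Yl])
    moreover have "(\<lambda>n. \<Sum>j\<in>F. nderiv s \<phi> (Y (r n) k - of_int j) *\<^sub>R d (r n) j) \<longlonglongrightarrow> 0"
    proof (rule Lim_null_comparison)
      show "(\<lambda>n. inverse (real (Suc (r n)))) \<longlonglongrightarrow> 0"
        using LIMSEQ_subseq_LIMSEQ[OF LIMSEQ_inverse_real_of_nat sm] by (simp add: o_def)
      \<comment> \<open>The window is open: a limit sample inside it is approximated by samples
        inside it.\<close>
      have "\<forall>\<^sub>F n in sequentially. - real N < Y (r n) k" "\<forall>\<^sub>F n in sequentially. Y (r n) k < real N + 1"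
        using order_tendstoD[OF Yl[of k]] k by auto
      with \<nu>e[of k] show "\<forall>\<^sub>F n in sequentially.
         norm (\<Sum>j\<in>F. nderiv s \<phi> (Y (r n) k - of_int j) *\<^sub>R d (r n) j) \<le> inverse (real (Suc (r n)))"
      proof eventually_elim
        case (elim n)
        then show ?case using dsum[of "k + q (r n)" "r n" s] s by (simp add: Y_def \<nu>_def)
      qed
    qed
    ultimately show ?thesis using LIMSEQ_unique by blast
  qed
  \<comment> \<open>Real parts suffice, since the central coefficient of the limit is 1.\<close>
  then have "(\<Sum>j\<in>F. nderiv s \<phi> (y k - of_int j) *\<^sub>R Re (D j)) = 0"
    if "- real N < y k" "y k < real N + 1" "s \<le> v k" for k s
  proof -
    have "Re (\<Sum>j\<in>F. nderiv s \<phi> (y k - of_int j) *\<^sub>R D j) = 0"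
      using that \<open>\<And>k s. - real N < y k \<Longrightarrow> y k < real N + 1 \<Longrightarrow> s \<le> v k \<Longrightarrow>
        (\<Sum>j\<in>F. nderiv s \<phi> (y k - of_int j) *\<^sub>R D j) = 0\<close> by simp
    then show ?thesis by simp
  qed
  from uniqueness[OF gsl g N F this] have "Re (D 0) = 0" by simp
  with \<open>D 0 = 1\<close> show False by simp
qed

end

section \<open>Norm inequalities\<close>

lemma nn_integral_count_indicator:
  fixes g :: "'i \<Rightarrow> ennreal"
  assumes "finite A"
  shows "(\<integral>\<^sup>+l. g l * indicator A l \<partial>count_space UNIV) = (\<Sum>l\<in>A. g l)"
  using nn_integral_count_space'[OF assms, of UNIV "\<lambda>l. g l * indicator A l"]
  by (auto simp: indicator_def)

lemma sum_le_nn_integral_count: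
  fixes g :: "'i \<Rightarrow> ennreal"
  assumes "finite A"
  shows "(\<Sum>l\<in>A. g l) \<le> (\<integral>\<^sup>+l. g l \<partial>count_space UNIV)"
proof -
  have "(\<Sum>l\<in>A. g l) = (\<integral>\<^sup>+l. g l * indicator A l \<partial>count_space UNIV)"
    by (rule nn_integral_count_indicator[OF assms, symmetric])
  also have "\<dots> \<le> (\<integral>\<^sup>+l. g l \<partial>count_space UNIV)"
    by (intro nn_integral_mono) (auto simp: indicator_def)
  finally show ?thesis .
qed

text \<open>Sums over samples become integrals over a counting measure, so that Tonelli's theorem
  can exchange them with sums and integrals.\<close>

lemma infsum_eq_nn_integral:
  fixes f :: "int \<Rightarrow> ennreal"
  shows "(\<Sum>\<^sub>\<infinity>k\<in>UNIV. f k) = (\<integral>\<^sup>+k. f k \<partial>count_space UNIV)"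
proof (rule antisym)
  have eq: "(\<Sum>\<^sub>\<infinity>k\<in>UNIV. f k) = (SUP F\<in>{F. finite F \<and> F \<subseteq> UNIV}. sum f F)"
    by (rule nonneg_infsum_complete) simp
  show "(\<Sum>\<^sub>\<infinity>k\<in>UNIV. f k) \<le> (\<integral>\<^sup>+k. f k \<partial>count_space UNIV)"
    unfolding eq by (rule SUP_least) (auto intro: sum_le_nn_integral_count)
  have "(\<integral>\<^sup>+k. f k \<partial>count_space UNIV) = (\<integral>\<^sup>+n. f (int_decode n) \<partial>count_space UNIV)"
    using nn_integral_bij_count_space[OF bij_int_decode, of f] by simp
  also have "\<dots> = (SUP n. \<Sum>i<n. f (int_decode i))"
    by (simp add: nn_integral_count_space_nat suminf_eq_SUP)
  also have "\<dots> \<le> (\<Sum>\<^sub>\<infinity>k\<in>UNIV. f k)"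
    unfolding eq
  proof (rule SUP_least)
    fix n :: nat
    have inj: "inj_on int_decode {..<n}" using inj_int_decode inj_on_subset by blast
    have "(\<Sum>i<n. f (int_decode i)) = sum f (int_decode ` {..<n})"
      by (simp add: sum.reindex[OF inj])
    also have "\<dots> \<le> (SUP F\<in>{F. finite F \<and> F \<subseteq> UNIV}. sum f F)" by (rule SUP_upper) auto
    finally show "(\<Sum>i<n. f (int_decode i)) \<le> (SUP F\<in>{F. finite F \<and> F \<subseteq> UNIV}. sum f F)" .
  qed
  finally show "(\<integral>\<^sup>+k. f k \<partial>count_space UNIV) \<le> (\<Sum>\<^sub>\<infinity>k\<in>UNIV. f k)" .
qed

lemma powr_sum_le:
  fixes a :: "'i \<Rightarrow> real"
  assumes "finite A" "\<And>i. i \<in> A \<Longrightarrow> 0 \<le> a i" "P > 0"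
  shows "(\<Sum>i\<in>A. a i) powr P \<le> real (card A) powr P * (\<Sum>i\<in>A. a i powr P)"
proof (cases "A = {}")
  case False
  define M where "M = Max (a ` A)"
  have "M \<in> a ` A" unfolding M_def using assms(1) False by (intro Max_in) auto
  then obtain i where i: "i \<in> A" "M = a i" by auto
  have "(\<Sum>i\<in>A. a i) \<le> real (card A) * M"
    using assms(1) by (intro sum_bounded_above) (auto simp: M_def)
  then have "(\<Sum>i\<in>A. a i) powr P \<le> (real (card A) * M) powr P"
    using assms by (intro powr_mono2 sum_nonneg) auto
  also have "\<dots> = real (card A) powr P * a i powr P"
    using assms(2) i by (simp add: powr_mult)
  also have "\<dots> \<le> real (card A) powr P * (\<Sum>i\<in>A. a i powr P)"
    using assms(1) i by (intro mult_left_mono member_le_sum) auto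
  finally show ?thesis .
qed simp

text \<open>Subtracting half of \<open>T\<close> requires it to be finite; membership of the
  coefficients in the sequence space enters the lower bound here.\<close>

lemma ennreal_absorb_half:
  fixes T a :: ennreal
  assumes "T \<le> a + ennreal (1 / 2) * T" "T < \<infinity>"
  shows "T \<le> 2 * a"
proof (cases a)
  case (real r)
  obtain t where t: "T = ennreal t" "t \<ge> 0" using assms(2) by (cases T) auto
  have "ennreal (1 / 2) * T = ennreal (1 / 2 * t)"
    unfolding t(1) using t(2) by (intro ennreal_mult[symmetric]) auto
  moreover have "ennreal r + ennreal (1 / 2 * t) = ennreal (r + 1 / 2 * t)"
    using t(2) real by (intro ennreal_plus[symmetric]) auto
  ultimately have "ennreal t \<le> ennreal (r + 1 / 2 * t)"
    using assms(1) t(1) real by simp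
  then have "t \<le> r + 1 / 2 * t" using t real by (subst (asm) ennreal_le_iff) auto
  then have "ennreal t \<le> ennreal (2 * r)" by (intro ennreal_leI) simp
  then show ?thesis using t real by (simp add: ennreal_mult)
qed (simp add: ennreal_mult_top)

lemma card_close_le:
  fixes S :: "int set"
  assumes "\<And>k k'. k \<in> S \<Longrightarrow> k' \<in> S \<Longrightarrow> \<bar>k - k'\<bar> \<le> int M"
  shows "finite S" "card S \<le> 2 * M + 1"
proof -
  have "finite S \<and> card S \<le> 2 * M + 1"
  proof (cases "S = {}")
    case False
    then obtain k0 where k0: "k0 \<in> S" by auto
    have sub: "S \<subseteq> {k0 - int M..k0 + int M}" using assms[OF k0] by force
    have "card S \<le> card {k0 - int M..k0 + int M}" by (rule card_mono[OF _ sub]) simp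
    then show ?thesis using finite_subset[OF sub] by simp
  qed simp
  then show "finite S" "card S \<le> 2 * M + 1" by auto
qed

lemma floor_fibre_card:
  assumes gs: "gap_seq m \<delta> g x \<mu>"
  shows "finite {k. \<lfloor>x k\<rfloor> = l}" "card {k. \<lfloor>x k\<rfloor> = l} \<le> 2 * nat \<lceil>1 / \<delta>\<rceil> + 1"
proof -
  have d: "\<delta> > 0" using gs by (simp add: gap_seq_def)
  have le: "k - k' \<le> \<lceil>1 / \<delta>\<rceil>" if "\<lfloor>x k\<rfloor> = \<lfloor>x k'\<rfloor>" for k k'
  proof (cases "k' \<le> k")
    case True
    have "\<delta> * of_int (k - k') \<le> x k - x k'" by (rule gap_seq_diff(1)[OF gs True])
    also have "\<dots> \<le> 1" using that by linarith
    finally have "of_int (k - k') \<le> 1 / \<delta>" using d by (simp add: field_simps)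
    then show ?thesis by linarith
  next
    case False
    have "0 < 1 / \<delta>" using d by simp
    then have "0 \<le> \<lceil>1 / \<delta>\<rceil>" by linarith
    then show ?thesis using False by linarith
  qed
  have "\<bar>k - k'\<bar> \<le> int (nat \<lceil>1 / \<delta>\<rceil>)" if "k \<in> {k. \<lfloor>x k\<rfloor> = l}" "k' \<in> {k. \<lfloor>x k\<rfloor> = l}" for k k'
    using le[of k k'] le[of k' k] that by (simp only: mem_Collect_eq) linarith
  from card_close_le[OF this]
  show "finite {k. \<lfloor>x k\<rfloor> = l}" "card {k. \<lfloor>x k\<rfloor> = l} \<le> 2 * nat \<lceil>1 / \<delta>\<rceil> + 1" by blast+
qed

section \<open>Comparison of coefficients, samples and norms\<close>

context peb
begin

definition series :: "(int \<Rightarrow> complex) \<Rightarrow> real \<Rightarrow> complex" where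
  "series c = (\<lambda>x. \<Sum>\<^sub>\<infinity>l\<in>UNIV. c l * complex_of_real (\<phi> (x - of_int l)))"

definition coeff_pow :: "real \<Rightarrow> (int \<Rightarrow> complex) \<Rightarrow> ennreal" where
  "coeff_pow P c = (\<integral>\<^sup>+l. ennreal (norm (c l) powr P) \<partial>count_space UNIV)"

lemma series_measurable [measurable]: "series c \<in> borel_measurable borel"
  by (rule borel_measurable_continuous_onI[OF series_continuous[OF series_def]])

lemma series_bound:
  obtains B where "B > 0" "\<And>s c x. s \<le> m - 2 \<Longrightarrow> norm (nderiv s (series c) x) \<le> B * (\<Sum>l\<in>active x. norm (c l))"
proof -
  obtain B where B: "B > 0" "\<And>s z. s \<le> m - 2 \<Longrightarrow> \<bar>nderiv s \<phi> z\<bar> \<le> B" by (rule nderiv_bound) blast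
  have "norm (nderiv s (series c) x) \<le> B * (\<Sum>l\<in>active x. norm (c l))" if "s \<le> m - 2" for s c x
    unfolding series_nderiv[OF series_def that] by (rule active_bound[OF B(2)[OF that]])
  with B(1) that show ?thesis by blast
qed

lemma series_stability:
  obtains \<eta> where "\<eta> > 0" "\<And>c l. \<exists>s t. of_int l \<le> s \<and> t \<le> of_int l + 1 \<and> s + \<eta> \<le> t \<and>
     (\<forall>u\<in>{s..<t}. \<eta> * (\<Sum>j\<in>active u. norm (c j)) \<le> norm (series c u))"
proof -
  obtain \<eta> where eta: "\<eta> > 0" "\<And>(c :: int \<Rightarrow> complex) l. \<exists>s t. of_int l \<le> s \<and> t \<le> of_int l + 1 \<and> s + \<eta> \<le> t \<and>
     (\<forall>x\<in>{s..<t}. \<eta> * (\<Sum>j\<in>active x. norm (c j)) \<le> norm (\<Sum>j\<in>active x. \<phi> (x - of_int j) *\<^sub>R c j))"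
    by (rule stability) blast
  have "series c u = (\<Sum>j\<in>active u. \<phi> (u - of_int j) *\<^sub>R c j)" for c u
    using series_nderiv[OF series_def, of 0 c u] by simp
  with eta that show ?thesis by metis
qed

text \<open>All points of a knot interval share their m active coefficients. These bound the
  derivatives from above and, by stability, the values on a subinterval from below. The subinterval
  is independent of \<open>s\<close> and \<open>x\<close>.\<close>

lemma samples_dominated:
  obtains D \<eta> where "D > 0" "\<eta> > 0"
    "\<And>c l. \<exists>s0 t0. of_int l \<le> s0 \<and> t0 \<le> of_int l + 1 \<and> s0 + \<eta> \<le> t0 \<and>
       (\<forall>u\<in>{s0..<t0}. \<forall>s\<le>m - 2. \<forall>x. \<lfloor>x\<rfloor> = l \<longrightarrow> norm (nderiv s (series c) x) \<le> D * norm (series c u))"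
proof -
  obtain B where B: "B > 0" "\<And>s c x. s \<le> m - 2 \<Longrightarrow> norm (nderiv s (series c) x) \<le> B * (\<Sum>l\<in>active x. norm (c l))"
    by (rule series_bound) blast
  obtain \<eta> where eta: "\<eta> > 0" "\<And>c l. \<exists>s t. of_int l \<le> s \<and> t \<le> of_int l + 1 \<and> s + \<eta> \<le> t \<and>
     (\<forall>u\<in>{s..<t}. \<eta> * (\<Sum>j\<in>active u. norm (c j)) \<le> norm (series c u))"
    by (rule series_stability) blast
  have "\<exists>s0 t0. of_int l \<le> s0 \<and> t0 \<le> of_int l + 1 \<and> s0 + \<eta> \<le> t0 \<and>
       (\<forall>u\<in>{s0..<t0}. \<forall>s\<le>m - 2. \<forall>x. \<lfloor>x\<rfloor> = l \<longrightarrow> norm (nderiv s (series c) x) \<le> B / \<eta> * norm (series c u))"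
    for c l
  proof -
    obtain s0 t0 where st: "of_int l \<le> s0" "t0 \<le> of_int l + 1" "s0 + \<eta> \<le> t0"
      "\<And>u. u \<in> {s0..<t0} \<Longrightarrow> \<eta> * (\<Sum>j\<in>active u. norm (c j)) \<le> norm (series c u)"
      using eta(2)[of l c] by blast
    have "norm (nderiv s (series c) x) \<le> B / \<eta> * norm (series c u)"
      if u: "u \<in> {s0..<t0}" and s: "s \<le> m - 2" and x: "\<lfloor>x\<rfloor> = l" for u s x
    proof -
      have "\<lfloor>u\<rfloor> = l" using u st by (auto simp: floor_eq_iff)
      then have "active x = active u" using x by (simp add: active_def)
      then have "norm (nderiv s (series c) x) \<le> B * (\<Sum>j\<in>active u. norm (c j))" using B(2)[OF s, of c x] by simp
      also have "\<dots> = B / \<eta> * (\<eta> * (\<Sum>j\<in>active u. norm (c j)))" using eta(1) by simp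
      also have "\<dots> \<le> B / \<eta> * norm (series c u)"
        using st(4)[OF u] B(1) eta(1) by (intro mult_left_mono) auto
      finally show ?thesis .
    qed
    with st(1-3) show ?thesis by blast
  qed
  moreover have "B / \<eta> > 0" using B eta by simp
  ultimately show ?thesis using that[of "B / \<eta>" \<eta>] eta(1) by blast
qed

lemma Lp_le_coeff:
  assumes P: "P \<ge> 1"
  obtains B where "B > 0"
    "\<And>c. (\<integral>\<^sup>+x. ennreal (norm (series c x) powr P) \<partial>lborel) \<le> ennreal B * coeff_pow P c"
proof -
  obtain B where B: "B > 0" "\<And>s c x. s \<le> m - 2 \<Longrightarrow> norm (nderiv s (series c) x) \<le> B * (\<Sum>l\<in>active x. norm (c l))"
    by (rule series_bound) blast
  define D where "D = (B * real m) powr P"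
  have D: "D > 0" using B(1) m2 by (simp add: D_def)
  have "(\<integral>\<^sup>+x. ennreal (norm (series c x) powr P) \<partial>lborel) \<le> ennreal (D * real m) * coeff_pow P c" for c
  proof -
    \<comment> \<open>As a set of indices this has m elements, as a set of points it has length m;
      Tonelli's theorem passes from one view to the other.\<close>
    have act: "indicator {of_int l..<of_int l + real m} x = (indicator (active x) l :: ennreal)" for l x
      using floor_less_iff[of x "l + int m"] by (auto simp: indicator_def active_def le_floor_iff)
    have pt: "ennreal (norm (series c x) powr P) \<le>
       (\<integral>\<^sup>+l. ennreal (D * norm (c l) powr P) * indicator {of_int l..<of_int l + real m} x \<partial>count_space UNIV)" for x
    proof -
      have "norm (series c x) powr P \<le> (B * (\<Sum>l\<in>active x. norm (c l))) powr P"
        using B(2)[of 0 c x] P by (intro powr_mono2) auto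
      also have "\<dots> = B powr P * (\<Sum>l\<in>active x. norm (c l)) powr P"
        using B(1) by (simp add: powr_mult sum_nonneg)
      also have "\<dots> \<le> B powr P * (real (card (active x)) powr P * (\<Sum>l\<in>active x. norm (c l) powr P))"
        using P by (intro mult_left_mono powr_sum_le) auto
      also have "\<dots> = (\<Sum>l\<in>active x. D * norm (c l) powr P)"
        using B(1) by (simp add: D_def active_def powr_mult sum_distrib_left mult.assoc)
      finally have "ennreal (norm (series c x) powr P) \<le> (\<Sum>l\<in>active x. ennreal (D * norm (c l) powr P))"
        using D by (subst sum_ennreal) (auto intro!: ennreal_leI)
      then show ?thesis
        unfolding act by (subst nn_integral_count_indicator) auto
    qed
    have "(\<integral>\<^sup>+x. ennreal (norm (series c x) powr P) \<partial>lborel) \<le>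
       (\<integral>\<^sup>+x. \<integral>\<^sup>+l. ennreal (D * norm (c l) powr P) * indicator {of_int l..<of_int l + real m} x \<partial>count_space UNIV \<partial>lborel)"
      by (intro nn_integral_mono pt)
    also have "\<dots> = (\<integral>\<^sup>+l. \<integral>\<^sup>+x. ennreal (D * norm (c l) powr P) * indicator {of_int l..<of_int l + real m} x \<partial>lborel \<partial>count_space UNIV)"
      by (rule nn_integral_count_space_nn_integral) auto
    also have "\<dots> = (\<integral>\<^sup>+l. ennreal (D * real m) * ennreal (norm (c l) powr P) \<partial>count_space UNIV)"
      using D by (intro nn_integral_cong)
        (simp add: nn_integral_cmult_indicator ennreal_mult[symmetric] mult_ac)
    also have "\<dots> = ennreal (D * real m) * coeff_pow P c"
      unfolding coeff_pow_def by (rule nn_integral_cmult) simp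
    finally show ?thesis .
  qed
  moreover have "D * real m > 0" using D m2 by simp
  ultimately show ?thesis using that by blast
qed

definition sample_at :: "real \<Rightarrow> (int \<Rightarrow> real) \<Rightarrow> (int \<Rightarrow> nat) \<Rightarrow> (int \<Rightarrow> complex) \<Rightarrow> int \<Rightarrow> ennreal" where
  "sample_at P x \<mu> c k = (\<Sum>s=0..\<mu> k. ennreal (norm (nderiv s (series c) (x k)) powr P))"

lemma samples_le_Lp:
  assumes gs: "gap_seq m \<delta> g x \<mu>" and P: "P \<ge> 1"
  obtains B where "B > 0" "\<And>c. (\<integral>\<^sup>+k. sample_at P x \<mu> c k \<partial>count_space UNIV) \<le>
      ennreal B * (\<integral>\<^sup>+u. ennreal (norm (series c u) powr P) \<partial>lborel)"
proof -
  obtain D \<eta> where D: "D > 0" "\<eta> > 0"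
    "\<And>c l. \<exists>s0 t0. of_int l \<le> s0 \<and> t0 \<le> of_int l + 1 \<and> s0 + \<eta> \<le> t0 \<and>
       (\<forall>u\<in>{s0..<t0}. \<forall>s\<le>m - 2. \<forall>x. \<lfloor>x\<rfloor> = l \<longrightarrow> norm (nderiv s (series c) x) \<le> D * norm (series c u))"
    by (rule samples_dominated) blast
  \<comment> \<open>A sample is bounded by \<open>D\<close> times the value at each point of an
    interval of length at least \<eta>, hence its power by the mean over that interval.\<close>
  define E where "E = D powr P / \<eta>"
  have E: "E > 0" using D by (simp add: E_def)
  define Q where "Q = 2 * nat \<lceil>1 / \<delta>\<rceil> + 1"
  have mu: "\<mu> k + 2 \<le> m" for k using gs by (auto simp: gap_seq_def)
  have one: "ennreal (norm (nderiv s (series c) (x k)) powr P) \<le>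
     (\<integral>\<^sup>+u. ennreal (E * norm (series c u) powr P) * indicator {k. \<lfloor>x k\<rfloor> = \<lfloor>u\<rfloor>} k \<partial>lborel)" (is "ennreal ?v \<le> ?I")
    if s: "s \<le> \<mu> k" for s c k
  proof -
    obtain s0 t0 where st: "of_int \<lfloor>x k\<rfloor> \<le> s0" "t0 \<le> of_int \<lfloor>x k\<rfloor> + 1" "s0 + \<eta> \<le> t0"
      and le': "\<forall>u\<in>{s0..<t0}. \<forall>s\<le>m - 2. \<forall>y. \<lfloor>y\<rfloor> = \<lfloor>x k\<rfloor> \<longrightarrow> norm (nderiv s (series c) y) \<le> D * norm (series c u)"
      using D(3)[of "\<lfloor>x k\<rfloor>" c] by blast
    have "s \<le> m - 2" using s mu[of k] by linarith
    then have le: "norm (nderiv s (series c) (x k)) \<le> D * norm (series c u)" if "u \<in> {s0..<t0}" for u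
      using le' that by blast
    have "ennreal ?v = ennreal (?v / \<eta> * \<eta>)" using D by simp
    also have "\<dots> \<le> ennreal (?v / \<eta> * (t0 - s0))"
      using st D by (intro ennreal_leI mult_left_mono) auto
    also have "\<dots> = (\<integral>\<^sup>+u. ennreal (?v / \<eta>) * indicator {s0..<t0} u \<partial>lborel)"
      using st D by (simp add: nn_integral_cmult_indicator ennreal_mult[symmetric])
    also have "\<dots> \<le> ?I"
    proof (rule nn_integral_mono)
      fix u
      show "ennreal (?v / \<eta>) * indicator {s0..<t0} u \<le> ennreal (E * norm (series c u) powr P) * indicator {k. \<lfloor>x k\<rfloor> = \<lfloor>u\<rfloor>} k"
      proof (cases "u \<in> {s0..<t0}")
        case True
        have "?v \<le> (D * norm (series c u)) powr P" using le[OF True] P by (intro powr_mono2) auto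
        also have "\<dots> = D powr P * norm (series c u) powr P" using D by (simp add: powr_mult)
        finally have "?v / \<eta> \<le> E * norm (series c u) powr P"
          using D by (simp add: E_def divide_right_mono)
        moreover have "\<lfloor>u\<rfloor> = \<lfloor>x k\<rfloor>" using True st by (auto simp: floor_eq_iff)
        ultimately show ?thesis using True by (auto intro: ennreal_leI)
      qed simp
    qed
    finally show ?thesis .
  qed
  have fl: "(\<lambda>u::real. ennreal (E * norm (series c u) powr P) * indicator {k. \<lfloor>x k\<rfloor> = \<lfloor>u\<rfloor>} k) \<in> borel_measurable lborel" for c k
  proof -
    have "(\<lambda>u::real. indicator {k. \<lfloor>x k\<rfloor> = \<lfloor>u\<rfloor>} k :: ennreal) = indicator {of_int \<lfloor>x k\<rfloor>..<of_int \<lfloor>x k\<rfloor> + 1}"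
    proof
      fix u :: real
      show "(indicator {k. \<lfloor>x k\<rfloor> = \<lfloor>u\<rfloor>} k :: ennreal) = indicator {of_int \<lfloor>x k\<rfloor>..<of_int \<lfloor>x k\<rfloor> + 1} u"
        using floor_eq_iff[of u "\<lfloor>x k\<rfloor>"] by (auto simp: indicator_def)
    qed
    then have "(\<lambda>u::real. indicator {k. \<lfloor>x k\<rfloor> = \<lfloor>u\<rfloor>} k :: ennreal) \<in> borel_measurable lborel" by simp
    then show ?thesis by measurable
  qed
  have "(\<integral>\<^sup>+k. sample_at P x \<mu> c k \<partial>count_space UNIV) \<le>
      ennreal (real m * E * real Q) * (\<integral>\<^sup>+u. ennreal (norm (series c u) powr P) \<partial>lborel)" for c
  proof -
    let ?J = "\<lambda>k. \<integral>\<^sup>+u. ennreal (E * norm (series c u) powr P) * indicator {k. \<lfloor>x k\<rfloor> = \<lfloor>u\<rfloor>} k \<partial>lborel"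
    have "sample_at P x \<mu> c k \<le> of_nat m * ?J k" for k
    proof -
      have "sample_at P x \<mu> c k \<le> of_nat (card {0..\<mu> k}) * ?J k"
        unfolding sample_at_def by (intro sum_bounded_above one) auto
      also have "\<dots> \<le> of_nat m * ?J k"
        using mu[of k] by (intro mult_right_mono of_nat_mono) auto
      finally show ?thesis .
    qed
    then have "(\<integral>\<^sup>+k. sample_at P x \<mu> c k \<partial>count_space UNIV) \<le> (\<integral>\<^sup>+k. of_nat m * ?J k \<partial>count_space UNIV)"
      by (intro nn_integral_mono)
    also have "\<dots> = of_nat m * (\<integral>\<^sup>+k. ?J k \<partial>count_space UNIV)" by (rule nn_integral_cmult) simp
    finally have S: "(\<integral>\<^sup>+k. sample_at P x \<mu> c k \<partial>count_space UNIV) \<le> of_nat m * (\<integral>\<^sup>+k. ?J k \<partial>count_space UNIV)" .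
    have "(\<integral>\<^sup>+k. ?J k \<partial>count_space UNIV) = (\<integral>\<^sup>+u. \<integral>\<^sup>+k. ennreal (E * norm (series c u) powr P) * indicator {k. \<lfloor>x k\<rfloor> = \<lfloor>u\<rfloor>} k \<partial>count_space UNIV \<partial>lborel)"
      by (rule nn_integral_count_space_nn_integral[symmetric]) (auto intro: fl)
    also have "\<dots> \<le> (\<integral>\<^sup>+u. ennreal (E * real Q) * ennreal (norm (series c u) powr P) \<partial>lborel)"
    proof (rule nn_integral_mono)
      fix u
      have "(\<integral>\<^sup>+k. ennreal (E * norm (series c u) powr P) * indicator {k. \<lfloor>x k\<rfloor> = \<lfloor>u\<rfloor>} k \<partial>count_space UNIV)
         = of_nat (card {k. \<lfloor>x k\<rfloor> = \<lfloor>u\<rfloor>}) * ennreal (E * norm (series c u) powr P)"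
        using nn_integral_count_indicator[OF floor_fibre_card(1)[OF gs, of "\<lfloor>u\<rfloor>"]] by simp
      also have "\<dots> \<le> of_nat Q * ennreal (E * norm (series c u) powr P)"
        using floor_fibre_card(2)[OF gs, of "\<lfloor>u\<rfloor>"] by (intro mult_right_mono of_nat_mono) (auto simp: Q_def)
      also have "\<dots> = ennreal (E * real Q) * ennreal (norm (series c u) powr P)"
        using E by (simp add: ennreal_mult ennreal_of_nat_eq_real_of_nat mult_ac)
      finally show "(\<integral>\<^sup>+k. ennreal (E * norm (series c u) powr P) * indicator {k. \<lfloor>x k\<rfloor> = \<lfloor>u\<rfloor>} k \<partial>count_space UNIV)
         \<le> ennreal (E * real Q) * ennreal (norm (series c u) powr P)" .
    qed
    also have "\<dots> = ennreal (E * real Q) * (\<integral>\<^sup>+u. ennreal (norm (series c u) powr P) \<partial>lborel)"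
      by (rule nn_integral_cmult) measurable
    finally have "of_nat m * (\<integral>\<^sup>+k. ?J k \<partial>count_space UNIV) \<le>
      of_nat m * (ennreal (E * real Q) * (\<integral>\<^sup>+u. ennreal (norm (series c u) powr P) \<partial>lborel))"
      by (rule mult_left_mono) simp
    also have "\<dots> = ennreal (real m * E * real Q) * (\<integral>\<^sup>+u. ennreal (norm (series c u) powr P) \<partial>lborel)"
      using E by (simp add: ennreal_mult ennreal_of_nat_eq_real_of_nat mult_ac)
    finally show ?thesis using S by (rule order.trans[rotated])
  qed
  moreover have "real m * E * real Q > 0" using m2 E by (simp add: Q_def)
  ultimately show ?thesis using that by blast
qed

text \<open>The order of the quantifiers matters: \<open>N\<close> and \<open>F\<close> are fixed
  before \<epsilon>, which will be chosen in terms of the size of \<open>F\<close>.\<close>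

lemma coeff_estimate:
  assumes gs: "gap_seq m \<delta> g x \<mu>" and g: "g < 1"
  obtains N F where "finite F" "F \<noteq> {}"
    "\<And>\<epsilon>. \<epsilon> > 0 \<Longrightarrow> \<exists>C>0. \<forall>c l.
     (\<exists>k s. - real N < x k - of_int l \<and> x k - of_int l < real N + 1 \<and> s \<le> \<mu> k \<and>
        norm (c l) \<le> C * norm (nderiv s (series c) (x k))) \<or>
     (\<exists>j\<in>F. norm (c l) \<le> \<epsilon> * norm (c (l + j)))"
proof -
  have g0: "g > 0" and mu: "\<And>k. \<mu> k + 2 \<le> m" using gs by (auto simp: gap_seq_def)
  have pos: "1 / g - 1 > 0" using g g0 by simp
  obtain N where "2 * real m < real N * (1 / g - 1)" using reals_Archimedean3[OF pos] by blast
  then have N: "2 * real m < (real N + 1) * (1 / g - 1)" using pos by (simp add: distrib_right)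
  \<comment> \<open>Large enough to contain, relative to \<open>l\<close>, the active indices of
    every sample in the window around \<open>l\<close>.\<close>
  define F where "F = {- (int N + int m)..int N + int m}"
  have F: "finite F" "{1 - int m..0} \<subseteq> F" by (auto simp: F_def)
  have "\<exists>C>0. \<forall>c l.
     (\<exists>k s. - real N < x k - of_int l \<and> x k - of_int l < real N + 1 \<and> s \<le> \<mu> k \<and>
        norm (c l) \<le> C * norm (nderiv s (series c) (x k))) \<or>
     (\<exists>j\<in>F. norm (c l) \<le> \<epsilon> * norm (c (l + j)))" if eps: "\<epsilon> > 0" for \<epsilon>
  proof -
    obtain C where C: "C > 0" "\<And>(l :: int) (d :: int \<Rightarrow> complex).
     (\<exists>k s. - real N < x k - of_int l \<and> x k - of_int l < real N + 1 \<and> s \<le> \<mu> k \<and>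
        norm (d 0) \<le> C * norm (\<Sum>j\<in>F. nderiv s \<phi> (x k - of_int l - of_int j) *\<^sub>R d j)) \<or>
     (\<exists>j\<in>F. norm (d 0) \<le> \<epsilon> * norm (d j))"
      by (rule local_estimate[OF gs g N eps F]) blast
    have "(\<Sum>j\<in>F. nderiv s \<phi> (x k - of_int l - of_int j) *\<^sub>R c (l + j)) = nderiv s (series c) (x k)"
      if w: "- real N < x k - of_int l" "x k - of_int l < real N + 1" and s: "s \<le> \<mu> k" for k s c l
    proof -
      have s': "s \<le> m - 2" using s mu[of k] by linarith
      have inj: "inj_on (\<lambda>j. l + j) F" by (auto simp: inj_on_def)
      have "l - int N \<le> \<lfloor>x k\<rfloor>" "\<lfloor>x k\<rfloor> \<le> l + int N" using w by linarith+
      then have act: "active (x k) \<subseteq> (\<lambda>j. l + j) ` F" by (auto simp: active_def F_def)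
      have "(\<Sum>j\<in>F. nderiv s \<phi> (x k - of_int l - of_int j) *\<^sub>R c (l + j)) =
        (\<Sum>i\<in>(\<lambda>j. l + j) ` F. nderiv s \<phi> (x k - of_int i) *\<^sub>R c i)"
        unfolding sum.reindex[OF inj] by (simp add: o_def algebra_simps)
      also have "\<dots> = nderiv s (series c) (x k)"
        unfolding series_nderiv[OF series_def s'] using F by (intro active_sum[OF s' act]) auto
      finally show ?thesis .
    qed
    note eq = this
    show ?thesis
    proof (intro exI[of _ C] conjI C(1) allI)
      fix c l
      from C(2)[of l "\<lambda>j. c (l + j)"] show "(\<exists>k s. - real N < x k - of_int l \<and> x k - of_int l < real N + 1 \<and> s \<le> \<mu> k \<and>
        norm (c l) \<le> C * norm (nderiv s (series c) (x k))) \<or>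
       (\<exists>j\<in>F. norm (c l) \<le> \<epsilon> * norm (c (l + j)))"
      proof (elim disjE exE conjE)
        fix k s assume w: "- real N < x k - of_int l" "x k - of_int l < real N + 1" "s \<le> \<mu> k"
          and le: "norm (c (l + 0)) \<le> C * norm (\<Sum>j\<in>F. nderiv s \<phi> (x k - of_int l - of_int j) *\<^sub>R c (l + j))"
        show ?thesis using w le unfolding eq[OF w] by (intro disjI1 exI[of _ k] exI[of _ s]) simp
      next
        assume "\<exists>j\<in>F. norm (c (l + 0)) \<le> \<epsilon> * norm (c (l + j))"
        then show ?thesis by simp
      qed
    qed
  qed
  moreover have "F \<noteq> {}" by (simp add: F_def)
  ultimately show ?thesis using that F(1) by blast
qed

lemma coeff_pow_finite:
  assumes "(\<lambda>l. norm (c l) powr P) summable_on UNIV"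
  shows "coeff_pow P c < \<infinity>"
proof -
  have "coeff_pow P c = (\<Sum>\<^sub>\<infinity>l\<in>UNIV. ennreal (norm (c l) powr P))"
    unfolding coeff_pow_def by (rule infsum_eq_nn_integral[symmetric])
  also have "\<dots> = (SUP F\<in>{F. finite F \<and> F \<subseteq> UNIV}. \<Sum>l\<in>F. ennreal (norm (c l) powr P))"
    by (rule nonneg_infsum_complete) simp
  also have "\<dots> \<le> ennreal (\<Sum>\<^sub>\<infinity>l\<in>UNIV. norm (c l) powr P)"
  proof (rule SUP_least)
    fix F :: "int set" assume "F \<in> {F. finite F \<and> F \<subseteq> UNIV}"
    then have "(\<Sum>l\<in>F. norm (c l) powr P) \<le> (\<Sum>\<^sub>\<infinity>l\<in>UNIV. norm (c l) powr P)"
      by (intro finite_sum_le_infsum assms) auto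
    then show "(\<Sum>l\<in>F. ennreal (norm (c l) powr P)) \<le> ennreal (\<Sum>\<^sub>\<infinity>l\<in>UNIV. norm (c l) powr P)"
      by (subst sum_ennreal) (auto intro: ennreal_leI)
  qed
  also have "\<dots> < \<infinity>" by simp
  finally show ?thesis .
qed

lemma coeff_le_samples:
  assumes gs: "gap_seq m \<delta> g x \<mu>" and g: "g < 1" and P: "P \<ge> 1"
  obtains B where "B > 0" "\<And>c. coeff_pow P c < \<infinity> \<Longrightarrow>
      coeff_pow P c \<le> ennreal B * (\<integral>\<^sup>+k. sample_at P x \<mu> c k \<partial>count_space UNIV)"
proof -
  obtain N F where F: "finite F" "F \<noteq> {}" and est: "\<And>\<epsilon>. \<epsilon> > 0 \<Longrightarrow> \<exists>C>0. \<forall>c l.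
     (\<exists>k s. - real N < x k - of_int l \<and> x k - of_int l < real N + 1 \<and> s \<le> \<mu> k \<and>
        norm (c l) \<le> C * norm (nderiv s (series c) (x k))) \<or>
     (\<exists>j\<in>F. norm (c l) \<le> \<epsilon> * norm (c (l + j)))"
    by (rule coeff_estimate[OF gs g]) blast
  \<comment> \<open>Each of the shifted sums over \<open>F\<close> equals the full coefficient sum,
    so together they contribute one half of it. As \<epsilon> \<le> 1 and P \<ge> 1, passing to P-th
    powers does no harm.\<close>
  define \<epsilon> where "\<epsilon> = 1 / (2 * real (card F))"
  have cF: "real (card F) \<ge> 1" using F by (simp add: Suc_leI card_gt_0_iff)
  have eps: "\<epsilon> > 0" "\<epsilon> \<le> 1" "real (card F) * \<epsilon> = 1 / 2"
    using cF by (auto simp: \<epsilon>_def field_simps)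
  obtain C where C: "C > 0" "\<And>c l.
     (\<exists>k s. - real N < x k - of_int l \<and> x k - of_int l < real N + 1 \<and> s \<le> \<mu> k \<and>
        norm (c l) \<le> C * norm (nderiv s (series c) (x k))) \<or>
     (\<exists>j\<in>F. norm (c l) \<le> \<epsilon> * norm (c (l + j)))"
    using est[OF eps(1)] by blast
  \<comment> \<open>Contains every \<open>l\<close> whose window contains the k-th sample, so each
    sample is charged at most 2N + 1 times.\<close>
  define W where "W k = {\<lfloor>x k\<rfloor> - int N..\<lfloor>x k\<rfloor> + int N}" for k
  define E where "E = C powr P"
  have E: "E > 0" using C by (simp add: E_def)
  have pt: "ennreal (norm (c l) powr P) \<le>
      (\<integral>\<^sup>+k. ennreal E * sample_at P x \<mu> c k * indicator (W k) l \<partial>count_space UNIV) +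
      (\<Sum>j\<in>F. ennreal \<epsilon> * ennreal (norm (c (l + j)) powr P))" (is "_ \<le> ?A + ?B") for c l
    using C(2)[of l c]
  proof (elim disjE exE conjE bexE)
    fix k s assume w: "- real N < x k - of_int l" "x k - of_int l < real N + 1" "s \<le> \<mu> k"
      and le: "norm (c l) \<le> C * norm (nderiv s (series c) (x k))"
    have lW: "l \<in> W k" using w unfolding W_def by (simp only: atLeastAtMost_iff) linarith
    have "norm (c l) powr P \<le> (C * norm (nderiv s (series c) (x k))) powr P"
      using le P by (intro powr_mono2) auto
    also have "\<dots> = E * norm (nderiv s (series c) (x k)) powr P" using C by (simp add: E_def powr_mult)
    finally have "ennreal (norm (c l) powr P) \<le> ennreal E * ennreal (norm (nderiv s (series c) (x k)) powr P)"
      using E by (simp add: ennreal_mult[symmetric] ennreal_leI)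
    also have "\<dots> \<le> ennreal E * sample_at P x \<mu> c k"
      unfolding sample_at_def using w(3) by (intro mult_left_mono member_le_sum) auto
    also have "\<dots> = (\<Sum>k\<in>{k}. ennreal E * sample_at P x \<mu> c k * indicator (W k) l)" using lW by simp
    also have "\<dots> \<le> ?A" by (rule sum_le_nn_integral_count) simp
    also have "\<dots> \<le> ?A + ?B" by simp
    finally show ?thesis .
  next
    fix j assume j: "j \<in> F" and le: "norm (c l) \<le> \<epsilon> * norm (c (l + j))"
    have "norm (c l) powr P \<le> (\<epsilon> * norm (c (l + j))) powr P"
      using le P by (intro powr_mono2) auto
    also have "\<dots> = \<epsilon> powr P * norm (c (l + j)) powr P" using eps by (simp add: powr_mult)
    also have "\<dots> \<le> \<epsilon> * norm (c (l + j)) powr P"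
      using eps P powr_mono'[of 1 P \<epsilon>] by (intro mult_right_mono) auto
    finally have "ennreal (norm (c l) powr P) \<le> ennreal \<epsilon> * ennreal (norm (c (l + j)) powr P)"
      using eps by (simp add: ennreal_mult[symmetric] ennreal_leI)
    also have "\<dots> \<le> ?B" using F(1) j by (intro member_le_sum) auto
    also have "\<dots> \<le> ?A + ?B" by simp
    finally show ?thesis .
  qed
  have "coeff_pow P c \<le> ennreal (2 * (E * real (2 * N + 1))) * (\<integral>\<^sup>+k. sample_at P x \<mu> c k \<partial>count_space UNIV)"
    if fin: "coeff_pow P c < \<infinity>" for c
  proof -
    let ?S = "\<integral>\<^sup>+k. sample_at P x \<mu> c k \<partial>count_space UNIV"
    have "(\<integral>\<^sup>+l. \<integral>\<^sup>+k. ennreal E * sample_at P x \<mu> c k * indicator (W k) l \<partial>count_space UNIV \<partial>count_space UNIV)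
       = (\<integral>\<^sup>+k. \<integral>\<^sup>+l. ennreal E * sample_at P x \<mu> c k * indicator (W k) l \<partial>count_space UNIV \<partial>count_space UNIV)"
      by (rule nn_integral_count_space_nn_integral) auto
    also have "\<dots> = (\<integral>\<^sup>+k. ennreal (E * real (2 * N + 1)) * sample_at P x \<mu> c k \<partial>count_space UNIV)"
    proof (rule nn_integral_cong)
      fix k
      have "(\<integral>\<^sup>+l. ennreal E * sample_at P x \<mu> c k * indicator (W k) l \<partial>count_space UNIV)
        = of_nat (card (W k)) * (ennreal E * sample_at P x \<mu> c k)"
        by (subst nn_integral_count_indicator) (auto simp: W_def)
      also have "card (W k) = 2 * N + 1" by (simp add: W_def)
      also have "of_nat (2 * N + 1) * (ennreal E * sample_at P x \<mu> c k) = ennreal (E * real (2 * N + 1)) * sample_at P x \<mu> c k"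
      proof -
        have "ennreal (E * real (2 * N + 1)) = ennreal E * ennreal (real (2 * N + 1))"
          using E by (intro ennreal_mult) auto
        then show ?thesis by (simp only: ennreal_of_nat_eq_real_of_nat mult_ac)
      qed
      finally show "(\<integral>\<^sup>+l. ennreal E * sample_at P x \<mu> c k * indicator (W k) l \<partial>count_space UNIV)
        = ennreal (E * real (2 * N + 1)) * sample_at P x \<mu> c k" .
    qed
    also have "\<dots> = ennreal (E * real (2 * N + 1)) * ?S" by (rule nn_integral_cmult) simp
    finally have A: "(\<integral>\<^sup>+l. \<integral>\<^sup>+k. ennreal E * sample_at P x \<mu> c k * indicator (W k) l \<partial>count_space UNIV \<partial>count_space UNIV)
       = ennreal (E * real (2 * N + 1)) * ?S" .
    have shift: "(\<integral>\<^sup>+l. ennreal (norm (c (l + j)) powr P) \<partial>count_space UNIV) = coeff_pow P c" for j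
    proof -
      have "bij_betw (\<lambda>l. l + j) UNIV UNIV" by (rule bij_betwI[of _ _ _ "\<lambda>l. l - j"]) auto
      from nn_integral_bij_count_space[OF this, of "\<lambda>l. ennreal (norm (c l) powr P)"]
      show ?thesis by (simp add: coeff_pow_def)
    qed
    have "(\<integral>\<^sup>+l. (\<Sum>j\<in>F. ennreal \<epsilon> * ennreal (norm (c (l + j)) powr P)) \<partial>count_space UNIV)
      = (\<Sum>j\<in>F. ennreal \<epsilon> * coeff_pow P c)"
      by (subst nn_integral_sum) (auto simp: nn_integral_cmult shift)
    also have "\<dots> = ennreal (real (card F) * \<epsilon>) * coeff_pow P c"
      using eps(1) by (simp add: ennreal_mult ennreal_of_nat_eq_real_of_nat mult.assoc)
    finally have B: "(\<integral>\<^sup>+l. (\<Sum>j\<in>F. ennreal \<epsilon> * ennreal (norm (c (l + j)) powr P)) \<partial>count_space UNIV)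
      = ennreal (1 / 2) * coeff_pow P c" unfolding eps(3) .
    have "coeff_pow P c \<le> ennreal (E * real (2 * N + 1)) * ?S + ennreal (1 / 2) * coeff_pow P c"
      unfolding A[symmetric] B[symmetric]
      unfolding coeff_pow_def by (subst nn_integral_add[symmetric]) (auto intro!: nn_integral_mono pt)
    from ennreal_absorb_half[OF this fin] show ?thesis
      using E by (simp add: ennreal_mult mult.assoc)
  qed
  moreover have "2 * (E * real (2 * N + 1)) > 0" using E by simp
  ultimately show ?thesis using that by blast
qed

lemma sampling_finite:
  assumes gs: "gap_seq m \<delta> g x (\<lambda>k. \<mu> (x k))" and g: "g < 1" and P: "P \<ge> 1"
  shows "sampling_set (ereal P) \<phi> (range x) \<mu>"
proof -
  let ?S = "\<lambda>c. \<integral>\<^sup>+k. sample_at P x (\<lambda>k. \<mu> (x k)) c k \<partial>count_space UNIV"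
  let ?L = "\<lambda>c. \<integral>\<^sup>+u. ennreal (norm (series c u) powr P) \<partial>lborel"
  obtain B1 where B1: "B1 > 0" "\<And>c. ?S c \<le> ennreal B1 * ?L c"
    by (rule samples_le_Lp[OF gs P]) blast
  obtain B2 where B2: "B2 > 0" "\<And>c. ?L c \<le> ennreal B2 * coeff_pow P c"
    by (rule Lp_le_coeff[OF P]) blast
  obtain B3 where B3: "B3 > 0" "\<And>c. coeff_pow P c < \<infinity> \<Longrightarrow> coeff_pow P c \<le> ennreal B3 * ?S c"
    by (rule coeff_le_samples[OF gs g P]) blast
  have inj: "inj x" using gap_seq_strict_mono[OF gs] by (rule strict_mono_imp_inj_on)
  have S: "sample_pow (ereal P) (range x) \<mu> (series c) = ?S c" for c
    unfolding sample_pow_def sample_at_def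
    by (simp add: infsum_reindex[OF inj] o_def infsum_eq_nn_integral)
  have L: "Lp_pow (ereal P) (series c) = ?L c" for c by (simp add: Lp_pow_def)
  have "ennreal (1 / (B2 * B3)) * ?L c \<le> ?S c \<and> ?S c \<le> ennreal B1 * ?L c" if "coeff_pow P c < \<infinity>" for c
  proof
    have "?L c \<le> ennreal B2 * (ennreal B3 * ?S c)"
      using B2(2)[of c] B3(2)[OF that] by (meson mult_left_mono order_trans zero_le)
    then have "ennreal (1 / (B2 * B3)) * ?L c \<le> ennreal (1 / (B2 * B3)) * (ennreal B2 * (ennreal B3 * ?S c))"
      by (rule mult_left_mono) simp
    also have "\<dots> = ennreal (1 / (B2 * B3) * (B2 * B3)) * ?S c"
      using B2(1) B3(1) by (simp add: ennreal_mult' mult.assoc[symmetric] del: times_divide_eq_left times_divide_eq_right)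
    also have "\<dots> = ?S c" using B2(1) B3(1) by simp
    finally show "ennreal (1 / (B2 * B3)) * ?L c \<le> ?S c" .
  qed (rule B1(2))
  moreover have "\<exists>c. f = series c \<and> coeff_pow P c < \<infinity>" if "f \<in> shift_inv_space (ereal P) \<phi>" for f
    using that coeff_pow_finite unfolding shift_inv_space_def in_lp_def series_def by auto
  ultimately have "\<forall>f\<in>shift_inv_space (ereal P) \<phi>.
      ennreal (1 / (B2 * B3)) * Lp_pow (ereal P) f \<le> sample_pow (ereal P) (range x) \<mu> f \<and>
      sample_pow (ereal P) (range x) \<mu> f \<le> ennreal B1 * Lp_pow (ereal P) f"
    by (metis S L)
  moreover have "1 / (B2 * B3) > 0" using B2(1) B3(1) by simp
  ultimately show ?thesis unfolding sampling_set_def using B1(1) by blast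
qed

lemma sampling_infinite:
  assumes gs: "gap_seq m \<delta> g x (\<lambda>k. \<mu> (x k))" and g: "g < 1"
  shows "sampling_set \<infinity> \<phi> (range x) \<mu>"
proof -
  have mu: "\<mu> (x k) + 2 \<le> m" for k using gs by (auto simp: gap_seq_def)
  obtain D \<eta> where D: "D > 0" "\<eta> > 0"
    "\<And>c l. \<exists>s0 t0. of_int l \<le> s0 \<and> t0 \<le> of_int l + 1 \<and> s0 + \<eta> \<le> t0 \<and>
       (\<forall>u\<in>{s0..<t0}. \<forall>s\<le>m - 2. \<forall>x. \<lfloor>x\<rfloor> = l \<longrightarrow> norm (nderiv s (series c) x) \<le> D * norm (series c u))"
    by (rule samples_dominated) blast
  obtain B where B: "B > 0" "\<And>s c x. s \<le> m - 2 \<Longrightarrow> norm (nderiv s (series c) x) \<le> B * (\<Sum>l\<in>active x. norm (c l))"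
    by (rule series_bound) blast
  obtain N F where F: "finite F" "F \<noteq> {}" and est: "\<And>\<epsilon>. \<epsilon> > 0 \<Longrightarrow> \<exists>C>0. \<forall>c l.
     (\<exists>k s. - real N < x k - of_int l \<and> x k - of_int l < real N + 1 \<and> s \<le> \<mu> (x k) \<and>
        norm (c l) \<le> C * norm (nderiv s (series c) (x k))) \<or>
     (\<exists>j\<in>F. norm (c l) \<le> \<epsilon> * norm (c (l + j)))"
    by (rule coeff_estimate[OF gs g]) blast
  \<comment> \<open>With suprema a single neighbouring coefficient is compared, so one half is small
    enough regardless of the size of \<open>F\<close>.\<close>
  have "(1/2::real) > 0" by simp
  from est[OF this] obtain C where C: "C > 0" "\<And>c l.
     (\<exists>k s. - real N < x k - of_int l \<and> x k - of_int l < real N + 1 \<and> s \<le> \<mu> (x k) \<and>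
        norm (c l) \<le> C * norm (nderiv s (series c) (x k))) \<or>
     (\<exists>j\<in>F. norm (c l) \<le> 1 / 2 * norm (c (l + j)))" by blast
  let ?S = "\<lambda>c. sample_pow \<infinity> (range x) \<mu> (series c)"
  let ?L = "\<lambda>c. esssup lborel (\<lambda>u. ennreal (norm (series c u)))"
  have S: "?S c = (SUP k. SUP s\<in>{0..\<mu> (x k)}. ennreal (norm (nderiv s (series c) (x k))))" for c
    by (simp add: sample_pow_def image_comp)
  have Sge: "ennreal (norm (nderiv s (series c) (x k))) \<le> ?S c" if "s \<le> \<mu> (x k)" for c s k
    unfolding S using that by (intro SUP_upper2[of k] SUP_upper2[of s]) auto
  have upper: "?S c \<le> ennreal D * ?L c" for c
    unfolding S
  proof (intro SUP_least)
    fix k s assume s: "s \<in> {0..\<mu> (x k)}"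
    obtain s0 t0 where st: "s0 + \<eta> \<le> t0"
      and le: "\<forall>u\<in>{s0..<t0}. \<forall>s\<le>m - 2. \<forall>y. \<lfloor>y\<rfloor> = \<lfloor>x k\<rfloor> \<longrightarrow> norm (nderiv s (series c) y) \<le> D * norm (series c u)"
      using D(3)[of "\<lfloor>x k\<rfloor>" c] by blast
    have sm: "s \<le> m - 2" using s mu[of k] by auto
    \<comment> \<open>The subinterval has positive length and so cannot lie in the exceptional null
      set of the essential supremum.\<close>
    have "\<exists>u\<in>{s0..<t0}. ennreal (norm (series c u)) \<le> ?L c"
    proof (rule ccontr)
      assume "\<not> ?thesis"
      then have "AE u in lborel. u \<notin> {s0..<t0}"
        using esssup_AE[of "\<lambda>u. ennreal (norm (series c u))" lborel] by (auto elim!: eventually_mono)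
      then have "{s0..<t0} \<in> null_sets lborel" by (subst AE_iff_null_sets) auto
      then show False using st D(2) by (simp add: null_sets_def)
    qed
    then obtain u where u: "u \<in> {s0..<t0}" "ennreal (norm (series c u)) \<le> ?L c" by blast
    have "ennreal (norm (nderiv s (series c) (x k))) \<le> ennreal (D * norm (series c u))"
      using le u(1) sm by (intro ennreal_leI) blast
    also have "\<dots> = ennreal D * ennreal (norm (series c u))" using D(1) by (simp add: ennreal_mult)
    also have "\<dots> \<le> ennreal D * ?L c" using u(2) by (intro mult_left_mono) auto
    finally show "ennreal (norm (nderiv s (series c) (x k))) \<le> ennreal D * ?L c" .
  qed
  have lower: "?L c \<le> ennreal (B * real m * (2 * C)) * ?S c" if bdd: "bounded (range c)" for c
  proof -
    define M where "M = (SUP l. ennreal (norm (c l)))"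
    have Mge: "ennreal (norm (c l)) \<le> M" for l unfolding M_def by (rule SUP_upper) simp
    obtain b where "\<And>l. norm (c l) \<le> b" using bdd unfolding bounded_iff by auto
    then have "M \<le> ennreal b" unfolding M_def by (intro SUP_least ennreal_leI)
    then have fin: "M < \<infinity>" by (simp add: le_less_trans)
    have "M \<le> ennreal C * ?S c + ennreal (1 / 2) * M"
    proof (subst (1) M_def, rule SUP_least)
      fix l
      show "ennreal (norm (c l)) \<le> ennreal C * ?S c + ennreal (1 / 2) * M"
        using C(2)[of l c]
      proof (elim disjE exE conjE bexE)
        fix k s assume "s \<le> \<mu> (x k)" and le: "norm (c l) \<le> C * norm (nderiv s (series c) (x k))"
        have "ennreal (norm (c l)) \<le> ennreal C * ennreal (norm (nderiv s (series c) (x k)))"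
          using le C(1) by (simp add: ennreal_mult[symmetric] ennreal_leI)
        also have "\<dots> \<le> ennreal C * ?S c" by (intro mult_left_mono Sge \<open>s \<le> \<mu> (x k)\<close>) simp
        also have "\<dots> \<le> ennreal C * ?S c + ennreal (1 / 2) * M" by simp
        finally show ?thesis .
      next
        fix j assume le: "norm (c l) \<le> 1 / 2 * norm (c (l + j))"
        have "ennreal (norm (c l)) \<le> ennreal (1 / 2 * norm (c (l + j)))" by (rule ennreal_leI[OF le])
        also have "\<dots> = ennreal (1 / 2) * ennreal (norm (c (l + j)))" by (rule ennreal_mult) auto
        also have "\<dots> \<le> ennreal (1 / 2) * M" by (intro mult_left_mono Mge) simp
        also have "\<dots> \<le> ennreal C * ?S c + ennreal (1 / 2) * M" by simp
        finally show ?thesis .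
      qed
    qed
    from ennreal_absorb_half[OF this fin] have M: "M \<le> 2 * (ennreal C * ?S c)" .
    have "ennreal (norm (series c u)) \<le> ennreal (B * real m) * M" for u
    proof -
      have "ennreal (norm (series c u)) \<le> ennreal (B * (\<Sum>l\<in>active u. norm (c l)))"
        using B(2)[of 0 c u] by (intro ennreal_leI) simp
      also have "\<dots> = ennreal B * (\<Sum>l\<in>active u. ennreal (norm (c l)))"
        using B(1) by (simp add: ennreal_mult sum_nonneg)
      also have "\<dots> \<le> ennreal B * (of_nat (card (active u)) * M)"
        by (intro mult_left_mono sum_bounded_above Mge) simp
      also have "\<dots> = ennreal (B * real m) * M"
        using B(1) by (simp add: active_def ennreal_mult ennreal_of_nat_eq_real_of_nat mult.assoc)
      finally show ?thesis .
    qed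
    then have "?L c \<le> ennreal (B * real m) * M" by (intro esssup_I) auto
    also have "\<dots> \<le> ennreal (B * real m) * (2 * (ennreal C * ?S c))" using M by (intro mult_left_mono) auto
    also have "\<dots> = ennreal (B * real m * (2 * C)) * ?S c"
      using B(1) C(1) by (simp add: ennreal_mult mult.assoc)
    finally show ?thesis .
  qed
  define A where "A = B * real m * (2 * C)"
  have A: "A > 0" using B C m2 by (simp add: A_def)
  have "ennreal (1 / A) * ?L c \<le> ?S c" if "bounded (range c)" for c
  proof -
    have "ennreal (1 / A) * ?L c \<le> ennreal (1 / A) * (ennreal A * ?S c)"
      using lower[OF that] unfolding A_def by (rule mult_left_mono) simp
    also have "\<dots> = ?S c" using A by (simp add: mult.assoc[symmetric] ennreal_mult[symmetric])
    finally show ?thesis .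
  qed
  moreover have "\<exists>c. f = series c \<and> bounded (range c)" if "f \<in> shift_inv_space \<infinity> \<phi>" for f
    using that unfolding shift_inv_space_def in_lp_def series_def by auto
  moreover have "Lp_pow \<infinity> (series c) = ?L c" for c by (simp add: Lp_pow_def)
  ultimately have "\<forall>f\<in>shift_inv_space \<infinity> \<phi>.
      ennreal (1 / A) * Lp_pow \<infinity> f \<le> sample_pow \<infinity> (range x) \<mu> f \<and>
      sample_pow \<infinity> (range x) \<mu> f \<le> ennreal D * Lp_pow \<infinity> f"
    using upper by metis
  moreover have "1 / A > 0" using A by simp
  ultimately show ?thesis unfolding sampling_set_def using D(1) by blast
qed

end

section \<open>Reduction of the theorem to the local setting\<close>

lemma PEB_spline_imp_peb:
  assumes "PEB_spline m \<phi>" "m \<ge> 2"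
  obtains w \<gamma> G where "peb m \<phi> w \<gamma> G"
proof -
  obtain w \<gamma> G where w: "spline_weights m w \<gamma>" "spline_chain m w \<phi> G"
    by (rule PEB_spline_chain[OF assms]) blast
  have "closure {x. \<phi> x \<noteq> 0} = {0..real m}" "C_k (m - 2) \<phi>" "\<And>x. x \<in> {0<..<real m} \<Longrightarrow> \<phi> x > 0"
    using assms unfolding PEB_spline_def by blast+
  moreover from this have "\<phi> x = 0" if "x \<notin> {0..real m}" for x
    using that closure_subset[of "{x. \<phi> x \<noteq> 0}"] by blast
  ultimately have "peb m \<phi> w \<gamma> G"
    using w assms(2) by unfold_locales (auto simp: less_imp_neq[THEN not_sym])
  then show ?thesis by (rule that)
qed

lemma gap_seq_of_weighted_max_gap:
  assumes sep: "separated (range x)" and sm: "strict_mono x"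
    and mu: "\<forall>y\<in>range x. \<mu> y + 2 \<le> m" and gap: "weighted_max_gap x \<mu> < 1"
  obtains \<delta> g where "gap_seq m \<delta> g x (\<lambda>k. \<mu> (x k))" "g < 1"
proof -
  have pos: "x (k + 1) - x k > 0" for k using sm by (simp add: strict_mono_def)
  have le: "ereal ((x (k + 1) - x k) / (1 + real (\<mu> (x k)))) \<le> weighted_max_gap x \<mu>" for k
    unfolding weighted_max_gap_def by (intro max.coboundedI1 SUP_upper) simp
  \<comment> \<open>It is finite, being below 1 and at least one of its ratios.\<close>
  obtain g where g: "weighted_max_gap x \<mu> = ereal g"
    using gap le[of 0] by (cases "weighted_max_gap x \<mu>") auto
  have ratio: "(x (k + 1) - x k) / (1 + real (\<mu> (x k))) \<le> g" for k using le[of k] g by simp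
  have "0 < (x (0 + 1) - x 0) / (1 + real (\<mu> (x 0)))" by (rule divide_pos_pos[OF pos]) simp
  then have g0: "0 < g" using ratio[of 0] by linarith
  have gk: "x (k + 1) - x k \<le> g * (1 + real (\<mu> (x k)))" for k
    using ratio[of k] by (simp add: pos_divide_le_eq)
  define I where "I = (INF (a, b)\<in>{(a, b). a \<in> range x \<and> b \<in> range x \<and> a \<noteq> b}. ereal \<bar>a - b\<bar>)"
  have "0 < I" using sep unfolding separated_def I_def .
  \<comment> \<open>A real number below the infimum is chosen, since the infimum itself is an
    extended real.\<close>
  then obtain \<delta> where d: "0 < \<delta>" "ereal \<delta> < I" using ereal_dense2[of 0 I] by (auto simp: zero_ereal_def)
  have "\<delta> \<le> x (k + 1) - x k" for k
  proof -
    have "I \<le> ereal \<bar>x (k + 1) - x k\<bar>"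
      unfolding I_def using pos[of k] by (intro INF_lower2[of "(x (k + 1), x k)"]) auto
    with d(2) have "ereal \<delta> \<le> ereal \<bar>x (k + 1) - x k\<bar>" by (rule less_imp_le[OF less_le_trans])
    then show ?thesis using pos[of k] by simp
  qed
  then have "gap_seq m \<delta> g x (\<lambda>k. \<mu> (x k))" unfolding gap_seq_def using d g0 gk mu by auto
  moreover have "g < 1" using gap g by simp
  ultimately show ?thesis by (rule that)
qed

theorem theorem1p3:
  fixes m :: nat and \<phi> :: "real \<Rightarrow> real"
    and X :: "real set" and x :: "int \<Rightarrow> real" and \<mu> :: "real \<Rightarrow> nat" and p :: ereal
  assumes "PEB_spline m \<phi>"
    and "separated X"
    and "strict_mono x" and "X = range x"
    and "\<forall>y\<in>X. \<mu> y + 2 \<le> m"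
    and "weighted_max_gap x \<mu> < 1"
    and "1 \<le> p"
  shows "sampling_set p \<phi> X \<mu>"
proof -
  \<comment> \<open>The sequence is bi-infinite, so a sample exists and its multiplicity bound
    excludes m = 1.\<close>
  have "\<mu> (x 0) + 2 \<le> m" using assms(4,5) by auto
  then have m: "m \<ge> 2" by simp
  obtain w \<gamma> G where "peb m \<phi> w \<gamma> G" by (rule PEB_spline_imp_peb[OF assms(1) m])
  then interpret peb m \<phi> w \<gamma> G .
  obtain \<delta> g where gs: "gap_seq m \<delta> g x (\<lambda>k. \<mu> (x k))" "g < 1"
    using gap_seq_of_weighted_max_gap[of x \<mu> m] assms by blast
  show ?thesis
  proof (cases p)
    case (real P)
    then show ?thesis using sampling_finite[OF gs, of P] assms(4,7) by simp
  next
    case PInf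
    then show ?thesis using sampling_infinite[OF gs] assms(4) by simp
  qed (use assms(7) in simp)
qed

end
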